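(* If $G$ is a 2-generated prosoluble group, then the graph $\Delta(G)$ is connected and $\operatorname{diam}(\Delta(G))\leq 3$.
   Context: A prosoluble group is a profinite group that is an inverse limit of finite soluble groups. For a profinite group $G$, generation is meant topologically: $\langle X\rangle = G$ means that the abstract subgroup generated by $X$ is dense in $G$. $G$ is 2-generated if $G=\langle a,b\rangle$ for some $a,b\in G$. The generating graph $\Gamma(G)$ has vertex set $G$, with two elements $x,y$ adjacent if and only if $\langle x,y\rangle=G$. $V(G)$ is the set of non-isolated vertices of $\Gamma(G)$, i.e. the set of $x\in G$ for which there exists $y\in G$ with $\langle x,y\rangle=G$. $\Delta(G)$ is the graph obtained from $\Gamma(G)$ by removing its isolated vertices, i.e. the subgraph of $\Gamma(G)$ induced on $V(G)$. *)

theory Defs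
  imports
    "HOL-Analysis.Analysis"
    "HOL-Algebra.Solvable_Groups"
    "HOL-Algebra.Product_Groups"
    "Graph_Theory.Digraph_Component"
    "Graph_Theory.Shortest_Path"
begin

section \<open>Prosoluble groups\<close>

definition topological_group :: "('a, 'm) monoid_scheme \<Rightarrow> 'a topology \<Rightarrow> bool" where
  "topological_group G T \<longleftrightarrow>
     group G \<and> topspace T = carrier G \<and>
     continuous_map (prod_topology T T) T (\<lambda>(x, y). x \<otimes>\<^bsub>G\<^esub> y) \<and>
     continuous_map T T (\<lambda>x. inv\<^bsub>G\<^esub> x)"

definition topological_group_iso ::
  "('a, 'm) monoid_scheme \<Rightarrow> 'a topology \<Rightarrow> ('b, 'n) monoid_scheme \<Rightarrow> 'b topology \<Rightarrow> bool" where
  "topological_group_iso G T H U \<longleftrightarrow> (\<exists>f. f \<in> iso G H \<and> homeomorphic_map T U f)"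

text \<open>
  A pair \<open>(i, j) \<in> r\<close> is read as \<open>i \<le> j\<close>; the transition map \<open>\<phi> i j\<close> then goes from
  \<open>H j\<close> to \<open>H i\<close>.
\<close>

definition directed_poset :: "'i set \<Rightarrow> 'i rel \<Rightarrow> bool" where
  "directed_poset I r \<longleftrightarrow>
     I \<noteq> {} \<and> partial_order_on I r \<and> (\<forall>i\<in>I. \<forall>j\<in>I. \<exists>k\<in>I. (i, k) \<in> r \<and> (j, k) \<in> r)"

definition inverse_system ::
  "'i set \<Rightarrow> 'i rel \<Rightarrow> ('i \<Rightarrow> 'h monoid) \<Rightarrow> ('i \<Rightarrow> 'i \<Rightarrow> 'h \<Rightarrow> 'h) \<Rightarrow> bool" where
  "inverse_system I r H \<phi> \<longleftrightarrow>
     directed_poset I r \<and>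
     (\<forall>i\<in>I. group (H i)) \<and>
     (\<forall>(i, j)\<in>r. \<phi> i j \<in> hom (H j) (H i)) \<and>
     (\<forall>i\<in>I. \<forall>x\<in>carrier (H i). \<phi> i i x = x) \<and>
     (\<forall>i j k. (i, j) \<in> r \<longrightarrow> (j, k) \<in> r \<longrightarrow>
        (\<forall>x\<in>carrier (H k). \<phi> i j (\<phi> j k x) = \<phi> i k x))"

definition inverse_limit_group ::
  "'i set \<Rightarrow> 'i rel \<Rightarrow> ('i \<Rightarrow> 'h monoid) \<Rightarrow> ('i \<Rightarrow> 'i \<Rightarrow> 'h \<Rightarrow> 'h) \<Rightarrow> ('i \<Rightarrow> 'h) monoid" where
  "inverse_limit_group I r H \<phi> =
     (product_group I H)
       \<lparr>carrier := {x \<in> carrier (product_group I H). \<forall>(i, j)\<in>r. \<phi> i j (x j) = x i}\<rparr>"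

definition inverse_limit_topology ::
  "'i set \<Rightarrow> 'i rel \<Rightarrow> ('i \<Rightarrow> 'h monoid) \<Rightarrow> ('i \<Rightarrow> 'i \<Rightarrow> 'h \<Rightarrow> 'h) \<Rightarrow> ('i \<Rightarrow> 'h) topology" where
  "inverse_limit_topology I r H \<phi> =
     subtopology (product_topology (\<lambda>i. discrete_topology (carrier (H i))) I)
       (carrier (inverse_limit_group I r H \<phi>))"

text \<open>
  HOL cannot quantify over types inside a definition, so the types of the indices and of the
  elements of the finite groups are passed as arguments. As free type variables of a theorem
  they are universally quantified, and inverse systems of every kind are covered. No finite
  quotient is lost: the canonical system of all quotients by open normal subgroups
  is available at \<open>'i = 'h = 'a set\<close>. Finite soluble groups form a
  subclass of finite groups, so a group satisfying this predicate is in particular profinite.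
\<close>

definition prosoluble ::
  "'i itself \<Rightarrow> 'h itself \<Rightarrow> ('a, 'm) monoid_scheme \<Rightarrow> 'a topology \<Rightarrow> bool" where
  "prosoluble _ _ G T \<longleftrightarrow>
     topological_group G T \<and>
     (\<exists>(I :: 'i set) r (H :: 'i \<Rightarrow> 'h monoid) \<phi>.
        inverse_system I r H \<phi> \<and>
        (\<forall>i\<in>I. finite (carrier (H i)) \<and> solvable (H i)) \<and>
        topological_group_iso G T (inverse_limit_group I r H \<phi>) (inverse_limit_topology I r H \<phi>))"


section \<open>Topological generation and the generating graph\<close>

definition top_generates :: "('a, 'm) monoid_scheme \<Rightarrow> 'a topology \<Rightarrow> 'a set \<Rightarrow> bool" where
  "top_generates G T X \<longleftrightarrow> T closure_of (generate G X) = carrier G"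

definition two_generated :: "('a, 'm) monoid_scheme \<Rightarrow> 'a topology \<Rightarrow> bool" where
  "two_generated G T \<longleftrightarrow> (\<exists>a\<in>carrier G. \<exists>b\<in>carrier G. top_generates G T {a, b})"

text \<open>
  Undirected graphs are symmetric digraphs. An element that generates \<open>G\<close> by itself
  carries a loop; loops affect neither distances nor connectedness.
\<close>

definition generating_graph ::
  "('a, 'm) monoid_scheme \<Rightarrow> 'a topology \<Rightarrow> ('a, 'a \<times> 'a) pre_digraph" where
  "generating_graph G T = with_proj
     \<lparr>pverts = carrier G,
      parcs = {(x, y). x \<in> carrier G \<and> y \<in> carrier G \<and> top_generates G T {x, y}}\<rparr>"

definition nonisolated :: "('a, 'm) monoid_scheme \<Rightarrow> 'a topology \<Rightarrow> 'a set" where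
  "nonisolated G T = {x \<in> carrier G. \<exists>y\<in>carrier G. top_generates G T {x, y}}"

definition Delta_graph ::
  "('a, 'm) monoid_scheme \<Rightarrow> 'a topology \<Rightarrow> ('a, 'a \<times> 'a) pre_digraph" where
  "Delta_graph G T = generating_graph G T \<restriction> nonisolated G T"

text \<open>
  With unit weights, \<open>wf_digraph.\<mu>\<close> is the length of a shortest walk,
  and \<open>\<infinity>\<close> if there is none.
\<close>

definition graph_diameter :: "('v, 'e) pre_digraph \<Rightarrow> ereal" where
  "graph_diameter \<Gamma> =
     (SUP (u, v) \<in> verts \<Gamma> \<times> verts \<Gamma>. wf_digraph.\<mu> \<Gamma> (\<lambda>_. 1) u v)"

lemma verts_Delta_graph [simp]: "verts (Delta_graph G T) = nonisolated G T"
  by (simp add: Delta_graph_def)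

lemma arcs_Delta_graph:
  "arcs (Delta_graph G T) =
     {(x, y). x \<in> carrier G \<and> y \<in> carrier G \<and> top_generates G T {x, y}}"
proof -
  have "y \<in> nonisolated G T"
    if "x \<in> carrier G" "y \<in> carrier G" "top_generates G T {x, y}" for x y
    using that by (auto simp: nonisolated_def insert_commute intro!: bexI[of _ x])
  then show ?thesis
    by (auto simp: Delta_graph_def generating_graph_def) (auto simp: nonisolated_def)
qed

lemma wf_digraph_Delta_graph: "wf_digraph (Delta_graph G T)"
  by unfold_locales (auto simp: Delta_graph_def)

lemma symmetric_Delta_graph: "symmetric (Delta_graph G T)"
proof -
  have "arcs_ends (Delta_graph G T) = arcs (Delta_graph G T)"
    by (simp add: arcs_ends_conv Delta_graph_def generating_graph_def)
  then show ?thesis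
    by (auto simp: symmetric_def sym_def arcs_Delta_graph insert_commute)
qed

end

theory Submission
  imports Defs
    "HOL-Library.Function_Algebras"
    "HOL-Library.Disjoint_Sets"
    "HOL-Algebra.Multiplicative_Group"
    "HOL-Algebra.Zassenhaus"
begin

text \<open>
  By compactness it suffices to join two non-isolated vertices \<open>a\<^sub>1\<close>, \<open>a\<^sub>2\<close> of a finite
  soluble group \<open>G\<close> by a path \<open>a\<^sub>1 - c\<^sub>1 - c\<^sub>2 - a\<^sub>2\<close>. The pair \<open>(c\<^sub>1, c\<^sub>2)\<close> is lifted down a
  chief series. At an abelian chief factor \<open>V = A/B\<close> the lifts that fail to generate correspond to
  complements of \<open>V\<close>, hence to derivations into \<open>V\<close>. The good lifts therefore form
  \<open>V \<times> V\<close> minus three proper cosets: of \<open>U\<^sub>1 \<times> V\<close>, of \<open>V \<times> U\<^sub>2\<close> and of a subgroup \<open>Z\<close> of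
  \<open>V \<times> V\<close>. These cover \<open>V \<times> V\<close> only if \<open>V\<close> has exponent two, all three have
  index two and \<open>Z = {(x, y). x \<in> U\<^sub>1 \<longleftrightarrow> y \<in> U\<^sub>2}\<close>. Such a configuration, a property of
  \<open>(c\<^sub>1, c\<^sub>2)\<close> and of the isomorphism type of \<open>V\<close>, is called obstructed. Whenever a lift creates it,
  another good lift avoids it, so the induction carries along that no module is obstructed.
\<close>

section \<open>Covering a product by cosets\<close>

text \<open>The three forbidden sets are proper by Gaschuetz's counting: the number of bad lifts is
  the same for every pair being lifted, and a pair that generates shows it is not maximal. The
  obstacle is the prime 2. If \<open>V\<close> has no 2-torsion, a proper coset has density at most
  1/3, and (2/3)^2 > 1/3 leaves a good lift. At density 1/2 the same count fails, and a covering can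
  really occur. A covering forces the direction subgroups of the three cosets to be balanced. These
  are made of cocycles modulo \<open>A\<close>, so the danger is visible one step before the lift
  and can be excluded there. It must be excluded for every irreducible module of exponent two, since
  any of them may be isomorphic to the next chief factor. Going from \<open>A\<close> to
  \<open>B\<close>, a module that gains cocycles and is obstructed must be isomorphic to
  \<open>V\<close>, so each step has a single module to control. Obstruction of \<open>V\<close>
  itself leaves room for only one new coset of cocycles, the splittings; the lift shifts their
  values, and this freedom is used to break the balance. Modulo the whole group all cocycles vanish,
  and nothing is obstructed.\<close>

definition add_subgroup :: "'v::ab_group_add set \<Rightarrow> bool" where
  "add_subgroup V \<longleftrightarrow> 0 \<in> V \<and> (\<forall>x\<in>V. \<forall>y\<in>V. x - y \<in> V)"

text \<open>The empty set qualifies on purpose: a chief factor without suitable complements forbids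
  no lift at all.\<close>

definition coset_like :: "'v::ab_group_add set \<Rightarrow> bool" where
  "coset_like A \<longleftrightarrow> (\<forall>x\<in>A. \<forall>y\<in>A. \<forall>z\<in>A. x - y + z \<in> A)"

lemma add_subgroup_zero: "add_subgroup V \<Longrightarrow> 0 \<in> V"
  and add_subgroup_diff: "add_subgroup V \<Longrightarrow> x \<in> V \<Longrightarrow> y \<in> V \<Longrightarrow> x - y \<in> V"
  by (auto simp: add_subgroup_def)

lemma add_subgroup_minus: "add_subgroup V \<Longrightarrow> x \<in> V \<Longrightarrow> - x \<in> V"
  using add_subgroup_diff[of V 0 x] add_subgroup_zero[of V] by simp

lemma add_subgroup_add: "add_subgroup V \<Longrightarrow> x \<in> V \<Longrightarrow> y \<in> V \<Longrightarrow> x + y \<in> V"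
  using add_subgroup_diff[of V x "- y"] add_subgroup_minus[of V y] by simp

lemmas add_subgroup_intros =
  add_subgroup_zero add_subgroup_diff add_subgroup_minus add_subgroup_add

lemma coset_likeD: "coset_like A \<Longrightarrow> x \<in> A \<Longrightarrow> y \<in> A \<Longrightarrow> z \<in> A \<Longrightarrow> x - y + z \<in> A"
  by (auto simp: coset_like_def)

lemma add_subgroup_Times:
  "add_subgroup V \<Longrightarrow> add_subgroup W \<Longrightarrow> add_subgroup (V \<times> W)"
  by (auto simp: add_subgroup_def zero_prod_def)

lemma doubling_inj_on:
  assumes "add_subgroup V" "\<And>x. x \<in> V \<Longrightarrow> x + x = 0 \<Longrightarrow> x = 0"
  shows "inj_on (\<lambda>x. x + x) V"
proof (rule inj_onI)
  fix x y assume "x \<in> V" "y \<in> V" "x + x = y + y"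
  then have "(x - y) + (x - y) = 0" by (simp add: algebra_simps)
  with assms(2)[of "x - y"] assms(1) \<open>x \<in> V\<close> \<open>y \<in> V\<close> show "x = y"
    by (simp add: add_subgroup_diff)
qed

text \<open>Without 2-torsion a proper subgroup has index at least three: for a difference
  \<open>d\<close> outside the direction of \<open>A\<close>, the translates \<open>A\<close>,
  \<open>A + d\<close> and \<open>A - d\<close> are disjoint.\<close>

lemma card_proper_coset_odd:
  fixes V :: "'v::ab_group_add set"
  assumes V: "add_subgroup V" "finite V" and odd: "\<And>x. x \<in> V \<Longrightarrow> x + x = 0 \<Longrightarrow> x = 0"
    and A: "A \<subseteq> V" "A \<noteq> V" "coset_like A"
  shows "3 * card A \<le> card V"
proof (cases "A = {}")
  case False
  then obtain a0 where a0: "a0 \<in> A" by auto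
  obtain v where v: "v \<in> V" "v \<notin> A" using A by auto
  define d where "d = v - a0"
  have d: "d \<in> V" using v a0 A V by (auto simp: d_def intro: add_subgroup_intros)
  have dA: "a + d \<notin> A" "a - d \<notin> A" if "a \<in> A" for a
  proof -
    show "a + d \<notin> A"
      using coset_likeD[OF A(3) _ that a0, of "a + d"] v by (auto simp: d_def algebra_simps)
    show "a - d \<notin> A"
      using coset_likeD[OF A(3) that _ a0, of "a - d"] v by (auto simp: d_def algebra_simps)
  qed
  have fA: "finite A" using A V finite_subset by blast
  \<comment> \<open>\<open>A + d\<close> and \<open>A - d\<close> could meet only if
    \<open>d + d\<close> lay in the direction subgroup \<open>U\<close>. Doubling is injective,
    hence a permutation of the finite \<open>U\<close>, so \<open>d\<close> itself would lie in
    \<open>U\<close>.\<close>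
  have dd: "d + d \<noteq> a' - a" if "a \<in> A" "a' \<in> A" for a a'
  proof
    assume eq: "d + d = a' - a"
    define U where "U = (\<lambda>x. x - a0) ` A"
    have UV: "U \<subseteq> V" using A V a0 by (auto simp: U_def intro: add_subgroup_intros)
    have "(\<lambda>x. x + x) ` U \<subseteq> U"
    proof clarsimp
      fix u assume "u \<in> U"
      then obtain x where "x \<in> A" "u = x - a0" by (auto simp: U_def)
      then have "x - a0 + x \<in> A" "u + u = (x - a0 + x) - a0"
        using A(3) a0 by (auto intro: coset_likeD)
      then show "u + u \<in> U" by (auto simp: U_def)
    qed
    moreover have "inj_on (\<lambda>x. x + x) U"
      using doubling_inj_on[OF V(1) odd] UV inj_on_subset by blast
    moreover have "finite U" using fA by (simp add: U_def)
    ultimately have "(\<lambda>x. x + x) ` U = U" by (simp add: endo_inj_surj)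
    moreover have "a' - a \<in> U"
      using coset_likeD[OF A(3) that(2,1) a0] by (force simp: U_def image_iff)
    ultimately have "d + d \<in> (\<lambda>x. x + x) ` U" using eq by simp
    then obtain u where u: "u \<in> U" "u + u = d + d" by force
    then have "u = d" using doubling_inj_on[OF V(1) odd] UV d by (auto dest: inj_onD)
    then show False using u v a0 by (auto simp: U_def d_def)
  qed
  let ?P = "(\<lambda>x. x + d) ` A" and ?M = "(\<lambda>x. x - d) ` A"
  have "A \<inter> ?P = {}" "A \<inter> ?M = {}" using dA by auto
  moreover have "?P \<inter> ?M = {}"
  proof -
    have "a + d \<noteq> a' - d" if "a \<in> A" "a' \<in> A" for a a'
      using dd[OF that] by (simp add: eq_diff_eq algebra_simps)
    then show ?thesis by blast
  qed
  moreover have "card ?P = card A" "card ?M = card A" by (simp_all add: card_image)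
  ultimately have "card (A \<union> ?P \<union> ?M) = 3 * card A"
    using fA by (subst card_Un_disjoint | auto)+
  moreover have "A \<union> ?P \<union> ?M \<subseteq> V" using A V d by (auto intro: add_subgroup_intros)
  ultimately show ?thesis using card_mono[OF V(2)] by metis
qed simp

lemma card_proper_coset:
  fixes V :: "'v::ab_group_add set"
  assumes V: "add_subgroup V" "finite V"
    and A: "A \<subseteq> V" "A \<noteq> V" "coset_like A"
  shows "2 * card A \<le> card V"
proof (cases "A = {}")
  case False
  then obtain a0 where a0: "a0 \<in> A" by auto
  obtain v where v: "v \<in> V" "v \<notin> A" using A by auto
  let ?P = "(\<lambda>x. x + (v - a0)) ` A"
  have fA: "finite A" using A V finite_subset by blast
  have "a + (v - a0) \<notin> A" if "a \<in> A" for a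
    using coset_likeD[OF A(3) _ that a0, of "a + (v - a0)"] v by (auto simp: algebra_simps)
  then have "A \<inter> ?P = {}" by auto
  moreover have "card ?P = card A" by (simp add: card_image)
  ultimately have "card (A \<union> ?P) = 2 * card A"
    using fA by (subst card_Un_disjoint) auto
  moreover have "A \<union> ?P \<subseteq> V" using A V v a0 by (auto intro!: add_subgroup_intros)
  ultimately show ?thesis using card_mono[OF V(2)] by metis
qed simp

text \<open>Pure counting: the rectangle of allowed pairs fills at least 4/9 of
  \<open>V \<times> V\<close>, while \<open>Z\<close> fills at most 1/3.\<close>

lemma avoid_three_cosets_odd:
  fixes V :: "'v::ab_group_add set"
  assumes V: "add_subgroup V" "finite V" and odd: "\<And>x. x \<in> V \<Longrightarrow> x + x = 0 \<Longrightarrow> x = 0"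
    and A1: "A1 \<subseteq> V" "A1 \<noteq> V" "coset_like A1"
    and A2: "A2 \<subseteq> V" "A2 \<noteq> V" "coset_like A2"
    and Z: "Z \<subseteq> V \<times> V" "Z \<noteq> V \<times> V" "coset_like Z"
  shows "\<exists>x\<in>V - A1. \<exists>y\<in>V - A2. (x, y) \<notin> Z"
proof (rule ccontr)
  assume "\<not> ?thesis"
  then have "(V - A1) \<times> (V - A2) \<subseteq> Z" by auto
  moreover have finZ: "finite Z" using Z V finite_subset by blast
  ultimately have "card (V - A1) * card (V - A2) \<le> card Z"
    by (metis card_cartesian_product card_mono)
  moreover have "3 * card Z \<le> card V * card V"
    using card_proper_coset_odd[of "V \<times> V" Z] Z V odd
    by (auto simp: add_subgroup_Times card_cartesian_product zero_prod_def)
  moreover have a: "3 * card A1 \<le> card V" "3 * card A2 \<le> card V"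
    using card_proper_coset_odd[OF V odd] A1 A2 by auto
  moreover have "card (V - A1) = card V - card A1" "card (V - A2) = card V - card A2"
    using A1 A2 V by (simp_all add: card_Diff_subset finite_subset)
  ultimately have *: "3 * ((card V - card A1) * (card V - card A2)) \<le> card V * card V" by simp
  have "2 * card V \<le> 3 * (card V - card A1)" "2 * card V \<le> 3 * (card V - card A2)"
    using a by simp_all
  from mult_le_mono[OF this]
  have "4 * (card V * card V) \<le> 9 * ((card V - card A1) * (card V - card A2))" by (simp add: algebra_simps)
  then have "card V * card V = 0" using * by linarith
  then show False using V by (auto simp: add_subgroup_def)
qed

text \<open>Applied to the forbidden cosets of a lift as well as to direction subgroups, and
  therefore free of any coset or subgroup condition.\<close>

definition balanced ::
  "'v::ab_group_add set \<Rightarrow> 'v set \<Rightarrow> 'v set \<Rightarrow> ('v \<times> 'v) set \<Rightarrow> bool" where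
  "balanced V U1 U2 Z \<longleftrightarrow> 2 * card U1 = card V \<and> 2 * card U2 = card V \<and>
     Z = {(x, y) \<in> V \<times> V. x \<in> U1 \<longleftrightarrow> y \<in> U2}"

lemma add_subgroup_coset_like: "add_subgroup V \<Longrightarrow> coset_like V"
  by (auto simp: coset_like_def intro!: add_subgroup_intros)

section \<open>Three cosets covering a product of elementary abelian 2-groups\<close>

locale elementary_2_group =
  fixes V :: "'v::ab_group_add set"
  assumes subgroup: "add_subgroup V" and fin: "finite V"
    and char2: "\<And>x. x \<in> V \<Longrightarrow> x + x = 0"
begin

lemma minus_eq: "x \<in> V \<Longrightarrow> - x = x"
  using char2 by (simp add: minus_unique)

lemma diff_eq_add: "y \<in> V \<Longrightarrow> x - y = x + y"
  using minus_eq[of y] by (metis diff_conv_add_uminus)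

lemma card_pos: "card V > 0"
  using subgroup fin by (auto simp: add_subgroup_def card_gt_0_iff)

text \<open>Unless \<open>A\<close> is exactly half of \<open>V\<close>, the affine hull of its
  complement is everything. A \<open>coset_like\<close> set that contains the complement is then all
  of \<open>V\<close>.\<close>

lemma three_term_sum_outside:
  assumes A: "A \<subseteq> V" "A \<noteq> V" "coset_like A" "2 * card A \<noteq> card V" and v: "v \<in> V"
  shows "\<exists>x\<in>V - A. \<exists>y\<in>V - A. \<exists>z\<in>V - A. v = x - y + z"
proof (cases "v \<in> A")
  case False
  then show ?thesis using v by (intro bexI[of _ v]) auto
next
  case True
  obtain x where x: "x \<in> V" "x \<notin> A" using A by auto
  let ?P = "(\<lambda>a. a + (x - v)) ` A"
  have "card (A \<union> ?P) \<le> card A + card ?P" by (rule card_Un_le)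
  also have "\<dots> = 2 * card A" by (simp add: card_image)
  also have "\<dots> < card V" using card_proper_coset[OF subgroup fin A(1-3)] A(4) by simp
  finally have "\<not> V \<subseteq> A \<union> ?P"
    using card_mono[of "A \<union> ?P" V] A fin by (auto dest: finite_subset)
  then obtain y where y: "y \<in> V" "y \<notin> A" "y \<notin> ?P" by auto
  \<comment> \<open>\<open>y\<close> was chosen off the translate of \<open>A\<close> by
    \<open>x - v\<close>. As twice \<open>x - v\<close> is zero, this is what keeps
    \<open>?w\<close> outside \<open>A\<close>.\<close>
  let ?w = "x + y - v"
  have "?w \<notin> A"
  proof
    assume "?w \<in> A"
    moreover have "?w + (x - v) = y + ((x - v) + (x - v))" by (simp add: algebra_simps)
    moreover have "(x - v) + (x - v) = 0"
      using x v by (auto intro!: char2 add_subgroup_intros subgroup)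
    ultimately show False using y(3) by force
  qed
  moreover have "?w \<in> V" using x y v subgroup by (auto intro: add_subgroup_intros)
  moreover have "v = x - ?w + y" by simp
  ultimately show ?thesis using x y by blast
qed

text \<open>In the application the elements of \<open>A1\<close> and \<open>A2\<close> are
  coordinates of elements of \<open>Z\<close>, which gives \<open>p1\<close> and \<open>p2\<close>.
  The proof shows that every deviation from balance makes \<open>Z\<close> contain a full strip
  \<open>V \<times> (V - A2)\<close> or \<open>(V - A1) \<times> V\<close>, and that a full strip
  makes \<open>Z\<close> everything.\<close>

lemma covering_by_cosets:
  assumes A1: "A1 \<subseteq> V" "A1 \<noteq> V" "coset_like A1"
    and A2: "A2 \<subseteq> V" "A2 \<noteq> V" "coset_like A2"
    and Z: "Z \<subseteq> V \<times> V" "Z \<noteq> V \<times> V" "coset_like Z"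
    and p1: "\<And>x. x \<in> A1 \<Longrightarrow> \<exists>y. (x, y) \<in> Z" and p2: "\<And>y. y \<in> A2 \<Longrightarrow> \<exists>x. (x, y) \<in> Z"
    and cov: "\<And>x y. x \<in> V - A1 \<Longrightarrow> y \<in> V - A2 \<Longrightarrow> (x, y) \<in> Z"
  shows "balanced V A1 A2 Z"
proof -
  have Z3: "(x, y) \<in> Z" if "(x1, y1) \<in> Z" "(x2, y2) \<in> Z" "(x3, y3) \<in> Z" "x = x1 - x2 + x3" "y = y1 - y2 + y3"
    for x y x1 x2 x3 y1 y2 y3
    using coset_likeD[OF Z(3) that(1-3)] that(4,5) by simp
  have out: "b + d - c \<in> V - A" if "b \<in> V - A" "c \<in> A" "d \<in> A" "coset_like A" "A \<subseteq> V" for A b c d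
  proof -
    have "b + d - c \<notin> A"
    proof
      assume "b + d - c \<in> A"
      from coset_likeD[OF that(4) this that(3,2)] have "b \<in> A" by simp
      with that show False by simp
    qed
    then show ?thesis using that subgroup by (auto intro!: add_subgroup_intros)
  qed
  \<comment> \<open>In each remaining row \<open>p2\<close> supplies one point of \<open>Z\<close>;
    differences taken from a full row move this point along its own row.\<close>
  have nonfull1: "\<not> V \<times> (V - A2) \<subseteq> Z"
  proof
    assume full: "V \<times> (V - A2) \<subseteq> Z"
    have "(v, \<beta>) \<in> Z" if "v \<in> V" "\<beta> \<in> V" for v \<beta>
    proof (cases "\<beta> \<in> A2")
      case True
      then obtain x0 where x0: "(x0, \<beta>) \<in> Z" using p2 by auto
      obtain b where b: "b \<in> V - A2" using A2 by auto
      show ?thesis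
        by (rule Z3[of v b x0 b x0 \<beta>]) (use full b x0 that Z in auto)
    qed (use full that in auto)
    then show False using Z by auto
  qed
  have nonfull2: "\<not> (V - A1) \<times> V \<subseteq> Z"
  proof
    assume full: "(V - A1) \<times> V \<subseteq> Z"
    have "(\<beta>, v) \<in> Z" if "v \<in> V" "\<beta> \<in> V" for v \<beta>
    proof (cases "\<beta> \<in> A1")
      case True
      then obtain x0 where x0: "(\<beta>, x0) \<in> Z" using p1 by auto
      obtain b where b: "b \<in> V - A1" using A1 by auto
      show ?thesis
        by (rule Z3[of b v b x0 \<beta> x0]) (use full b x0 that Z in auto)
    qed (use full that in auto)
    then show False using Z by auto
  qed
  have "2 * card A1 = card V"
  proof (rule ccontr)
    assume h: "2 * card A1 \<noteq> card V"
    have "(v, b) \<in> Z" if v: "v \<in> V" and b: "b \<in> V - A2" for v b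
    proof -
      from three_term_sum_outside[OF A1 h v] obtain x y z
        where "x \<in> V - A1" "y \<in> V - A1" "z \<in> V - A1" "v = x - y + z" by blast
      then show ?thesis using cov b by - (rule Z3[of x b y b z b], auto)
    qed
    then show False using nonfull1 by auto
  qed
  moreover have "2 * card A2 = card V"
  proof (rule ccontr)
    assume h: "2 * card A2 \<noteq> card V"
    have "(b, v) \<in> Z" if v: "v \<in> V" and b: "b \<in> V - A1" for v b
    proof -
      from three_term_sum_outside[OF A2 h v] obtain x y z
        where "x \<in> V - A2" "y \<in> V - A2" "z \<in> V - A2" "v = x - y + z" by blast
      then show ?thesis using cov b by - (rule Z3[of b x b y b z], auto)
    qed
    then show False using nonfull2 by auto
  qed
  moreover obtain b1 b2 where b: "b1 \<in> V - A1" "b2 \<in> V - A2" using A1 A2 by auto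
  \<comment> \<open>One such point of \<open>Z\<close>, corrected by differences of points in the
    allowed rectangle, reaches every point of \<open>A1 \<times> (V - A2)\<close>, so the strip
    would be full.\<close>
  have no1: "(a, c) \<notin> Z" if a: "a \<in> A1" and c: "c \<in> V - A2" for a c
  proof
    assume ac: "(a, c) \<in> Z"
    have "(x, y) \<in> Z" if "x \<in> V" "y \<in> V - A2" for x y
    proof (cases "x \<in> A1")
      case True
      then show ?thesis
        using out[OF b(1) a True A1(3,1)] b c that cov ac
        by - (rule Z3[of a c b1 c "b1 + x - a" y], auto)
    qed (use that cov in auto)
    then show False using nonfull1 by auto
  qed
  have no2: "(c, a) \<notin> Z" if a: "a \<in> A2" and c: "c \<in> V - A1" for a c
  proof
    assume ac: "(c, a) \<in> Z"
    have "(y, x) \<in> Z" if "x \<in> V" "y \<in> V - A1" for x y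
    proof (cases "x \<in> A2")
      case True
      then show ?thesis
        using out[OF b(2) a True A2(3,1)] b c that cov ac
        by - (rule Z3[of c a c b2 y "b2 + x - a"], auto)
    qed (use that cov in auto)
    then show False using nonfull2 by auto
  qed
  have "(x, y) \<in> Z" if "x \<in> A1" "y \<in> A2" for x y
  proof -
    obtain y' where y': "(x, y') \<in> Z" using p1[OF \<open>x \<in> A1\<close>] by auto
    then have "y' \<in> A2" using no1 that Z by blast
    then show ?thesis
      using out[OF b(2) _ that(2) A2(3,1), of y'] b cov y'
      by - (rule Z3[of x y' b1 b2 b1 "b2 + y - y'"], auto)
  qed
  then have "Z = {(x, y) \<in> V \<times> V. x \<in> A1 \<longleftrightarrow> y \<in> A2}"
    using cov no1 no2 Z by blast
  ultimately show ?thesis by (simp add: balanced_def)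
qed

section \<open>Choosing a lift that is not balanced\<close>

lemma exists_outside: "X \<subseteq> V \<Longrightarrow> card X < card V \<Longrightarrow> \<exists>v\<in>V. v \<notin> X"
  by (metis less_irrefl subsetI subset_antisym)

lemma card_balanced:
  assumes "U1 \<subseteq> V" "U2 \<subseteq> V" "balanced V U1 U2 Z"
  shows "2 * card Z = card V * card V"
proof -
  have "Z = U1 \<times> U2 \<union> (V - U1) \<times> (V - U2)" using assms by (auto simp: balanced_def)
  then have "card Z = card (U1 \<times> U2) + card ((V - U1) \<times> (V - U2))"
    using assms(1,2) fin by (simp only:, subst card_Un_disjoint) (auto intro: finite_subset)
  also have "\<dots> = card U1 * card U2 + (card V - card U1) * (card V - card U2)"
    using assms(1,2) fin by (simp add: card_cartesian_product card_Diff_subset finite_subset)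
  finally have *: "card Z = \<dots>" .
  have "card V = 2 * card U1" "card U2 = card U1" using assms(3) by (auto simp: balanced_def)
  then show ?thesis using * by (simp add: algebra_simps)
qed

text \<open>Indices are powers of two: adjoining one outside element doubles \<open>s\<close>, and
  the result is still a proper subgroup.\<close>

lemma card_subgroup_dichotomy:
  assumes "add_subgroup s" "s \<subseteq> V" "2 * card s < card V"
  shows "4 * card s \<le> card V"
proof -
  have "s \<noteq> V" using assms by auto
  then obtain x where x: "x \<in> V" "x \<notin> s" using assms by auto
  let ?t = "s \<union> (+) x ` s"
  have fs: "finite s" using assms fin finite_subset by blast
  have sd: "a - b \<in> s" if "a \<in> s" "b \<in> s" for a b using that assms(1) by (rule add_subgroup_diff[rotated])
  have "s \<inter> (+) x ` s = {}"
    using sd x by force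
  then have ct: "card ?t = 2 * card s"
    using fs by (subst card_Un_disjoint) (auto simp: card_image)
  have "add_subgroup ?t"
  proof -
    have "a - (x + b) = x + (a - b)" for a b
      using minus_eq[OF x(1)] by (metis add.commute diff_add_eq_diff_diff_swap diff_conv_add_uminus)
    then have t12: "a - (x + b) \<in> (+) x ` s" "(x + a) - b \<in> (+) x ` s" if "a \<in> s" "b \<in> s" for a b
      using sd[OF that] add_diff_eq[of x a b] by (metis image_eqI)+
    have t34: "(x + a) - (x + b) \<in> s" "a - b \<in> s" if "a \<in> s" "b \<in> s" for a b
      using sd[OF that] by simp_all
    have "a - (x + b) \<in> ?t" "(x + a) - b \<in> ?t" "(x + a) - (x + b) \<in> ?t" "a - b \<in> ?t"
      if "a \<in> s" "b \<in> s" for a b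
      using t12[OF that] t34[OF that] by (simp_all only: Un_iff simp_thms)
    then have "\<forall>p\<in>?t. \<forall>q\<in>?t. p - q \<in> ?t" by (simp add: ball_Un)
    then show ?thesis
      using add_subgroup_zero[OF assms(1)] by (simp add: add_subgroup_def)
  qed
  moreover have "?t \<subseteq> V"
    using assms(2) x add_subgroup_add[OF subgroup] by blast
  moreover have "?t \<noteq> V" using ct assms(3) by auto
  ultimately have "2 * card ?t \<le> card V"
    by (intro card_proper_coset[OF subgroup fin] add_subgroup_coset_like)
  then show ?thesis using ct by simp
qed

lemma card_fibration:
  assumes "add_subgroup W" "W \<subseteq> V \<times> V"
  shows "card W = card (fst ` W) * card {y. (0, y) \<in> W}"
proof -
  have fW: "finite W" using assms fin finite_subset by blast
  have "card {y. (x, y) \<in> W} = card {y. (0, y) \<in> W}" if "x \<in> fst ` W" for x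
  proof -
    obtain y0 where y0: "(x, y0) \<in> W" using \<open>x \<in> fst ` W\<close> by auto
    have "(x, y + y0) \<in> W" if "(0, y) \<in> W" for y
      using add_subgroup_add[OF assms(1) that y0] by simp
    moreover have "(0, y - y0) \<in> W" if "(x, y) \<in> W" for y
      using add_subgroup_diff[OF assms(1) that y0] by simp
    ultimately have "bij_betw (\<lambda>y. y - y0) {y. (x, y) \<in> W} {y. (0, y) \<in> W}"
      by (intro bij_betwI[where g = "\<lambda>y. y + y0"]) auto
    then show ?thesis by (rule bij_betw_same_card)
  qed
  moreover have "W = Sigma (fst ` W) (\<lambda>x. {y. (x, y) \<in> W})" by force
  moreover have "finite {y. (x, y) \<in> W}" for x
    using finite_imageI[OF fW, of snd] by (rule finite_subset[rotated]) force
  ultimately show ?thesis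
    using fW card_SigmaI[of "fst ` W" "\<lambda>x. {y. (x, y) \<in> W}"] by simp
qed

text \<open>The hypothesis on \<open>Z\<close> is the way in which "empty or a coset of
  \<open>W\<close>" is expressed here and below. A nonempty fibre of \<open>Z\<close> is a translate
  into the fibre of \<open>W\<close> over zero.\<close>

lemma card_fiber_le:
  assumes "add_subgroup W" "W \<subseteq> V \<times> V"
    and Z: "\<And>p z. z \<in> Z \<Longrightarrow> p - z \<in> W \<longleftrightarrow> p \<in> Z"
  shows "card {y. (x, y) \<in> Z} \<le> card {y. (0, y) \<in> W}"
proof (cases "\<exists>y0. (x, y0) \<in> Z")
  case True
  then obtain y0 where y0: "(x, y0) \<in> Z" by auto
  have "(\<lambda>y. y - y0) ` {y. (x, y) \<in> Z} \<subseteq> {y. (0, y) \<in> W}" using Z[OF y0] by force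
  moreover have "finite {y. (0, y) \<in> W}"
    by (rule finite_subset[OF _ fin]) (use assms in auto)
  moreover have "inj_on (\<lambda>y. y - y0) {y. (x, y) \<in> Z}" by (auto simp: inj_on_def)
  ultimately show ?thesis by (metis card_inj_on_le)
qed auto

text \<open>By the two cardinalities the first projection of \<open>W\<close> has index two. If
  \<open>w1\<close> is the first coordinate of a point of \<open>Z\<close>, then in characteristic
  two the translate of \<open>Z\<close> has its first coordinates in that projection too. The union
  thus misses a whole column over some \<open>v\<close>, whereas a balanced set meets every column.
  \<open>A1\<close> is too small to contain the first projection of \<open>Z\<close>, so such a
  \<open>w1\<close> can be allowed.\<close>

lemma avoid_balanced_half:
  assumes W: "add_subgroup W" "W \<subseteq> V \<times> V" "4 * card W = card V * card V"
    and half: "2 * card {y. (0, y) \<in> W} = card V"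
    and Z: "Z \<subseteq> V \<times> V" "Z \<noteq> {}" "\<And>p z. z \<in> Z \<Longrightarrow> p - z \<in> W \<longleftrightarrow> p \<in> Z"
    and A: "A1 \<subseteq> V" "A2 \<subseteq> V" "4 * card A1 \<le> card V" "4 * card A2 \<le> card V"
  shows "\<exists>w1\<in>V - A1. \<exists>w2\<in>V - A2. (w1, w2) \<notin> Z \<and> (\<exists>v\<in>V. \<forall>y. (v, y) \<notin> W \<union> (+) (w1, w2) ` Z)"
proof -
  obtain z0 where z0: "z0 \<in> Z" using Z by auto
  have fZ: "finite Z" using Z fin finite_subset by blast
  have "4 * (card (fst ` W) * card {y. (0, y) \<in> W}) = card V * card V"
    using W card_fibration by metis
  then have "2 * card (fst ` W) * (2 * card {y. (0, y) \<in> W}) = card V * card V" by simp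
  then have c1: "2 * card (fst ` W) = card V" using half card_pos by simp
  have "fst ` W \<subseteq> (\<lambda>x. x - fst z0) ` fst ` Z"
  proof clarsimp
    fix x y assume "(x, y) \<in> W"
    then have "(x, y) + z0 \<in> Z" using Z(3)[OF z0, of "(x, y) + z0"] by simp
    then show "x \<in> (\<lambda>x. x - fst z0) ` fst ` Z"
      by (intro image_eqI[of _ _ "x + fst z0"] image_eqI[of _ _ "(x, y) + z0"]) auto
  qed
  then have "card (fst ` W) \<le> card (fst ` Z)"
    using fZ by (meson card_image_le card_mono finite_imageI le_trans)
  then have "card A1 < card (fst ` Z)" using A c1 card_pos by linarith
  then have "\<not> fst ` Z \<subseteq> A1" using A fin by (meson card_mono finite_subset not_less)
  then obtain z where z: "z \<in> Z" "fst z \<notin> A1" by auto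
  let ?w = "fst z" and ?F = "{y. (fst z, y) \<in> Z}"
  have "card (A2 \<union> ?F) \<le> card A2 + card ?F" by (rule card_Un_le)
  also have "\<dots> < card V" using card_fiber_le[OF W(1,2) Z(3), of "fst z"] A half card_pos by fastforce
  finally have lt: "card (A2 \<union> ?F) < card V" .
  have "A2 \<union> ?F \<subseteq> V" using A Z by auto
  from exists_outside[OF this lt] obtain w2 where w2: "w2 \<in> V" "w2 \<notin> A2" "(?w, w2) \<notin> Z" by auto
  have "card (fst ` W) < card V" using c1 card_pos by simp
  moreover have "fst ` W \<subseteq> V" using W by auto
  ultimately obtain v where v: "v \<in> V" "v \<notin> fst ` W" using exists_outside[of "fst ` W"] by auto
  have "(v, y) \<notin> W \<union> (+) (?w, w2) ` Z" for y
  proof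
    assume "(v, y) \<in> W \<union> (+) (?w, w2) ` Z"
    then obtain z' where z': "z' \<in> Z" "v = ?w + fst z'" using v by force
    have "fst (z - z') = v"
      using z' Z(1) diff_eq_add[of "fst z'" "fst z"] by auto
    moreover have "z - z' \<in> W" using Z(3) z z' by blast
    ultimately show False using v by force
  qed
  moreover have "?w \<in> V" using z Z by auto
  ultimately show ?thesis using z w2 v by blast
qed

text \<open>The three unions are the sets of cocycle values after the lift by
  \<open>(w1, w2)\<close>. If the given lift balances them, sizes are forced: \<open>A1\<close> and
  \<open>A2\<close> fill at most a quarter of \<open>V\<close>, and \<open>W\<close> exactly a
  quarter of \<open>V \<times> V\<close>. This leaves enough room to move the lift.\<close>

lemma exists_not_balanced:
  assumes W: "add_subgroup W" "W \<subseteq> V \<times> V"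
    and Z: "Z \<subseteq> V \<times> V" "Z \<noteq> {}" "\<And>p z. z \<in> Z \<Longrightarrow> p - z \<in> W \<longleftrightarrow> p \<in> Z"
    and u1: "add_subgroup u1" "u1 \<subseteq> V" and A1: "A1 \<subseteq> V" "\<And>a x. a \<in> A1 \<Longrightarrow> x - a \<in> u1 \<longleftrightarrow> x \<in> A1"
    and u2: "add_subgroup u2" "u2 \<subseteq> V" and A2: "A2 \<subseteq> V" "\<And>a x. a \<in> A2 \<Longrightarrow> x - a \<in> u2 \<longleftrightarrow> x \<in> A2"
    and good: "v1 \<in> V - A1" "v2 \<in> V - A2" "(v1, v2) \<notin> Z"
  shows "\<exists>w1\<in>V - A1. \<exists>w2\<in>V - A2. (w1, w2) \<notin> Z \<and>
    \<not> balanced V (u1 \<union> (+) w1 ` A1) (u2 \<union> (+) w2 ` A2) (W \<union> (+) (w1, w2) ` Z)"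
proof (cases "balanced V (u1 \<union> (+) v1 ` A1) (u2 \<union> (+) v2 ` A2) (W \<union> (+) (v1, v2) ` Z)")
  case False
  then show ?thesis using good by blast
next
  case True
  have small: "4 * card A \<le> card V"
    if "add_subgroup u" "u \<subseteq> V" "A \<subseteq> V" "\<And>a x. a \<in> A \<Longrightarrow> x - a \<in> u \<longleftrightarrow> x \<in> A" "v \<in> V - A"
      "2 * card (u \<union> (+) v ` A) = card V" for u A v
  proof (cases "A = {}")
    case ne: False
    then obtain a where a: "a \<in> A" by auto
    have f: "finite u" "finite A" using that fin finite_subset by blast+
    have "u \<inter> (+) v ` A = {}"
    proof -
      have "v + b \<notin> u" if "b \<in> A" for b
      proof -
        have "v - b = v + b" using that \<open>A \<subseteq> V\<close> by (intro diff_eq_add) auto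
        moreover have "v - b \<notin> u"
          using \<open>v \<in> V - A\<close> \<open>\<And>a x. a \<in> A \<Longrightarrow> x - a \<in> u \<longleftrightarrow> x \<in> A\<close>[OF that, of v] by auto
        ultimately show ?thesis by metis
      qed
      then show ?thesis by auto
    qed
    then have "card (u \<union> (+) v ` A) = card u + card A"
      using f by (subst card_Un_disjoint) (auto simp: card_image)
    moreover have "card A \<le> card u"
      by (rule card_inj_on_le[of "\<lambda>x. x - a"]) (use that(4)[OF a] f in \<open>auto simp: inj_on_def\<close>)
    ultimately show ?thesis using that by simp
  qed simp
  note bal = True[unfolded balanced_def]
  have A1s: "4 * card A1 \<le> card V" by (rule small[OF u1 A1 good(1)]) (use bal in auto)
  have A2s: "4 * card A2 \<le> card V" by (rule small[OF u2 A2 good(2)]) (use bal in auto)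
  have fW: "finite W" "finite Z" using W Z fin finite_subset by blast+
  have VV: "v1 \<in> V" "v2 \<in> V" using good by auto
  have "W \<inter> (+) (v1, v2) ` Z = {}"
  proof -
    have "(v1, v2) + z \<notin> W" if "z \<in> Z" for z
    proof -
      have "fst z \<in> V" "snd z \<in> V" using that Z(1) by auto
      then have "(v1, v2) - z = (v1, v2) + z"
        by (intro prod_eqI) (simp_all only: fst_diff snd_diff fst_add snd_add fst_conv snd_conv diff_eq_add)
      then show ?thesis using Z(3)[OF that, of "(v1, v2)"] good(3) by metis
    qed
    then show ?thesis by auto
  qed
  then have "card (W \<union> (+) (v1, v2) ` Z) = card W + card Z"
    using fW by (subst card_Un_disjoint) (auto simp: card_image)
  moreover have "card Z = card W"
  proof -
    obtain z0 where "z0 \<in> Z" using Z by auto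
    then have "z - z0 \<in> W \<longleftrightarrow> z \<in> Z" for z by (rule Z(3))
    moreover from this[of "_ + z0"] have "w + z0 \<in> Z \<longleftrightarrow> w \<in> W" for w by simp
    ultimately have "bij_betw (\<lambda>z. z - z0) Z W"
      by (intro bij_betwI[where g = "\<lambda>w. w + z0"]) (simp_all del: add_uminus_conv_diff)
    then show ?thesis by (rule bij_betw_same_card)
  qed
  moreover have "2 * card (W \<union> (+) (v1, v2) ` Z) = card V * card V"
    using A1 A2 u1 u2 VV subgroup by (intro card_balanced[OF _ _ True]) (auto intro!: add_subgroup_intros)
  ultimately have cW: "4 * card W = card V * card V" by simp
  \<comment> \<open>These slices of \<open>W\<close> lie in the two balanced halves, so each has
    index two or at least four. Index two leads to \<open>avoid_balanced_half\<close>, with the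
    coordinates swapped in the case of \<open>?s1\<close>.\<close>
  let ?s1 = "{x. (x, 0) \<in> W}" and ?s2 = "{y. (0, y) \<in> W}"
  have s: "add_subgroup ?s1" "add_subgroup ?s2" "?s1 \<subseteq> V" "?s2 \<subseteq> V"
    using W add_subgroup_diff[OF W(1)] add_subgroup_zero[OF W(1)]
    by (force simp: add_subgroup_def zero_prod_def)+
  have zu: "0 \<in> u1" "0 \<in> u2" using u1 u2 by (auto intro: add_subgroup_intros)
  have zV: "0 \<in> V" using subgroup by (rule add_subgroup_zero)
  have sU: "?s1 \<subseteq> u1 \<union> (+) v1 ` A1" "?s2 \<subseteq> u2 \<union> (+) v2 ` A2"
    using bal zu W by blast+
  have finU: "finite (u1 \<union> (+) v1 ` A1)" "finite (u2 \<union> (+) v2 ` A2)"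
    using A1 A2 u1 u2 fin by (auto intro: finite_subset)
  have s_le: "2 * card ?s1 \<le> card V" "2 * card ?s2 \<le> card V"
    using card_mono[OF finU(1) sU(1)] card_mono[OF finU(2) sU(2)] bal by auto
  consider (half2) "2 * card ?s2 = card V" | (half1) "2 * card ?s1 = card V"
    | (small) "4 * card ?s1 \<le> card V" "4 * card ?s2 \<le> card V"
    using s_le card_subgroup_dichotomy[OF s(1,3)] card_subgroup_dichotomy[OF s(2,4)] by linarith
  then show ?thesis
  proof cases
    case half2
    from avoid_balanced_half[OF W cW half2 Z A1(1) A2(1) A1s A2s] obtain w1 w2 v
      where w: "w1 \<in> V - A1" "w2 \<in> V - A2" "(w1, w2) \<notin> Z" and v: "v \<in> V"
        and vy: "\<And>y. (v, y) \<notin> W \<union> (+) (w1, w2) ` Z" by blast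
    have "\<not> balanced V (u1 \<union> (+) w1 ` A1) (u2 \<union> (+) w2 ` A2) (W \<union> (+) (w1, w2) ` Z)"
    proof
      assume b: "balanced V (u1 \<union> (+) w1 ` A1) (u2 \<union> (+) w2 ` A2) (W \<union> (+) (w1, w2) ` Z)"
      have "u2 \<union> (+) w2 ` A2 \<noteq> V" using b card_pos by (auto simp: balanced_def)
      moreover have "u2 \<union> (+) w2 ` A2 \<subseteq> V"
        using u2 A2 w subgroup by (auto intro!: add_subgroup_intros)
      ultimately obtain y where "y \<in> V" "y \<notin> u2 \<union> (+) w2 ` A2" by blast
      then show False using b vy[of y] vy[of 0] v zV zu unfolding balanced_def by blast
    qed
    then show ?thesis using w by blast
  next
    case half1
    let ?W = "prod.swap ` W" and ?Z = "prod.swap ` Z"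
    have sw: "(x, y) \<in> prod.swap ` X \<longleftrightarrow> (y, x) \<in> X" for x y :: 'v and X by force
    have 1: "add_subgroup ?W"
      using add_subgroup_diff[OF W(1), of "(_, _)" "(_, _)"] add_subgroup_zero[OF W(1)]
      by (auto simp: add_subgroup_def zero_prod_def sw)
    have 2: "?W \<subseteq> V \<times> V" "?Z \<subseteq> V \<times> V" "?Z \<noteq> {}" using W Z by auto
    have 3: "4 * card ?W = card V * card V" using cW by (simp add: card_image)
    have 4: "2 * card {y. (0, y) \<in> ?W} = card V" using half1 by (simp add: sw)
    have 5: "p - z \<in> ?W \<longleftrightarrow> p \<in> ?Z" if "z \<in> ?Z" for p z
      using Z(3)[of "prod.swap z" "prod.swap p"] that by (cases p; cases z) (auto simp: sw)
    from avoid_balanced_half[OF 1 2(1) 3 4 2(2,3) 5 A2(1) A1(1) A2s A1s] obtain w1 w2 v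
      where w: "w1 \<in> V - A1" "w2 \<in> V - A2" "(w1, w2) \<notin> Z" and v: "v \<in> V"
        and "\<And>y. (v, y) \<notin> ?W \<union> (+) (w2, w1) ` ?Z" by (auto simp: sw)
    then have vy: "(y, v) \<notin> W \<union> (+) (w1, w2) ` Z" for y by (force simp: sw)
    have "\<not> balanced V (u1 \<union> (+) w1 ` A1) (u2 \<union> (+) w2 ` A2) (W \<union> (+) (w1, w2) ` Z)"
    proof
      assume b: "balanced V (u1 \<union> (+) w1 ` A1) (u2 \<union> (+) w2 ` A2) (W \<union> (+) (w1, w2) ` Z)"
      have "u1 \<union> (+) w1 ` A1 \<noteq> V" using b card_pos by (auto simp: balanced_def)
      moreover have "u1 \<union> (+) w1 ` A1 \<subseteq> V"
        using u1 A1 w subgroup by (auto intro!: add_subgroup_intros)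
      ultimately obtain y where "y \<in> V" "y \<notin> u1 \<union> (+) w1 ` A1" by blast
      then show False using b vy[of y] vy[of 0] v zV zu unfolding balanced_def by blast
    qed
    then show ?thesis using w by blast
  next
    case small
    \<comment> \<open>Balance would demand the point \<open>(x, 0)\<close>, since \<open>x\<close>
      lies in the first half and 0 in the second. \<open>w2\<close> is chosen so that neither
      \<open>W\<close> nor the translate of \<open>Z\<close> contains it; the choices to be avoided
      fill at most three quarters of \<open>V\<close>.\<close>
    have "card ?s1 < card (u1 \<union> (+) v1 ` A1)" using small bal card_pos by linarith
    then obtain x where x: "x \<in> u1 \<union> (+) v1 ` A1" "(x, 0) \<notin> W"
      using card_mono[of ?s1 "u1 \<union> (+) v1 ` A1"] finite_subset[OF s(3) fin] by (auto simp: not_less)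
    have xV: "x \<in> V" using x u1 A1 VV subgroup by (auto intro!: add_subgroup_intros)
    let ?F = "\<lambda>x. {y. (x, y) \<in> Z}"
    have "card (?F v1) \<le> card ?s2" "card (?F (v1 + x)) \<le> card ?s2"
      using card_fiber_le[OF W Z(3)] by simp_all
    then have lt: "card (A2 \<union> ?F v1 \<union> ?F (v1 + x)) < card V"
      using card_Un_le[of "A2 \<union> ?F v1" "?F (v1 + x)"] card_Un_le[of A2 "?F v1"]
        small A2s card_pos by linarith
    have "A2 \<union> ?F v1 \<union> ?F (v1 + x) \<subseteq> V" using A2 Z by auto
    from exists_outside[OF this lt]
    obtain w2 where w2: "w2 \<in> V" "w2 \<notin> A2" "(v1, w2) \<notin> Z" "(v1 + x, w2) \<notin> Z" by auto
    have "\<not> balanced V (u1 \<union> (+) v1 ` A1) (u2 \<union> (+) w2 ` A2) (W \<union> (+) (v1, w2) ` Z)"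
    proof
      assume "balanced V (u1 \<union> (+) v1 ` A1) (u2 \<union> (+) w2 ` A2) (W \<union> (+) (v1, w2) ` Z)"
      then have "(x, 0) \<in> W \<union> (+) (v1, w2) ` Z"
        using x xV zu zV by (auto simp: balanced_def)
      then obtain a b where ab: "(a, b) \<in> Z" "x = v1 + a" "0 = w2 + b" using x by auto
      have "a = x - v1" using ab by simp
      then have "a = v1 + x" using diff_eq_add[OF VV(1), of x] by (simp add: add.commute)
      moreover have "b = - w2" using ab by (metis minus_unique)
      then have "b = w2" using minus_eq[OF w2(1)] by simp
      ultimately show False using ab(1) w2(4) by metis
    qed
    then show ?thesis using good w2 by blast
  qed
qed

end

section \<open>Characters of abelian sections\<close>

text \<open>
  With values in one divisible group, chief factors of every prime exponent embed in the same type
  \<open>'a \<Rightarrow> circle\<close>, where type-class algebra is available.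
\<close>

quotient_type circle = real / "\<lambda>x y. x - y \<in> \<int>"
proof (rule equivpI)
  show "reflp (\<lambda>x y::real. x - y \<in> \<int>)" by (simp add: reflp_def)
  show "symp (\<lambda>x y::real. x - y \<in> \<int>)"
    by (rule sympI) (metis Ints_minus minus_diff_eq)
  show "transp (\<lambda>x y::real. x - y \<in> \<int>)"
    by (rule transpI) (metis Ints_add diff_add_cancel add_diff_eq)
qed

instantiation circle :: ab_group_add
begin

lift_definition zero_circle :: circle is 0 .

lift_definition plus_circle :: "circle \<Rightarrow> circle \<Rightarrow> circle" is "(+)"
  by (metis Ints_add add_diff_add)

lift_definition uminus_circle :: "circle \<Rightarrow> circle" is uminus
  by (metis Ints_minus minus_diff_minus)

lift_definition minus_circle :: "circle \<Rightarrow> circle \<Rightarrow> circle" is "(-)"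
  by (metis (no_types, lifting) Ints_diff diff_diff_eq2 add_diff_eq diff_add_eq add.commute diff_diff_add)

instance
  by standard (transfer; simp add: algebra_simps)+

end

lift_definition circle_of_real :: "real \<Rightarrow> circle" is "\<lambda>x. x" .

lemma circle_of_real_add: "circle_of_real (x + y) = circle_of_real x + circle_of_real y"
  by transfer simp

lemma circle_of_real_eq_iff: "circle_of_real x = circle_of_real y \<longleftrightarrow> x - y \<in> \<int>"
  by transfer simp

lemma circle_of_real_eq_0_iff: "circle_of_real x = 0 \<longleftrightarrow> x \<in> \<int>"
  by transfer simp

context group
begin

text \<open>A maximal proper subgroup \<open>S\<close> of \<open>A\<close> above \<open>B\<close> is
  normalised by \<open>A\<close>, because commutators lie in \<open>B\<close>. The quotient is
  cyclic, generated by \<open>a\<close>, of order \<open>k\<close>; the character sends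
  \<open>s \<otimes> a [^] i\<close> with \<open>s\<close> in \<open>S\<close> to i/k modulo
  1.\<close>

lemma exists_nontrivial_character:
  assumes A: "subgroup A G" "finite A" and B: "subgroup B G" "B \<subset> A"
    and comm: "\<And>x y. x \<in> A \<Longrightarrow> y \<in> A \<Longrightarrow> x \<otimes> y \<otimes> inv x \<otimes> inv y \<in> B"
  obtains ch :: "'a \<Rightarrow> circle" where "\<And>x y. x \<in> A \<Longrightarrow> y \<in> A \<Longrightarrow> ch (x \<otimes> y) = ch x + ch y"
    "\<And>b. b \<in> B \<Longrightarrow> ch b = 0" "\<exists>a\<in>A. ch a \<noteq> 0"
proof -
  let ?P = "\<lambda>S. subgroup S G \<and> B \<subseteq> S \<and> S \<subset> A"
  have "\<exists>S. ?P S \<and> (\<forall>S'. ?P S' \<longrightarrow> card S' \<le> card S)"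
    using B A by (intro ex_has_greatest_nat[of ?P B card "Suc (card A)"]) (auto simp: less_Suc_eq_le card_mono)
  then obtain S where S: "subgroup S G" "B \<subseteq> S" "S \<subset> A"
    and max: "\<And>S'. ?P S' \<Longrightarrow> card S' \<le> card S" by blast
  then obtain a where a: "a \<in> A" "a \<notin> S" by blast
  have AG: "x \<in> carrier G" if "x \<in> A" for x using that A subgroup.mem_carrier by metis
  have SA: "s \<in> A" if "s \<in> S" for s using that S by auto
  have aG: "a \<in> carrier G" using a AG by auto
  have conj: "x \<otimes> s \<otimes> inv x \<in> S" if "x \<in> A" "s \<in> S" for x s
  proof -
    have "x \<otimes> s \<otimes> inv x \<otimes> inv s \<in> S" using comm[of x s] that SA S by auto
    then have "x \<otimes> s \<otimes> inv x \<otimes> inv s \<otimes> s \<in> S" using that S subgroup.m_closed by metis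
    then show ?thesis using that AG SA by (simp add: m_assoc)
  qed
  have apow: "a [^] i \<in> A" for i :: int using a A(1) subgroup_int_pow_closed by blast
  define T where "T = {s \<otimes> a [^] i | s i. s \<in> S \<and> (i::int) \<in> UNIV}"
  have mult: "(s \<otimes> a [^] i) \<otimes> (t \<otimes> a [^] j) = (s \<otimes> (a [^] i \<otimes> t \<otimes> inv (a [^] i))) \<otimes> a [^] (i + j)"
    if "s \<in> S" "t \<in> S" for s t and i j :: int
    using that SA AG aG by (simp add: m_assoc int_pow_mult inv_solve_left)
  have mem: "s \<otimes> (a [^] i \<otimes> t \<otimes> inv (a [^] i)) \<in> S" if "s \<in> S" "t \<in> S" for s t and i :: int
    using conj[OF apow that(2)] that S(1) subgroup.m_closed by metis
  have TA: "T \<subseteq> A" using SA apow A(1) subgroup.m_closed by (fastforce simp: T_def)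
  have "subgroup T G"
  proof (rule subgroupI)
    show "T \<subseteq> carrier G" using TA AG by blast
    show "T \<noteq> {}" using S(1) subgroup.one_closed by (auto simp: T_def)
    show "x \<otimes> y \<in> T" if "x \<in> T" "y \<in> T" for x y
      using that mult mem unfolding T_def by blast
    show "inv x \<in> T" if xT: "x \<in> T" for x
    proof -
      obtain s i where s: "s \<in> S" "x = s \<otimes> a [^] (i::int)" using xT by (auto simp: T_def)
      have "inv x = (a [^] (- i) \<otimes> inv s \<otimes> inv (a [^] (- i))) \<otimes> a [^] (- i)"
        using s SA AG aG by (simp add: inv_mult_group m_assoc int_pow_neg)
      moreover have "a [^] (- i) \<otimes> inv s \<otimes> inv (a [^] (- i)) \<in> S"
        using conj[OF apow] s S(1) subgroup.m_inv_closed by metis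
      ultimately show ?thesis unfolding T_def by blast
    qed
  qed
  moreover have ST: "S \<subseteq> T"
  proof
    fix s assume "s \<in> S"
    then have "s = s \<otimes> a [^] (0::int)" using SA AG by simp
    then show "s \<in> T" using \<open>s \<in> S\<close> unfolding T_def by blast
  qed
  moreover have "a \<in> T"
  proof -
    have "a = \<one> \<otimes> a [^] (1::int)" using aG by (simp add: int_pow_1)
    then show ?thesis using S(1) subgroup.one_closed unfolding T_def by blast
  qed
  ultimately have "T = A"
    using max[of T] S(2) TA a(2) A(2) psubset_card_mono[of T S] finite_subset
    by (metis not_less psubsetI subset_trans)
  have ex: "\<exists>i::int. x \<otimes> inv (a [^] i) \<in> S" if "x \<in> A" for x
  proof -
    obtain s i where "s \<in> S" "x = s \<otimes> a [^] (i::int)" using \<open>T = A\<close> \<open>x \<in> A\<close> unfolding T_def by blast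
    then show ?thesis using SA AG aG by (intro exI[of _ i]) (simp add: m_assoc)
  qed
  let ?K = "{n::nat. 0 < n \<and> a [^] n \<in> S}"
  have "?K \<noteq> {}"
  proof -
    interpret A: group "G\<lparr>carrier := A\<rparr>" using A(1) by (simp add: subgroup_imp_group)
    have "a [^]\<^bsub>G\<lparr>carrier := A\<rparr>\<^esub> card A = \<one>"
      using A.pow_order_eq_1[of a] a by (simp add: order_def)
    then have "a [^] card A = \<one>" using nat_pow_consistent[of a "card A" A] by simp
    moreover have "card A > 0" using A a by (auto simp: card_gt_0_iff)
    moreover have "\<one> \<in> S" using S(1) by (rule subgroup.one_closed)
    ultimately have "card A \<in> ?K" by simp
    then show ?thesis by blast
  qed
  define k where "k = (LEAST n. 0 < n \<and> a [^] (n::nat) \<in> S)"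
  have k: "0 < k" "a [^] k \<in> S"
    using LeastI_ex[of "\<lambda>n. 0 < n \<and> a [^] (n::nat) \<in> S"] \<open>?K \<noteq> {}\<close> unfolding k_def by auto
  have kdvd: "int k dvd i" if "a [^] i \<in> S" for i :: int
  proof -
    have "a [^] (i mod int k) = a [^] (i - int k * (i div int k))"
      by (simp add: minus_mult_div_eq_mod)
    also have "\<dots> = a [^] i \<otimes> inv (a [^] (int k * (i div int k)))"
      using aG by (rule int_pow_diff)
    also have "a [^] (int k * (i div int k)) = (a [^] int k) [^] (i div int k)"
      using aG by (rule int_pow_pow[symmetric])
    finally have "a [^] (i mod int k) = a [^] i \<otimes> inv ((a [^] int k) [^] (i div int k))" .
    moreover have "(a [^] int k) [^] (i div int k) \<in> S"
      using k S(1) by - (rule subgroup_int_pow_closed, auto simp: int_pow_int)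
    ultimately have m: "a [^] (i mod int k) \<in> S"
      using that S(1) by (simp add: subgroup.m_closed subgroup.m_inv_closed)
    define n where "n = nat (i mod int k)"
    have n: "i mod int k = int n" "n < k"
      using k pos_mod_bound[of "int k" i] pos_mod_sign[of "int k" i] unfolding n_def by linarith+
    have "a [^] n \<in> S" using m n by (simp add: int_pow_int)
    then have "n = 0" using n not_less_Least[of n "\<lambda>n. 0 < n \<and> a [^] (n::nat) \<in> S"] by (auto simp: k_def)
    then show ?thesis using n by auto
  qed
  \<comment> \<open>Any admissible exponent serves: two of them differ by a multiple of
    \<open>k\<close>, hence by an integer after division by \<open>k\<close>.\<close>
  define idx where "idx x = (SOME i::int. x \<otimes> inv (a [^] i) \<in> S)" for x
  have idx: "x \<otimes> inv (a [^] idx x) \<in> S" if "x \<in> A" for x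
    using someI_ex[OF ex[OF that]] by (simp add: idx_def)
  define ch where "ch x = circle_of_real (real_of_int (idx x) / real k)" for x
  have ch: "ch x = circle_of_real (real_of_int i / real k)" if x: "x \<in> A" "x \<otimes> inv (a [^] i) \<in> S" for x i
  proof -
    have "inv (x \<otimes> inv (a [^] i)) \<otimes> (x \<otimes> inv (a [^] idx x)) \<in> S"
      using x idx S(1) subgroup.m_closed subgroup.m_inv_closed by metis
    also have "inv (x \<otimes> inv (a [^] i)) \<otimes> (x \<otimes> inv (a [^] idx x)) = a [^] (i - idx x)"
      using x AG aG by (simp add: inv_mult_group m_assoc int_pow_diff) (simp add: m_assoc[symmetric])
    finally obtain j where "i - idx x = int k * j" using kdvd by blast
    then have "real_of_int i - real_of_int (idx x) = real k * real_of_int j" by (metis of_int_diff of_int_mult of_int_of_nat_eq)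
    then have "real_of_int (idx x) / real k - real_of_int i / real k = real_of_int (- j)"
      using k by (simp add: field_simps)
    then show ?thesis unfolding ch_def circle_of_real_eq_iff by (metis Ints_of_int)
  qed
  show thesis
  proof
    show "ch (x \<otimes> y) = ch x + ch y" if "x \<in> A" "y \<in> A" for x y
    proof -
      let ?s = "x \<otimes> inv (a [^] idx x)" and ?t = "y \<otimes> inv (a [^] idx y)"
      have "x = ?s \<otimes> a [^] idx x" "y = ?t \<otimes> a [^] idx y" using that AG aG by (simp_all add: m_assoc)
      then have "x \<otimes> y = (?s \<otimes> (a [^] idx x \<otimes> ?t \<otimes> inv (a [^] idx x))) \<otimes> a [^] (idx x + idx y)"
        using mult[OF idx[OF that(1)] idx[OF that(2)]] by metis
      then have "(x \<otimes> y) \<otimes> inv (a [^] (idx x + idx y)) = ?s \<otimes> (a [^] idx x \<otimes> ?t \<otimes> inv (a [^] idx x))"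
        using that AG aG by (simp add: inv_solve_right')
      then have "(x \<otimes> y) \<otimes> inv (a [^] (idx x + idx y)) \<in> S"
        using mem[OF idx[OF that(1)] idx[OF that(2)]] by simp
      moreover have "x \<otimes> y \<in> A" using that A(1) subgroup.m_closed by metis
      ultimately show ?thesis
        using ch[of "x \<otimes> y" "idx x + idx y"]
        by (simp add: ch_def add_divide_distrib circle_of_real_add)
    qed
    show "ch b = 0" if "b \<in> B" for b
      using ch[of b 0] that S SA AG by (auto simp: circle_of_real_eq_0_iff)
    have "ch a = circle_of_real (real_of_int 1 / real k)"
      using ch[of a 1] a(1) aG S(1) subgroup.one_closed by (fastforce simp: int_pow_1)
    moreover have "k \<noteq> 1" using k(2) a(2) aG by auto
    then have "1 / real k \<notin> \<int>"
    proof (rule contrapos_nn)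
      assume "1 / real k \<in> \<int>"
      then obtain i where "1 / real k = of_int i" by (auto elim: Ints_cases)
      then have "real_of_int (i * int k) = 1" using k(1) by (simp add: field_simps)
      then have "i * int k = 1" by linarith
      then show "k = 1" by (simp add: zmult_eq_1_iff)
    qed
    ultimately show "\<exists>a\<in>A. ch a \<noteq> 0" using a(1) by (intro bexI[of _ a]) (simp_all add: circle_of_real_eq_0_iff)
  qed
qed

end

section \<open>Derivations as functions on the group\<close>

context group
begin

text \<open>Fixing the value 0 off the carrier makes equality in HOL agree with equality of
  functions on the group.\<close>

definition fn_space :: "('a \<Rightarrow> circle) set" where
  "fn_space = {f. \<forall>x. x \<notin> carrier G \<longrightarrow> f x = 0}"

text \<open>Right translation of the argument gives a left action. The functions form the module
  coinduced from the trivial subgroup, in which every derivation becomes inner.\<close>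

definition translate :: "'a \<Rightarrow> ('a \<Rightarrow> circle) \<Rightarrow> 'a \<Rightarrow> circle" where
  "translate g f = (\<lambda>x. if x \<in> carrier G then f (x \<otimes> g) else 0)"

definition delta :: "'a \<Rightarrow> ('a \<Rightarrow> circle) \<Rightarrow> 'a \<Rightarrow> circle" where
  "delta g f = translate g f - f"

definition gmodule :: "('a \<Rightarrow> circle) set \<Rightarrow> bool" where
  "gmodule V \<longleftrightarrow> add_subgroup V \<and> V \<subseteq> fn_space \<and>
     (\<forall>g\<in>carrier G. \<forall>v\<in>V. translate g v \<in> V)"

definition irreducible_gmodule :: "('a \<Rightarrow> circle) set \<Rightarrow> bool" where
  "irreducible_gmodule V \<longleftrightarrow> gmodule V \<and> (\<forall>W. gmodule W \<longrightarrow> W \<subseteq> V \<longrightarrow> W = {0} \<or> W = V)"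

text \<open>
  Every derivation into a module of functions has the form \<open>g \<mapsto> delta g f\<close>, where \<open>f g\<close> is
  its value at \<open>g\<close>, evaluated at \<open>\<one>\<close>. So \<open>cocycles V N\<close> stands for the derivations \<open>G/N \<rightarrow> V\<close>, and
  the normalisation \<open>f \<one> = 0\<close> makes \<open>f\<close> unique.
\<close>

definition cocycles :: "('a \<Rightarrow> circle) set \<Rightarrow> 'a set \<Rightarrow> ('a \<Rightarrow> circle) set" where
  "cocycles V N = {f \<in> fn_space. f \<one> = 0 \<and> (\<forall>g\<in>carrier G. delta g f \<in> V) \<and> (\<forall>n\<in>N. delta n f = 0)}"

lemma translate_zero [simp]: "translate g 0 = 0"
  and translate_add: "translate g (f + h) = translate g f + translate g h"
  and translate_diff: "translate g (f - h) = translate g f - translate g h"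
  by (auto simp: translate_def fun_eq_iff)

lemma translate_in_fn_space: "translate g f \<in> fn_space"
  by (simp add: translate_def fn_space_def)

lemma fn_space_subgroup: "add_subgroup fn_space"
  by (auto simp: add_subgroup_def fn_space_def)

lemma translate_one: "f \<in> fn_space \<Longrightarrow> translate \<one> f = f"
  by (auto simp: translate_def fn_space_def fun_eq_iff)

lemma translate_mult:
  "g \<in> carrier G \<Longrightarrow> h \<in> carrier G \<Longrightarrow> translate (g \<otimes> h) f = translate g (translate h f)"
  by (auto simp: translate_def fun_eq_iff m_assoc)

lemma translate_inv:
  "g \<in> carrier G \<Longrightarrow> f \<in> fn_space \<Longrightarrow> translate (inv g) (translate g f) = f"
  "g \<in> carrier G \<Longrightarrow> f \<in> fn_space \<Longrightarrow> translate g (translate (inv g) f) = f"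
  by (simp_all add: translate_mult[symmetric] translate_one)

lemma translate_eq_0_iff:
  "g \<in> carrier G \<Longrightarrow> f \<in> fn_space \<Longrightarrow> translate g f = 0 \<longleftrightarrow> f = 0"
  using translate_inv(1)[of g f] by auto

lemma delta_add: "delta g (f + h) = delta g f + delta g h"
  and delta_diff: "delta g (f - h) = delta g f - delta g h"
  and delta_zero [simp]: "delta g 0 = 0"
  by (simp_all add: delta_def translate_add translate_diff)

lemma delta_one: "f \<in> fn_space \<Longrightarrow> delta \<one> f = 0"
  by (simp add: delta_def translate_one)

lemma delta_mult:
  "g \<in> carrier G \<Longrightarrow> h \<in> carrier G \<Longrightarrow>
   delta (g \<otimes> h) f = translate g (delta h f) + delta g f"
  by (simp add: delta_def translate_mult translate_diff)

lemma delta_inv: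
  assumes "g \<in> carrier G" "f \<in> fn_space"
  shows "delta (inv g) f = - translate (inv g) (delta g f)"
  using delta_mult[of "inv g" g f] assms delta_one[of f] by (simp add: eq_neg_iff_add_eq_0 add.commute)

lemma delta_in_fn_space: "f \<in> fn_space \<Longrightarrow> delta g f \<in> fn_space"
  unfolding delta_def
  by (intro add_subgroup_diff[OF fn_space_subgroup] translate_in_fn_space)

lemma delta_eq_0_mult:
  "g \<in> carrier G \<Longrightarrow> h \<in> carrier G \<Longrightarrow> delta h f = 0 \<Longrightarrow> delta (g \<otimes> h) f = delta g f"
  by (simp add: delta_mult)

lemma stabilizer_subgroup:
  assumes "f \<in> fn_space"
  shows "subgroup {g \<in> carrier G. delta g f = 0} G"
proof (rule subgroupI)
  show "{g \<in> carrier G. delta g f = 0} \<noteq> {}" using delta_one[OF assms] by auto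
qed (auto simp: delta_mult delta_inv assms)

lemma cocyclesD:
  assumes "f \<in> cocycles V N"
  shows "f \<in> fn_space" "f \<one> = 0" "g \<in> carrier G \<Longrightarrow> delta g f \<in> V" "n \<in> N \<Longrightarrow> delta n f = 0"
  using assms by (auto simp: cocycles_def)

lemma gmoduleD:
  assumes "gmodule V"
  shows "add_subgroup V" "V \<subseteq> fn_space" "g \<in> carrier G \<Longrightarrow> v \<in> V \<Longrightarrow> translate g v \<in> V"
  using assms by (auto simp: gmodule_def)

lemma cocycles_subgroup:
  assumes "gmodule V"
  shows "add_subgroup (cocycles V N)"
  using fn_space_subgroup gmoduleD(1)[OF assms]
  by (auto simp: add_subgroup_def cocycles_def delta_diff)

lemma cocycles_antimono: "M \<subseteq> N \<Longrightarrow> cocycles V N \<subseteq> cocycles V M"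
  by (auto simp: cocycles_def)

lemma cocycle_eq_0:
  assumes "f \<in> cocycles V N" "\<And>g. g \<in> carrier G \<Longrightarrow> delta g f = 0"
  shows "f = 0"
proof
  fix x
  show "f x = 0 x"
  proof (cases "x \<in> carrier G")
    case True
    then have "translate x f \<one> = f \<one>" using assms(2)[of x] by (simp add: delta_def fun_eq_iff)
    then show ?thesis using True cocyclesD(2)[OF assms(1)] by (simp add: translate_def)
  next
    case False
    then show ?thesis using cocyclesD(1)[OF assms(1)] by (simp add: fn_space_def)
  qed
qed

text \<open>For normal \<open>N\<close> this is generation of \<open>G/N\<close>, phrased inside
  \<open>G\<close> so that all steps of the chief series share one group and one type.\<close>

definition generates_mod :: "'a set \<Rightarrow> 'a \<Rightarrow> 'a \<Rightarrow> bool" where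
  "generates_mod N x y \<longleftrightarrow> generate G ({x, y} \<union> N) = carrier G"

lemma generates_mod_commute: "generates_mod N x y \<longleftrightarrow> generates_mod N y x"
  by (simp add: generates_mod_def insert_commute)

lemma generates_mod_delta_0:
  assumes "generates_mod N x y" "f \<in> fn_space" "delta x f = 0" "delta y f = 0"
    "\<And>n. n \<in> N \<Longrightarrow> delta n f = 0" "x \<in> carrier G" "y \<in> carrier G" "N \<subseteq> carrier G"
    and "g \<in> carrier G"
  shows "delta g f = 0"
proof -
  have "{x, y} \<union> N \<subseteq> {g \<in> carrier G. delta g f = 0}" using assms by auto
  from generate_subgroup_incl[OF this stabilizer_subgroup[OF assms(2)]]
  show ?thesis using assms(1,9) by (auto simp: generates_mod_def)
qed

lemma generates_mod_cocycle_0: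
  assumes "generates_mod N x y" "f \<in> cocycles V N" "delta x f = 0" "delta y f = 0"
    "x \<in> carrier G" "y \<in> carrier G" "N \<subseteq> carrier G"
  shows "f = 0"
  using generates_mod_delta_0[OF assms(1) cocyclesD(1)[OF assms(2)] assms(3,4) cocyclesD(4)[OF assms(2)] assms(5-7)]
    cocycle_eq_0[OF assms(2)] by blast

text \<open>\<open>A\<close> carries the conjugation action. A chief factor \<open>A/B\<close> is
  represented by such a map with kernel \<open>B\<close>, so no quotient module has to be
  formed.\<close>

definition equiv_hom :: "'a set \<Rightarrow> ('a \<Rightarrow> 'a \<Rightarrow> circle) \<Rightarrow> bool" where
  "equiv_hom A \<phi> \<longleftrightarrow> (\<forall>a\<in>A. \<phi> a \<in> fn_space) \<and> (\<forall>a\<in>A. \<forall>b\<in>A. \<phi> (a \<otimes> b) = \<phi> a + \<phi> b) \<and>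
     (\<forall>g\<in>carrier G. \<forall>a\<in>A. \<phi> (g \<otimes> a \<otimes> inv g) = translate g (\<phi> a))"

lemma equiv_homD:
  assumes "equiv_hom A \<phi>" "a \<in> A"
  shows "\<phi> a \<in> fn_space" "b \<in> A \<Longrightarrow> \<phi> (a \<otimes> b) = \<phi> a + \<phi> b"
    "g \<in> carrier G \<Longrightarrow> \<phi> (g \<otimes> a \<otimes> inv g) = translate g (\<phi> a)"
  using assms by (auto simp: equiv_hom_def)

lemma equiv_hom_one:
  assumes "equiv_hom A \<phi>" "subgroup A G"
  shows "\<phi> \<one> = 0"
  using equiv_homD(2)[OF assms(1), of \<one> \<one>] assms(2) by (simp add: subgroup.one_closed)

lemma equiv_hom_inv:
  assumes "equiv_hom A \<phi>" "subgroup A G" "a \<in> A"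
  shows "\<phi> (inv a) = - \<phi> a"
  using equiv_homD(2)[OF assms(1,3), of "inv a"] assms equiv_hom_one[OF assms(1,2)]
  by (simp add: subgroup.m_inv_closed subgroup.mem_carrier eq_neg_iff_add_eq_0 add.commute)

lemma equiv_hom_translate_trivial:
  assumes "equiv_hom A \<phi>" "A \<lhd> G" "a \<in> A" "b \<in> A"
  shows "translate b (\<phi> a) = \<phi> a"
proof -
  have A: "subgroup A G" using assms by (simp add: normal_imp_subgroup)
  have "translate b (\<phi> a) = \<phi> (b \<otimes> a \<otimes> inv b)"
    using equiv_homD(3)[OF assms(1,3)] assms A by (simp add: subgroup.mem_carrier)
  also have "\<dots> = \<phi> b + \<phi> a + - \<phi> b"
    using equiv_homD(2)[OF assms(1)] assms A equiv_hom_inv[OF assms(1) A]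
    by (simp add: subgroup.m_closed subgroup.m_inv_closed)
  finally show ?thesis by simp
qed

lemma equiv_hom_image_gmodule:
  assumes "equiv_hom A \<phi>" "A \<lhd> G"
  shows "gmodule (\<phi> ` A)"
  unfolding gmodule_def add_subgroup_def
proof (intro conjI ballI subsetI)
  have A: "subgroup A G" using assms by (simp add: normal_imp_subgroup)
  show "0 \<in> \<phi> ` A" using equiv_hom_one[OF assms(1) A] A by (metis imageI subgroup.one_closed)
  show "x - y \<in> \<phi> ` A" if xy: "x \<in> \<phi> ` A" "y \<in> \<phi> ` A" for x y
  proof -
    obtain a b where ab: "a \<in> A" "b \<in> A" "x = \<phi> a" "y = \<phi> b" using xy by blast
    then have "x - y = \<phi> (a \<otimes> inv b)"
      using equiv_homD(2)[OF assms(1)] equiv_hom_inv[OF assms(1) A] A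
      by (simp add: subgroup.m_inv_closed)
    then show ?thesis using ab A by (simp add: subgroup.m_closed subgroup.m_inv_closed)
  qed
  show "x \<in> fn_space" if "x \<in> \<phi> ` A" for x using that equiv_homD(1)[OF assms(1)] by auto
  show "translate g x \<in> \<phi> ` A" if g: "g \<in> carrier G" "x \<in> \<phi> ` A" for g x
  proof -
    obtain a where a: "a \<in> A" "x = \<phi> a" using g by blast
    then have "translate g x = \<phi> (g \<otimes> a \<otimes> inv g)" using equiv_homD(3)[OF assms(1)] g by simp
    moreover have "g \<otimes> a \<otimes> inv g \<in> A" using assms(2) a g by (simp add: normal_inv_iff)
    ultimately show ?thesis by simp
  qed
qed

text \<open>The lever for minimality: two equivariant maps on \<open>A\<close> that vanish on
  \<open>B\<close> agree on all of \<open>A\<close> or only on \<open>B\<close>. Comparison with the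
  zero map treats kernels.\<close>

lemma equalizer_normal:
  assumes "equiv_hom A \<phi>" "equiv_hom A \<psi>" "A \<lhd> G"
  shows "{a \<in> A. \<phi> a = \<psi> a} \<lhd> G"
proof -
  have A: "subgroup A G" using assms by (simp add: normal_imp_subgroup)
  have "subgroup {a \<in> A. \<phi> a = \<psi> a} G"
  proof (rule subgroupI)
    show "{a \<in> A. \<phi> a = \<psi> a} \<subseteq> carrier G" using A subgroup.subset by blast
    show "{a \<in> A. \<phi> a = \<psi> a} \<noteq> {}"
      using A equiv_hom_one[OF assms(1) A] equiv_hom_one[OF assms(2) A]
      by (auto intro: subgroup.one_closed)
  qed (use A assms equiv_homD(2)[OF assms(1)] equiv_homD(2)[OF assms(2)]
       equiv_hom_inv[OF assms(1) A] equiv_hom_inv[OF assms(2) A] in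
       \<open>auto simp: subgroup.m_closed subgroup.m_inv_closed\<close>)
  moreover have "g \<otimes> a \<otimes> inv g \<in> {a \<in> A. \<phi> a = \<psi> a}" if "g \<in> carrier G" "a \<in> {a \<in> A. \<phi> a = \<psi> a}" for g a
    using that assms equiv_homD(3)[OF assms(1)] equiv_homD(3)[OF assms(2)]
    by (auto simp: normal_inv_iff)
  ultimately show ?thesis by (auto simp: normal_inv_iff)
qed

lemma equiv_hom_zero: "A \<lhd> G \<Longrightarrow> equiv_hom A (\<lambda>_. 0)"
  by (auto simp: equiv_hom_def fn_space_def)

lemma equiv_hom_double:
  assumes "equiv_hom A \<phi>"
  shows "equiv_hom A (\<lambda>a. \<phi> a + \<phi> a)"
  using equiv_homD[OF assms]
  by (auto simp: equiv_hom_def translate_add intro: add_subgroup_add[OF fn_space_subgroup])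

text \<open>Where \<open>A\<close> acts trivially, the derivation rule becomes additivity.
  Equivariance results from expanding the derivation at \<open>g \<otimes> a\<close> and at the
  equal product \<open>(g \<otimes> a \<otimes> inv g) \<otimes> g\<close>.\<close>

lemma delta_equiv_hom:
  assumes V: "gmodule V" and A: "A \<lhd> G" and triv: "\<And>a v. a \<in> A \<Longrightarrow> v \<in> V \<Longrightarrow> translate a v = v"
    and f: "f \<in> cocycles V N"
  shows "equiv_hom A (\<lambda>a. delta a f)"
proof -
  have AG: "a \<in> carrier G" if "a \<in> A" for a using A that by (meson normal_imp_subgroup subgroup.mem_carrier)
  have 1: "delta (a \<otimes> b) f = delta a f + delta b f" if "a \<in> A" "b \<in> A" for a b
    using that AG cocyclesD(3)[OF f] triv by (simp add: delta_mult)
  have 2: "delta (g \<otimes> a \<otimes> inv g) f = translate g (delta a f)" if g: "g \<in> carrier G" "a \<in> A" for g a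
  proof -
    have "g \<otimes> a \<otimes> inv g \<in> A" using g A by (simp add: normal_inv_iff)
    moreover have "delta g f \<in> V" using cocyclesD(3)[OF f] g by simp
    ultimately have "delta ((g \<otimes> a \<otimes> inv g) \<otimes> g) f = delta g f + delta (g \<otimes> a \<otimes> inv g) f"
      using g AG triv by (simp add: delta_mult)
    moreover have "(g \<otimes> a \<otimes> inv g) \<otimes> g = g \<otimes> a" using g AG by (simp add: m_assoc)
    moreover have "delta (g \<otimes> a) f = translate g (delta a f) + delta g f"
      using g AG by (simp add: delta_mult)
    ultimately show ?thesis by (simp add: algebra_simps)
  qed
  show ?thesis
    using 1 2 AG cocyclesD(1)[OF f] by (auto simp: equiv_hom_def delta_in_fn_space)
qed

text \<open>The composite of a derivation with a module map is a derivation; the function that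
  represents it is recovered by evaluating the composite at \<open>\<one>\<close>.\<close>

lemma transport_cocycle:
  assumes V: "gmodule V" and W: "gmodule W" and h: "h \<in> cocycles V N" and N: "N \<subseteq> carrier G"
    and lamW: "\<And>v. v \<in> V \<Longrightarrow> lam v \<in> W"
    and add: "\<And>v w. v \<in> V \<Longrightarrow> w \<in> V \<Longrightarrow> lam (v + w) = lam v + lam w"
    and equi: "\<And>g v. g \<in> carrier G \<Longrightarrow> v \<in> V \<Longrightarrow> lam (translate g v) = translate g (lam v)"
  shows "\<exists>h'\<in>cocycles W N. \<forall>g\<in>carrier G. delta g h' = lam (delta g h)"
proof -
  have z: "lam 0 = 0" using add[of 0 0] gmoduleD(1)[OF V] by (simp add: add_subgroup_zero)
  define h' where "h' = (\<lambda>x. if x \<in> carrier G then lam (delta x h) \<one> else 0)"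
  have hV: "delta g h \<in> V" if "g \<in> carrier G" for g using cocyclesD(3)[OF h that] .
  have d: "delta g h' = lam (delta g h)" if g: "g \<in> carrier G" for g
  proof
    fix x
    show "delta g h' x = lam (delta g h) x"
    proof (cases "x \<in> carrier G")
      case True
      have "delta (x \<otimes> g) h = translate x (delta g h) + delta x h"
        using True g by (simp add: delta_mult)
      then have "lam (delta (x \<otimes> g) h) = translate x (lam (delta g h)) + lam (delta x h)"
        using add equi True g hV gmoduleD(3)[OF V] by simp
      then have "lam (delta (x \<otimes> g) h) \<one> = lam (delta g h) x + lam (delta x h) \<one>"
        using True by (simp add: translate_def)
      moreover have "delta g h' x = h' (x \<otimes> g) - h' x"
        using True by (simp add: delta_def translate_def)
      ultimately show ?thesis using True g by (simp add: h'_def)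
    next
      case False
      have "lam (delta g h) \<in> fn_space" using lamW hV g gmoduleD(2)[OF W] by blast
      then show ?thesis using False by (simp add: delta_def translate_def h'_def fn_space_def)
    qed
  qed
  moreover have "h' \<in> cocycles W N"
    unfolding cocycles_def
    using d lamW hV z N cocyclesD(4)[OF h] delta_one[OF cocyclesD(1)[OF h]]
    by (auto simp: fn_space_def h'_def subset_iff)
  ultimately show ?thesis by blast
qed

end

section \<open>Complements of chief factors\<close>

context group
begin

text \<open>Coinduction of a character: \<open>a\<close> goes to the function with value
  \<open>ch (x \<otimes> a \<otimes> inv x)\<close> at \<open>x\<close>. The character may have a
  kernel larger than \<open>B\<close>, but the kernel of the coinduced map is normal in
  \<open>G\<close> and proper in \<open>A\<close>, so minimality makes it \<open>B\<close>.\<close>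

lemma exists_chief_embedding:
  assumes A: "A \<lhd> G" and B: "B \<lhd> G" "B \<subset> A" and fin: "finite A"
    and min: "\<And>N. N \<lhd> G \<Longrightarrow> B \<subseteq> N \<Longrightarrow> N \<subseteq> A \<Longrightarrow> N = B \<or> N = A"
    and comm: "\<And>x y. x \<in> A \<Longrightarrow> y \<in> A \<Longrightarrow> x \<otimes> y \<otimes> inv x \<otimes> inv y \<in> B"
  obtains \<phi> where "equiv_hom A \<phi>" "\<And>a. a \<in> A \<Longrightarrow> \<phi> a = 0 \<longleftrightarrow> a \<in> B"
proof -
  have sA: "subgroup A G" and sB: "subgroup B G" using A B by (auto simp: normal_imp_subgroup)
  have AG: "a \<in> carrier G" if "a \<in> A" for a using sA that by (rule subgroup.mem_carrier)
  obtain ch :: "'a \<Rightarrow> circle" where ch: "\<And>x y. x \<in> A \<Longrightarrow> y \<in> A \<Longrightarrow> ch (x \<otimes> y) = ch x + ch y"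
    "\<And>b. b \<in> B \<Longrightarrow> ch b = 0" "\<exists>a\<in>A. ch a \<noteq> 0"
    using exists_nontrivial_character[OF sA fin sB B(2) comm] by blast
  define \<phi> where "\<phi> a = (\<lambda>x. if x \<in> carrier G then ch (x \<otimes> a \<otimes> inv x) else 0)" for a
  have conjA: "x \<otimes> a \<otimes> inv x \<in> A" if "x \<in> carrier G" "a \<in> A" for x a
    using A that by (simp add: normal_inv_iff)
  have hom: "equiv_hom A \<phi>"
    unfolding equiv_hom_def
  proof (intro conjI ballI)
    show "\<phi> a \<in> fn_space" if "a \<in> A" for a by (simp add: \<phi>_def fn_space_def)
    show "\<phi> (a \<otimes> b) = \<phi> a + \<phi> b" if "a \<in> A" "b \<in> A" for a b
    proof
      fix x
      have "x \<otimes> (a \<otimes> b) \<otimes> inv x = (x \<otimes> a \<otimes> inv x) \<otimes> (x \<otimes> b \<otimes> inv x)" if "x \<in> carrier G"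
        using that AG[OF \<open>a \<in> A\<close>] AG[OF \<open>b \<in> A\<close>] by (simp add: m_assoc inv_solve_left)
      then show "\<phi> (a \<otimes> b) x = (\<phi> a + \<phi> b) x"
        using that conjA ch(1) by (simp add: \<phi>_def)
    qed
    show "\<phi> (g \<otimes> a \<otimes> inv g) = translate g (\<phi> a)" if "g \<in> carrier G" "a \<in> A" for g a
      using that AG by (auto simp: \<phi>_def translate_def fun_eq_iff m_assoc inv_mult_group)
  qed
  have "{a \<in> A. \<phi> a = 0} \<lhd> G" by (rule equalizer_normal[OF hom equiv_hom_zero[OF A] A])
  moreover have "b \<in> A \<and> \<phi> b = 0" if "b \<in> B" for b
  proof -
    have "x \<otimes> b \<otimes> inv x \<in> B" if "x \<in> carrier G" for x using B(1) that \<open>b \<in> B\<close> by (simp add: normal_inv_iff)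
    then show ?thesis using ch(2) that B(2) by (auto simp: \<phi>_def fun_eq_iff)
  qed
  then have "B \<subseteq> {a \<in> A. \<phi> a = 0}" by auto
  moreover have "{a \<in> A. \<phi> a = 0} \<noteq> A"
  proof -
    obtain a where a: "a \<in> A" "ch a \<noteq> 0" using ch(3) by auto
    then have "\<phi> a \<one> \<noteq> 0" using AG by (simp add: \<phi>_def)
    then have "\<phi> a \<noteq> 0" by force
    then show ?thesis using a by blast
  qed
  ultimately have "{a \<in> A. \<phi> a = 0} = B" using min[of "{a \<in> A. \<phi> a = 0}"] by blast
  then show ?thesis using hom that[of \<phi>] by blast
qed

text \<open>A factor from \<open>N\<close> on the right is invisible by the derivation rule;
  normality moves it to the left.\<close>

lemma delta_coset:
  assumes N: "N \<lhd> G" and f: "f \<in> cocycles V N" and m: "m \<in> N" and c: "c \<in> carrier G"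
  shows "delta (m \<otimes> c) f = delta c f"
proof -
  have mG: "m \<in> carrier G" using N m by (meson normal_imp_subgroup subgroup.mem_carrier)
  have "inv c \<otimes> m \<otimes> c \<in> N" using N m c normal.inv_op_closed1 by metis
  then have "delta (c \<otimes> (inv c \<otimes> m \<otimes> c)) f = delta c f"
    using delta_eq_0_mult[of c "inv c \<otimes> m \<otimes> c" f] cocyclesD(4)[OF f] c mG by simp
  moreover have "c \<otimes> (inv c \<otimes> m \<otimes> c) = m \<otimes> c" using c mG by (simp add: m_assoc[symmetric])
  ultimately show ?thesis by simp
qed

lemma generates_mod_lift:
  assumes N: "N \<lhd> G" and m: "m \<in> N" and xy: "x \<in> carrier G" "y \<in> carrier G"
    and gen: "generates_mod N x y"
  shows "generates_mod N x (m \<otimes> y)"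
proof -
  have NG: "N \<subseteq> carrier G" using N by (simp add: normal_imp_subgroup subgroup.subset)
  have mG: "m \<in> carrier G" using NG m by blast
  let ?K = "generate G ({x, m \<otimes> y} \<union> N)"
  have K: "subgroup ?K G" using xy mG NG by (intro generate_is_subgroup) auto
  have "m \<in> ?K" "m \<otimes> y \<in> ?K" using m by (auto intro: generate.incl)
  then have "inv m \<otimes> (m \<otimes> y) \<in> ?K"
    using K by (simp add: subgroup.m_closed subgroup.m_inv_closed)
  moreover have "inv m \<otimes> (m \<otimes> y) = y" using mG xy by (simp add: m_assoc[symmetric])
  ultimately have "y \<in> ?K" by metis
  then have "{x, y} \<union> N \<subseteq> ?K" by (auto intro: generate.incl)
  from generate_subgroup_incl[OF this K] have "carrier G \<subseteq> ?K" using gen by (simp add: generates_mod_def)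
  then show ?thesis using subgroup.subset[OF K] unfolding generates_mod_def by blast
qed

text \<open>For \<open>N = A\<close> and the chief factor \<open>V\<close> this is the direction
  subgroup of the lifts of \<open>c\<close> that fail with \<open>a\<close>;
  \<open>value_pairs\<close> plays the same role for the middle edge of the path.\<close>

abbreviation values_at :: "'a \<Rightarrow> 'a \<Rightarrow> ('a \<Rightarrow> circle) set \<Rightarrow> 'a set \<Rightarrow> ('a \<Rightarrow> circle) set" where
  "values_at c a V N \<equiv> delta c ` {f \<in> cocycles V N. delta a f = 0}"

abbreviation value_pairs ::
  "'a \<Rightarrow> 'a \<Rightarrow> ('a \<Rightarrow> circle) set \<Rightarrow> 'a set \<Rightarrow> (('a \<Rightarrow> circle) \<times> ('a \<Rightarrow> circle)) set" where
  "value_pairs c1 c2 V N \<equiv> (\<lambda>f. (delta c1 f, delta c2 f)) ` cocycles V N"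

definition obstructed :: "'a \<Rightarrow> 'a \<Rightarrow> 'a set \<Rightarrow> ('a \<Rightarrow> circle) set \<Rightarrow> 'a \<Rightarrow> 'a \<Rightarrow> bool" where
  "obstructed a1 a2 N V c1 c2 \<longleftrightarrow> balanced V (values_at c1 a1 V N) (values_at c2 a2 V N) (value_pairs c1 c2 V N)"

end

section \<open>One abelian chief factor and its complements\<close>

locale chief_step = group G for G (structure) +
  fixes A B :: "'a set" and \<phi> :: "'a \<Rightarrow> 'a \<Rightarrow> circle"
  assumes fin: "finite (carrier G)"
    and A: "A \<lhd> G" and B: "B \<lhd> G" and BA: "B \<subset> A"
    and minimal: "\<And>N. N \<lhd> G \<Longrightarrow> B \<subseteq> N \<Longrightarrow> N \<subseteq> A \<Longrightarrow> N = B \<or> N = A"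
    and comm: "\<And>x y. x \<in> A \<Longrightarrow> y \<in> A \<Longrightarrow> x \<otimes> y \<otimes> inv x \<otimes> inv y \<in> B"
    and hom: "equiv_hom A \<phi>" and ker: "\<And>a. a \<in> A \<Longrightarrow> \<phi> a = 0 \<longleftrightarrow> a \<in> B"
begin

abbreviation V :: "('a \<Rightarrow> circle) set" where "V \<equiv> \<phi> ` A"

text \<open>The stabilizers of the splittings are the complements of \<open>A/B\<close>.\<close>

definition splittings :: "('a \<Rightarrow> circle) set" where
  "splittings = {f \<in> cocycles V B. \<forall>a\<in>A. delta a f = \<phi> a}"

lemma sub_A: "subgroup A G" and sub_B: "subgroup B G"
  using A B by (simp_all add: normal_imp_subgroup)

lemma A_carrier: "a \<in> A \<Longrightarrow> a \<in> carrier G"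
  using sub_A by (rule subgroup.mem_carrier)

lemma A_subset: "A \<subseteq> carrier G" and B_subset: "B \<subseteq> carrier G"
  using sub_A sub_B by (simp_all add: subgroup.subset)

lemma finite_A: "finite A" using fin A_subset by (rule rev_finite_subset)

lemma V_gmodule: "gmodule V" using hom A by (rule equiv_hom_image_gmodule)

lemma V_add_subgroup: "add_subgroup V" using V_gmodule by (rule gmoduleD)

lemma finite_V: "finite V" using finite_A by simp

lemma translate_V: "a \<in> A \<Longrightarrow> v \<in> V \<Longrightarrow> translate a v = v"
  using equiv_hom_translate_trivial[OF hom A] by blast

lemma normal_between_eq_B: "N \<lhd> G \<Longrightarrow> B \<subseteq> N \<Longrightarrow> N \<subset> A \<Longrightarrow> N = B"
  using minimal by blast

lemma exists_nonzero: "\<exists>a\<in>A. \<phi> a \<noteq> 0"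
  using BA ker by blast

text \<open>The elements of \<open>A\<close> whose image is killed by doubling form a normal
  subgroup between \<open>B\<close> and \<open>A\<close>.\<close>

lemma V_char_cases:
  obtains "\<And>v. v \<in> V \<Longrightarrow> v + v = 0" | "\<And>v. v \<in> V \<Longrightarrow> v + v = 0 \<Longrightarrow> v = 0"
proof -
  let ?N = "{a \<in> A. \<phi> a + \<phi> a = 0}"
  have "?N \<lhd> G"
    by (rule equalizer_normal[OF equiv_hom_double[OF hom] equiv_hom_zero[OF A] A])
  moreover have "B \<subseteq> ?N"
  proof
    fix b assume "b \<in> B"
    then have "b \<in> A" "\<phi> b = 0" using BA ker by blast+
    then show "b \<in> ?N" by simp
  qed
  ultimately have "?N = B \<or> ?N = A" using minimal[of ?N] by blast
  then show ?thesis
  proof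
    assume "?N = B"
    then show ?thesis using ker by (intro that(2)) blast
  next
    assume "?N = A"
    then show ?thesis by (intro that(1)) blast
  qed
qed

lemma splittingsD:
  assumes "f \<in> splittings"
  shows "f \<in> cocycles V B" "a \<in> A \<Longrightarrow> delta a f = \<phi> a"
  using assms by (auto simp: splittings_def)

text \<open>With \<open>splittings_add\<close>: if there are splittings at all, they form one coset
  of \<open>cocycles V A\<close>. This is the source of the coset structure of the forbidden
  lifts.\<close>

lemma splittings_diff:
  assumes "f \<in> splittings" "h \<in> splittings"
  shows "f - h \<in> cocycles V A"
proof -
  have "f - h \<in> cocycles V B"
    using assms splittingsD(1) cocycles_subgroup[OF V_gmodule] by (blast intro: add_subgroup_diff)
  then show ?thesis using assms by (auto simp: cocycles_def splittings_def delta_diff)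
qed

lemma splittings_add:
  assumes "f \<in> splittings" "h \<in> cocycles V A"
  shows "f + h \<in> splittings"
proof -
  have "h \<in> cocycles V B" using assms cocycles_antimono[of B A V] BA by blast
  then have "f + h \<in> cocycles V B"
    using assms splittingsD(1) cocycles_subgroup[OF V_gmodule] by (blast intro: add_subgroup_add)
  then show ?thesis using assms cocyclesD(4)[OF assms(2)] by (auto simp: splittings_def delta_add)
qed

text \<open>A lift shifts the value of a splitting by exactly \<open>\<phi> m\<close>, since
  \<open>A\<close> acts trivially on \<open>V\<close>.\<close>

lemma delta_lift:
  assumes "f \<in> splittings" "m \<in> A" "c \<in> carrier G"
  shows "delta (m \<otimes> c) f = delta c f + \<phi> m"
proof -
  have "delta c f \<in> V" using cocyclesD(3) splittingsD(1) assms by blast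
  then show ?thesis
    using assms A_carrier splittingsD(2) translate_V by (simp add: delta_mult)
qed

lemma splitting_not_generates:
  assumes "f \<in> splittings" "delta x f = 0" "delta y f = 0" "x \<in> carrier G" "y \<in> carrier G"
  shows "\<not> generates_mod B x y"
proof
  assume gen: "generates_mod B x y"
  obtain a where a: "a \<in> A" "\<phi> a \<noteq> 0" using exists_nonzero by blast
  have f: "f \<in> cocycles V B" using assms splittingsD by blast
  have "delta a f = 0"
    using generates_mod_delta_0[OF gen cocyclesD(1)[OF f] assms(2,3) cocyclesD(4)[OF f] assms(4,5) B_subset]
      A_carrier a by blast
  then show False using splittingsD(2)[OF assms(1) a(1)] a by simp
qed

text \<open>The projection \<open>F\<close> along \<open>K\<close>, sending
  \<open>a \<otimes> k\<close> to \<open>\<phi> a\<close>, is the derivation attached to the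
  complement. It is well defined because the factor in \<open>A\<close> is unique up to
  \<open>B\<close>, which \<open>\<phi>\<close> kills.\<close>

lemma complement_splitting:
  assumes K: "subgroup K G" and KA: "K \<inter> A = B"
    and prod: "\<And>g. g \<in> carrier G \<Longrightarrow> \<exists>a\<in>A. \<exists>k\<in>K. g = a \<otimes> k"
  shows "\<exists>f\<in>splittings. \<forall>k\<in>K. delta k f = 0"
proof -
  have KG: "k \<in> carrier G" if "k \<in> K" for k using K that by (rule subgroup.mem_carrier)
  define F where "F g = \<phi> (SOME a. a \<in> A \<and> inv a \<otimes> g \<in> K)" for g
  have F: "F (a \<otimes> k) = \<phi> a" if "a \<in> A" "k \<in> K" for a k
  proof -
    let ?b = "SOME b. b \<in> A \<and> inv b \<otimes> (a \<otimes> k) \<in> K"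
    have "a \<in> A \<and> inv a \<otimes> (a \<otimes> k) \<in> K" using that A_carrier KG by (simp add: m_assoc[symmetric])
    then have b: "?b \<in> A" "inv ?b \<otimes> (a \<otimes> k) \<in> K" using someI_ex[of "\<lambda>b. b \<in> A \<and> inv b \<otimes> (a \<otimes> k) \<in> K"] by blast+
    have "inv ?b \<otimes> (a \<otimes> k) \<otimes> inv k \<in> K"
      using b(2) that K by (simp add: subgroup.m_closed subgroup.m_inv_closed)
    then have "inv ?b \<otimes> a \<in> K" using b(1) that A_carrier KG by (simp add: m_assoc)
    moreover have "inv ?b \<otimes> a \<in> A" using b(1) that sub_A by (simp add: subgroup.m_closed subgroup.m_inv_closed)
    ultimately have "\<phi> (inv ?b \<otimes> a) = 0" using KA ker by blast
    then have "\<phi> a = \<phi> ?b"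
      using equiv_homD(2)[OF hom, of "inv ?b" a] equiv_hom_inv[OF hom sub_A b(1)] b(1) that sub_A
      by (simp add: subgroup.m_inv_closed)
    then show ?thesis by (simp add: F_def)
  qed
  define f where "f = (\<lambda>g. if g \<in> carrier G then F g \<one> else 0)"
  have d: "delta (a \<otimes> k) f = \<phi> a" if ak: "a \<in> A" "k \<in> K" for a k
  proof
    fix x
    show "delta (a \<otimes> k) f x = \<phi> a x"
    proof (cases "x \<in> carrier G")
      case True
      then obtain a' k' where x: "a' \<in> A" "k' \<in> K" "x = a' \<otimes> k'" using prod by blast
      have conj: "k' \<otimes> a \<otimes> inv k' \<in> A" using A KG x ak by (simp add: normal_inv_iff)
      have "x \<otimes> (a \<otimes> k) = (a' \<otimes> (k' \<otimes> a \<otimes> inv k')) \<otimes> (k' \<otimes> k)"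
        using x ak A_carrier KG by (simp add: m_assoc inv_solve_left)
      then have "F (x \<otimes> (a \<otimes> k)) = \<phi> a' + translate k' (\<phi> a)"
        using F[of "a' \<otimes> (k' \<otimes> a \<otimes> inv k')" "k' \<otimes> k"] x ak conj sub_A K
          equiv_homD(2)[OF hom x(1) conj] equiv_homD(3)[OF hom ak(1), of k'] KG
        by (simp add: subgroup.m_closed)
      moreover have "F x = \<phi> a'" using F x by simp
      ultimately have "delta (a \<otimes> k) f x = translate k' (\<phi> a) \<one>"
        using True ak A_carrier KG by (simp add: delta_def translate_def[of "a \<otimes> k"] f_def)
      also have "translate k' (\<phi> a) = translate x (\<phi> a)"
      proof -
        have "translate k' (\<phi> a) \<in> V" using gmoduleD(3)[OF V_gmodule] KG x ak by blast
        then show ?thesis using x A_carrier KG translate_V by (simp add: translate_mult)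
      qed
      also have "translate x (\<phi> a) \<one> = \<phi> a x" using True by (simp add: translate_def)
      finally show ?thesis .
    next
      case False
      then show ?thesis using equiv_homD(1)[OF hom ak(1)]
        by (simp add: delta_def translate_def f_def fn_space_def)
    qed
  qed
  have one: "\<one> \<in> K" "\<one> \<in> A" using K sub_A by (simp_all add: subgroup.one_closed)
  have dA: "delta a f = \<phi> a" if "a \<in> A" for a using d[OF that one(1)] A_carrier that by simp
  have dK: "delta k f = 0" if "k \<in> K" for k
    using d[OF one(2) that] KG that equiv_hom_one[OF hom sub_A] by simp
  have "f \<in> cocycles V B"
    unfolding cocycles_def
  proof (intro CollectI conjI ballI)
    show "f \<in> fn_space" by (simp add: f_def fn_space_def)
    have "F (\<one> \<otimes> \<one>) = \<phi> \<one>" using F one by blast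
    then show "f \<one> = 0" using equiv_hom_one[OF hom sub_A] by (simp add: f_def)
    show "delta g f \<in> V" if "g \<in> carrier G" for g using prod[OF that] d by auto
    show "delta n f = 0" if "n \<in> B" for n using dK KA that by blast
  qed
  then show ?thesis using dA dK by (auto simp: splittings_def)
qed

text \<open>The subgroup \<open>?K\<close> generated by \<open>x\<close>, \<open>y\<close> and
  \<open>B\<close> satisfies G = A ?K. Its intersection with \<open>A\<close> is normalised by
  \<open>?K\<close>, and by \<open>A\<close> because \<open>A/B\<close> is abelian, so it is normal
  in \<open>G\<close>. It is not \<open>A\<close>, otherwise \<open>?K\<close> would be everything;
  so it is \<open>B\<close>, and \<open>?K\<close> is a complement.\<close>

lemma not_generates_splitting:
  assumes gen: "generates_mod A x y" "\<not> generates_mod B x y" and xy: "x \<in> carrier G" "y \<in> carrier G"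
  shows "\<exists>f\<in>splittings. delta x f = 0 \<and> delta y f = 0"
proof -
  let ?K = "generate G ({x, y} \<union> B)"
  have K: "subgroup ?K G" using xy B_subset by (intro generate_is_subgroup) auto
  have incl: "x \<in> ?K" "y \<in> ?K" "B \<subseteq> ?K" by (auto intro: generate.incl)
  have KG: "k \<in> carrier G" if "k \<in> ?K" for k using K that by (rule subgroup.mem_carrier)
  have AK: "subgroup (A <#> ?K) G" using A K by (rule mult_norm_subgroup)
  have "{x, y} \<union> A \<subseteq> A <#> ?K"
  proof -
    have "a \<in> A <#> ?K" if "a \<in> A" for a
    proof -
      have "a = a \<otimes> \<one>" using that A_carrier by simp
      then show ?thesis using that subgroup.one_closed[OF K] unfolding set_mult_def by blast
    qed
    moreover have "z \<in> A <#> ?K" if "z \<in> ?K" for z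
    proof -
      have "z = \<one> \<otimes> z" using that KG by simp
      then show ?thesis using that subgroup.one_closed[OF sub_A] unfolding set_mult_def by blast
    qed
    ultimately show ?thesis using incl by blast
  qed
  from generate_subgroup_incl[OF this AK] have "carrier G \<subseteq> A <#> ?K"
    using gen(1) by (simp add: generates_mod_def)
  then have prod: "\<exists>a\<in>A. \<exists>k\<in>?K. g = a \<otimes> k" if "g \<in> carrier G" for g
    using that unfolding set_mult_def by blast
  have "?K \<inter> A \<lhd> G"
    unfolding normal_inv_iff
  proof (intro conjI ballI)
    show "subgroup (?K \<inter> A) G" using K sub_A by (rule subgroups_Inter_pair)
    fix g z assume g: "g \<in> carrier G" and z: "z \<in> ?K \<inter> A"
    obtain a k where ak: "a \<in> A" "k \<in> ?K" "g = a \<otimes> k" using prod[OF g] by blast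
    let ?w = "k \<otimes> z \<otimes> inv k"
    have w: "?w \<in> ?K" "?w \<in> A"
      using ak z K A KG by (auto simp: normal_inv_iff subgroup.m_closed subgroup.m_inv_closed)
    have wG: "?w \<in> carrier G" using w A_carrier by blast
    have "a \<otimes> ?w \<otimes> inv a \<otimes> inv ?w \<in> ?K" using comm[OF ak(1) w(2)] incl by blast
    then have "a \<otimes> ?w \<otimes> inv a \<otimes> inv ?w \<otimes> ?w \<in> ?K" using w(1) K by (simp add: subgroup.m_closed)
    then have "a \<otimes> ?w \<otimes> inv a \<in> ?K" using wG ak A_carrier by (simp add: m_assoc)
    moreover have "a \<otimes> ?w \<otimes> inv a = g \<otimes> z \<otimes> inv g"
      using ak z KG A_carrier by (simp add: m_assoc inv_mult_group)
    moreover have "g \<otimes> z \<otimes> inv g \<in> A" using A g z by (auto simp: normal_inv_iff)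
    ultimately show "g \<otimes> z \<otimes> inv g \<in> ?K \<inter> A" by simp
  qed
  moreover have "B \<subseteq> ?K \<inter> A" using incl BA by blast
  moreover have "?K \<inter> A \<noteq> A"
  proof
    assume "?K \<inter> A = A"
    then have "{x, y} \<union> A \<subseteq> ?K" using incl by blast
    from generate_subgroup_incl[OF this K] have "carrier G \<subseteq> ?K"
      using gen(1) by (simp add: generates_mod_def)
    then show False using gen(2) subgroup.subset[OF K] by (auto simp: generates_mod_def)
  qed
  ultimately have "?K \<inter> A = B" using minimal[of "?K \<inter> A"] by blast
  from complement_splitting[OF K this prod] show ?thesis using incl by blast
qed

end

section \<open>Lifting generating paths\<close>

lemma index_two_delta:
  fixes U :: "'v::ab_group_add set"
  assumes U: "add_subgroup U" "U \<subseteq> V" and V: "add_subgroup V" "finite V" "2 * card U = card V"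
    and x: "x \<in> V" "x \<notin> U" and y: "y \<in> V" "y \<notin> U"
  shows "x - y \<in> U"
proof -
  have fU: "finite U" using U V finite_subset by blast
  have "y + u \<notin> U" if "u \<in> U" for u
    using add_subgroup_diff[OF U(1) _ that, of "y + u"] y by auto
  then have "U \<inter> (+) y ` U = {}" by auto
  then have "card (U \<union> (+) y ` U) = card V"
    using fU V by (subst card_Un_disjoint) (auto simp: card_image)
  moreover have "U \<union> (+) y ` U \<subseteq> V" using U V(1) y by (auto intro: add_subgroup_add)
  ultimately have "U \<union> (+) y ` U = V" using V(2) by (intro card_subset_eq)
  then obtain u where "u \<in> U" "x = y + u" using x by blast
  then show ?thesis by simp
qed

context group
begin

lemma equiv_hom_factor:
  assumes hom: "equiv_hom A \<phi>" "equiv_hom A \<psi>" and A: "A \<lhd> G"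
    and ker: "\<And>a. a \<in> A \<Longrightarrow> \<phi> a = 0 \<Longrightarrow> \<psi> a = 0"
  obtains lam where "\<And>a. a \<in> A \<Longrightarrow> lam (\<phi> a) = \<psi> a"
    "\<And>v w. v \<in> \<phi> ` A \<Longrightarrow> w \<in> \<phi> ` A \<Longrightarrow> lam (v + w) = lam v + lam w"
    "\<And>g v. g \<in> carrier G \<Longrightarrow> v \<in> \<phi> ` A \<Longrightarrow> lam (translate g v) = translate g (lam v)"
proof -
  have sA: "subgroup A G" using A by (rule normal_imp_subgroup)
  define lam where "lam v = \<psi> (SOME a. a \<in> A \<and> \<phi> a = v)" for v
  have lam: "lam (\<phi> a) = \<psi> a" if a: "a \<in> A" for a
  proof -
    let ?b = "SOME b. b \<in> A \<and> \<phi> b = \<phi> a"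
    have b: "?b \<in> A" "\<phi> ?b = \<phi> a" using someI_ex[of "\<lambda>b. b \<in> A \<and> \<phi> b = \<phi> a"] a by blast+
    have ib: "inv ?b \<in> A" using b sA by (simp add: subgroup.m_inv_closed)
    have "\<phi> (inv ?b \<otimes> a) = 0"
      using equiv_homD(2)[OF hom(1) ib a] equiv_hom_inv[OF hom(1) sA b(1)] b(2) by simp
    then have "\<psi> (inv ?b \<otimes> a) = 0" using ker ib a sA by (simp add: subgroup.m_closed)
    then have "\<psi> a = \<psi> ?b"
      using equiv_homD(2)[OF hom(2) ib a] equiv_hom_inv[OF hom(2) sA b(1)] by simp
    then show ?thesis by (simp add: lam_def)
  qed
  show thesis
  proof (rule that[OF lam])
    show "lam (v + w) = lam v + lam w" if vw: "v \<in> \<phi> ` A" "w \<in> \<phi> ` A" for v w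
    proof -
      obtain a b where ab: "a \<in> A" "b \<in> A" "v = \<phi> a" "w = \<phi> b" using vw by blast
      have "lam (\<phi> (a \<otimes> b)) = \<psi> (a \<otimes> b)" using lam ab sA by (simp add: subgroup.m_closed)
      then show ?thesis using ab lam equiv_homD(2)[OF hom(1)] equiv_homD(2)[OF hom(2)] by simp
    qed
    show "lam (translate g v) = translate g (lam v)" if g: "g \<in> carrier G" "v \<in> \<phi> ` A" for g v
    proof -
      obtain a where a: "a \<in> A" "v = \<phi> a" using g by blast
      have "g \<otimes> a \<otimes> inv g \<in> A" using A a g by (simp add: normal_inv_iff)
      then have "lam (\<phi> (g \<otimes> a \<otimes> inv g)) = \<psi> (g \<otimes> a \<otimes> inv g)" by (rule lam)
      then show ?thesis using a g lam equiv_homD(3)[OF hom(1)] equiv_homD(3)[OF hom(2)] by simp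
    qed
  qed
qed

lemma generates_mod_mono:
  assumes "B \<subseteq> A" "A \<subseteq> carrier G" "x \<in> carrier G" "y \<in> carrier G" "generates_mod B x y"
  shows "generates_mod A x y"
proof -
  have "generate G ({x, y} \<union> B) \<subseteq> generate G ({x, y} \<union> A)" by (rule mono_generate) (use assms in auto)
  moreover have "generate G ({x, y} \<union> A) \<subseteq> carrier G" using assms by (intro generate_incl) auto
  ultimately show ?thesis using assms by (auto simp: generates_mod_def)
qed

text \<open>Lets an assumption on \<open>c1\<close>, \<open>c2\<close> modulo \<open>N\<close> speak
  about all their lifts.\<close>

lemma obstructed_coset:
  assumes "N \<lhd> G" "m1 \<in> N" "m2 \<in> N" "c1 \<in> carrier G" "c2 \<in> carrier G"
  shows "obstructed a1 a2 N V (m1 \<otimes> c1) (m2 \<otimes> c2) \<longleftrightarrow> obstructed a1 a2 N V c1 c2"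
proof -
  have "delta (m1 \<otimes> c1) f = delta c1 f" "delta (m2 \<otimes> c2) f = delta c2 f"
    if "f \<in> cocycles V N" for f
    using that assms delta_coset by blast+
  then show ?thesis unfolding obstructed_def by (simp cong: image_cong_simp conj_cong)
qed

lemma add_subgroup_delta_image:
  assumes "gmodule V"
  shows "add_subgroup (values_at c a V N)"
proof -
  let ?S = "{f \<in> cocycles V N. delta a f = 0}"
  have S: "add_subgroup ?S"
    using cocycles_subgroup[OF assms, of N] by (auto simp: add_subgroup_def delta_diff)
  have "0 \<in> delta c ` ?S" using add_subgroup_zero[OF S] delta_zero[of c] by (metis imageI)
  moreover have "delta c f - delta c h \<in> delta c ` ?S" if "f \<in> ?S" "h \<in> ?S" for f h
    using imageI[OF add_subgroup_diff[OF S that], of "delta c"] by (simp only: delta_diff)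
  ultimately show ?thesis unfolding add_subgroup_def by (auto simp only:)
qed

end

section \<open>Forbidden lifts and Gaschuetz's count\<close>

context chief_step
begin

text \<open>The solutions for \<open>\<phi> m\<close> of \<open>delta (m \<otimes> c) f = 0\<close>,
  by \<open>delta_lift\<close>: some complement contains both \<open>a\<close> and the lifted
  \<open>c\<close>.\<close>

definition forbidden :: "'a \<Rightarrow> 'a \<Rightarrow> ('a \<Rightarrow> circle) set" where
  "forbidden a c = (\<lambda>f. - delta c f) ` {f \<in> splittings. delta a f = 0}"

definition forbidden_pairs :: "'a \<Rightarrow> 'a \<Rightarrow> (('a \<Rightarrow> circle) \<times> ('a \<Rightarrow> circle)) set" where
  "forbidden_pairs c d = (\<lambda>f. (- delta c f, - delta d f)) ` splittings"

lemma lift_generates_iff: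
  assumes "a \<in> carrier G" "c \<in> carrier G" "generates_mod A a c" "m \<in> A"
  shows "generates_mod B a (m \<otimes> c) \<longleftrightarrow> \<phi> m \<notin> forbidden a c"
proof
  have mc: "m \<otimes> c \<in> carrier G" using assms A_carrier by simp
  show "\<phi> m \<notin> forbidden a c" if gen: "generates_mod B a (m \<otimes> c)"
  proof
    assume "\<phi> m \<in> forbidden a c"
    then obtain f where f: "f \<in> splittings" "delta a f = 0" "\<phi> m = - delta c f"
      by (auto simp: forbidden_def)
    then have "delta (m \<otimes> c) f = 0" using delta_lift assms by simp
    then show False using splitting_not_generates f assms mc gen by blast
  qed
  show "generates_mod B a (m \<otimes> c)" if nf: "\<phi> m \<notin> forbidden a c"
  proof (rule ccontr)
    assume "\<not> generates_mod B a (m \<otimes> c)"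
    then obtain f where f: "f \<in> splittings" "delta a f = 0" "delta (m \<otimes> c) f = 0"
      using not_generates_splitting[OF generates_mod_lift[OF A assms(4,1,2,3)]] assms(1) mc by blast
    then have "\<phi> m = - delta c f" using delta_lift assms by (simp add: eq_neg_iff_add_eq_0 add.commute)
    then show False using nf f by (auto simp: forbidden_def)
  qed
qed

lemma lifts_generate_iff:
  assumes "c \<in> carrier G" "d \<in> carrier G" "generates_mod A c d" "m \<in> A" "n \<in> A"
  shows "generates_mod B (m \<otimes> c) (n \<otimes> d) \<longleftrightarrow> (\<phi> m, \<phi> n) \<notin> forbidden_pairs c d"
proof
  have mc: "m \<otimes> c \<in> carrier G" "n \<otimes> d \<in> carrier G" using assms A_carrier by simp_all
  have gA: "generates_mod A (m \<otimes> c) (n \<otimes> d)"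
    using generates_mod_lift[OF A assms(5,1,2,3)] generates_mod_lift[OF A assms(4) mc(2) assms(1)]
      generates_mod_commute by blast
  show "(\<phi> m, \<phi> n) \<notin> forbidden_pairs c d" if gen: "generates_mod B (m \<otimes> c) (n \<otimes> d)"
  proof
    assume "(\<phi> m, \<phi> n) \<in> forbidden_pairs c d"
    then obtain f where f: "f \<in> splittings" "\<phi> n = - delta d f" "\<phi> m = - delta c f"
      by (auto simp: forbidden_pairs_def)
    then have "delta (m \<otimes> c) f = 0" "delta (n \<otimes> d) f = 0" using delta_lift assms by simp_all
    then show False using splitting_not_generates f assms mc gen by blast
  qed
  show "generates_mod B (m \<otimes> c) (n \<otimes> d)" if nf: "(\<phi> m, \<phi> n) \<notin> forbidden_pairs c d"
  proof (rule ccontr)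
    assume "\<not> generates_mod B (m \<otimes> c) (n \<otimes> d)"
    then obtain f where f: "f \<in> splittings" "delta (m \<otimes> c) f = 0" "delta (n \<otimes> d) f = 0"
      using not_generates_splitting[OF gA] mc by blast
    then have "\<phi> m = - delta c f" "\<phi> n = - delta d f"
      using delta_lift assms by (simp_all add: eq_neg_iff_add_eq_0 add.commute)
    then show False using nf f by (auto simp: forbidden_pairs_def)
  qed
qed

lemma delta_in_V: "f \<in> splittings \<Longrightarrow> c \<in> carrier G \<Longrightarrow> delta c f \<in> V"
  using cocyclesD(3) splittingsD(1) by blast

lemma splittings_affine: "f \<in> splittings \<Longrightarrow> g \<in> splittings \<Longrightarrow> h \<in> splittings \<Longrightarrow> f - g + h \<in> splittings"
  using splittings_add[OF _ splittings_diff, of h f g] by (simp add: add.commute)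

lemma delta_affine: "delta c (f - g + h) = delta c f - delta c g + delta c h"
  by (simp add: delta_add delta_diff)

lemma forbidden_subset: "c \<in> carrier G \<Longrightarrow> forbidden a c \<subseteq> V"
  using delta_in_V add_subgroup_minus[OF V_add_subgroup] unfolding forbidden_def by blast

lemma forbidden_pairs_subset: "c \<in> carrier G \<Longrightarrow> d \<in> carrier G \<Longrightarrow> forbidden_pairs c d \<subseteq> V \<times> V"
  using delta_in_V add_subgroup_minus[OF V_add_subgroup] unfolding forbidden_pairs_def by blast

lemma coset_like_forbidden: "coset_like (forbidden a c)"
  unfolding coset_like_def
proof (intro ballI)
  fix x y z assume "x \<in> forbidden a c" "y \<in> forbidden a c" "z \<in> forbidden a c"
  then obtain f g h where fgh: "f \<in> splittings" "delta a f = 0" "x = - delta c f"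
    "g \<in> splittings" "delta a g = 0" "y = - delta c g"
    "h \<in> splittings" "delta a h = 0" "z = - delta c h"
    unfolding forbidden_def by blast
  then have "f - g + h \<in> splittings" "delta a (f - g + h) = 0" "x - y + z = - delta c (f - g + h)"
    using splittings_affine by (simp_all add: delta_affine)
  then show "x - y + z \<in> forbidden a c" unfolding forbidden_def by blast
qed

lemma coset_like_forbidden_pairs: "coset_like (forbidden_pairs c d)"
  unfolding coset_like_def
proof (intro ballI)
  fix x y z assume "x \<in> forbidden_pairs c d" "y \<in> forbidden_pairs c d" "z \<in> forbidden_pairs c d"
  then obtain f g h where fgh: "f \<in> splittings" "x = (- delta c f, - delta d f)"
    "g \<in> splittings" "y = (- delta c g, - delta d g)"
    "h \<in> splittings" "z = (- delta c h, - delta d h)"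
    unfolding forbidden_pairs_def by blast
  then have "f - g + h \<in> splittings" "x - y + z = (- delta c (f - g + h), - delta d (f - g + h))"
    using splittings_affine by (simp_all add: delta_affine)
  then show "x - y + z \<in> forbidden_pairs c d" unfolding forbidden_pairs_def by blast
qed

lemma splittings_eqI:
  assumes "f \<in> splittings" "h \<in> splittings" "x \<in> carrier G" "y \<in> carrier G" "generates_mod A x y"
    "delta x f = delta x h" "delta y f = delta y h"
  shows "f = h"
  using generates_mod_cocycle_0[OF assms(5) splittings_diff[OF assms(1,2)] _ _ assms(3,4) A_subset] assms(6,7)
  by (simp add: delta_diff)

lemma card_forbidden:
  assumes "a \<in> carrier G" "c \<in> carrier G" "generates_mod A a c"
  shows "card (forbidden a c) = card {f \<in> splittings. delta a f = 0}"
  unfolding forbidden_def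
  by (intro card_image inj_onI) (use splittings_eqI[OF _ _ assms] in auto)

lemma card_forbidden_pairs:
  assumes "c \<in> carrier G" "d \<in> carrier G" "generates_mod A c d"
  shows "card (forbidden_pairs c d) = card splittings"
  unfolding forbidden_pairs_def
  by (intro card_image inj_onI) (use splittings_eqI[OF _ _ assms] in auto)

text \<open>Gaschuetz's counting argument: the number of forbidden lifts of \<open>c\<close> depends only on \<open>a\<close>.\<close>

lemma forbidden_ne_V:
  assumes "a \<in> carrier G" "c \<in> carrier G" "generates_mod A a c" "b \<in> carrier G" "generates_mod B a b"
  shows "forbidden a c \<noteq> V"
proof -
  have gen: "generates_mod A a b" using generates_mod_mono[OF _ A_subset assms(1,4,5)] BA by blast
  have "generates_mod B a (\<one> \<otimes> b)" using assms by simp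
  then have "\<phi> \<one> \<notin> forbidden a b"
    using lift_generates_iff[OF assms(1,4) gen] sub_A by (simp add: subgroup.one_closed)
  moreover have "\<phi> \<one> \<in> V" using sub_A by (simp add: subgroup.one_closed)
  ultimately have "forbidden a b \<subset> V" using forbidden_subset[OF assms(4)] by blast
  then have "card (forbidden a b) < card V" using finite_V psubset_card_mono by blast
  then show ?thesis using card_forbidden[OF assms(1,2,3)] card_forbidden[OF assms(1,4) gen] by auto
qed

text \<open>The same count for two moving elements: the number of forbidden pairs is the number of
  splittings, whichever pair is lifted, and for \<open>a\<close>, \<open>b\<close> the trivial lift
  is good.\<close>

lemma forbidden_pairs_ne:
  assumes "c \<in> carrier G" "d \<in> carrier G" "generates_mod A c d"
    "a \<in> carrier G" "b \<in> carrier G" "generates_mod B a b"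
  shows "forbidden_pairs c d \<noteq> V \<times> V"
proof -
  have one: "\<one> \<in> A" using sub_A by (rule subgroup.one_closed)
  have gen: "generates_mod A a b" using generates_mod_mono[OF _ A_subset assms(4-6)] BA by blast
  have "generates_mod B (\<one> \<otimes> a) (\<one> \<otimes> b)" using assms by simp
  then have "(\<phi> \<one>, \<phi> \<one>) \<notin> forbidden_pairs a b"
    using lifts_generate_iff[OF assms(4,5) gen one one] by simp
  moreover have "\<phi> \<one> \<in> V" using one by simp
  ultimately have "forbidden_pairs a b \<subset> V \<times> V" using forbidden_pairs_subset[OF assms(4,5)] by blast
  then have "card (forbidden_pairs a b) < card (V \<times> V)" using finite_V by (intro psubset_card_mono) auto
  then show ?thesis using card_forbidden_pairs[OF assms(1,2,3)] card_forbidden_pairs[OF assms(4,5) gen] by auto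
qed

text \<open>The reflection that takes \<open>x\<close> to \<open>\<alpha>1 - x\<close> in the first
  coordinate, and likewise \<open>\<alpha>2\<close> in the second, turns the forbidden cosets into
  their direction subgroups. With \<open>\<alpha>1\<close> and \<open>\<alpha>2\<close> taken from
  the two forbidden sets, balance puts the pair \<open>(\<alpha>1, \<alpha>2)\<close> into
  \<open>forbidden_pairs\<close>, so the same reflection serves for the pairs.\<close>

lemma balanced_forbidden_obstructed:
  assumes c: "c1 \<in> carrier G" "c2 \<in> carrier G"
    and bal: "balanced V (forbidden a1 c1) (forbidden a2 c2) (forbidden_pairs c1 c2)"
  shows "obstructed a1 a2 A V c1 c2"
proof -
  have pos: "card V > 0" using add_subgroup_zero[OF V_add_subgroup] finite_V by (auto simp: card_gt_0_iff)
  have sub: "\<exists>\<alpha>\<in>forbidden a c. \<forall>x. x \<in> values_at c a V A \<longleftrightarrow> \<alpha> - x \<in> forbidden a c"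
    if ne: "forbidden a c \<noteq> {}" for a c
  proof -
    obtain f1 where f1: "f1 \<in> splittings" "delta a f1 = 0" using ne by (auto simp: forbidden_def)
    have "x \<in> values_at c a V A \<longleftrightarrow> - delta c f1 - x \<in> forbidden a c" for x
    proof
      assume "x \<in> values_at c a V A"
      then obtain h where h: "h \<in> cocycles V A" "delta a h = 0" "x = delta c h" by blast
      then have "f1 + h \<in> splittings" "delta a (f1 + h) = 0" "- delta c f1 - x = - delta c (f1 + h)"
        using f1 splittings_add by (simp_all add: delta_add)
      then show "- delta c f1 - x \<in> forbidden a c" unfolding forbidden_def by blast
    next
      assume "- delta c f1 - x \<in> forbidden a c"
      then obtain f where f: "f \<in> splittings" "delta a f = 0" "- delta c f1 - x = - delta c f"
        unfolding forbidden_def by blast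
      have "x = - (- delta c f1 - x) - delta c f1" by simp
      then have "x = delta c (f - f1)" unfolding f(3) delta_diff by simp
      moreover have "f - f1 \<in> cocycles V A" "delta a (f - f1) = 0"
        using f f1 splittings_diff by (simp_all add: delta_diff)
      ultimately show "x \<in> values_at c a V A" by blast
    qed
    then show ?thesis using f1 unfolding forbidden_def by blast
  qed
  have ne: "forbidden a1 c1 \<noteq> {}" "forbidden a2 c2 \<noteq> {}" using bal pos by (auto simp: balanced_def)
  let ?U1 = "values_at c1 a1 V A"
  let ?U2 = "values_at c2 a2 V A"
  obtain \<alpha>1 where \<alpha>1: "\<alpha>1 \<in> forbidden a1 c1" "\<And>x. x \<in> ?U1 \<longleftrightarrow> \<alpha>1 - x \<in> forbidden a1 c1"
    using sub[OF ne(1)] by blast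
  obtain \<alpha>2 where \<alpha>2: "\<alpha>2 \<in> forbidden a2 c2" "\<And>x. x \<in> ?U2 \<longleftrightarrow> \<alpha>2 - x \<in> forbidden a2 c2"
    using sub[OF ne(2)] by blast
  have \<alpha>V: "\<alpha>1 \<in> V" "\<alpha>2 \<in> V" using \<alpha>1 \<alpha>2 forbidden_subset c by blast+
  have shift: "\<alpha> - x \<in> V \<longleftrightarrow> x \<in> V" if "\<alpha> \<in> V" for \<alpha> x
    using add_subgroup_diff[OF V_add_subgroup that] by (metis diff_diff_eq2 add_diff_cancel_left')
  have card_eq: "card U = card F" if "\<And>x. x \<in> U \<longleftrightarrow> \<alpha> - x \<in> F" for U F :: "('a \<Rightarrow> circle) set" and \<alpha>
    by (rule bij_betw_same_card[of "\<lambda>x. \<alpha> - x"], rule bij_betwI[where g = "\<lambda>x. \<alpha> - x"]) (use that in auto)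
  have "(\<alpha>1, \<alpha>2) \<in> forbidden_pairs c1 c2" using bal \<alpha>1(1) \<alpha>2(1) \<alpha>V by (auto simp: balanced_def)
  then obtain f0 where f0: "f0 \<in> splittings" "\<alpha>1 = - delta c1 f0" "\<alpha>2 = - delta c2 f0"
    by (auto simp: forbidden_pairs_def)
  have pairs: "(x, y) \<in> value_pairs c1 c2 V A \<longleftrightarrow>
      (\<alpha>1 - x, \<alpha>2 - y) \<in> forbidden_pairs c1 c2" for x y
  proof
    assume "(x, y) \<in> value_pairs c1 c2 V A"
    then obtain h where h: "h \<in> cocycles V A" "x = delta c1 h" "y = delta c2 h" by blast
    then have "f0 + h \<in> splittings" "\<alpha>1 - x = - delta c1 (f0 + h)" "\<alpha>2 - y = - delta c2 (f0 + h)"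
      using f0 splittings_add by (simp_all add: delta_add)
    then show "(\<alpha>1 - x, \<alpha>2 - y) \<in> forbidden_pairs c1 c2" unfolding forbidden_pairs_def by blast
  next
    assume "(\<alpha>1 - x, \<alpha>2 - y) \<in> forbidden_pairs c1 c2"
    then obtain f where f: "f \<in> splittings" "\<alpha>1 - x = - delta c1 f" "\<alpha>2 - y = - delta c2 f"
      unfolding forbidden_pairs_def by blast
    have "x = \<alpha>1 - (\<alpha>1 - x)" by simp
    also have "\<dots> = - delta c1 f0 - (- delta c1 f)" using f(2) f0(2) by (simp only:)
    finally have "x = delta c1 (f - f0)" by (simp add: delta_diff)
    moreover have "y = \<alpha>2 - (\<alpha>2 - y)" by simp
    then have "y = - delta c2 f0 - (- delta c2 f)" using f(3) f0(3) by (simp only:)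
    then have "y = delta c2 (f - f0)" by (simp add: delta_diff)
    moreover have "f - f0 \<in> cocycles V A" using f f0 splittings_diff by simp
    ultimately show "(x, y) \<in> value_pairs c1 c2 V A" by blast
  qed
  have "(x, y) \<in> value_pairs c1 c2 V A \<longleftrightarrow>
      (x, y) \<in> V \<times> V \<and> (x \<in> ?U1 \<longleftrightarrow> y \<in> ?U2)" for x y
    using bal shift[OF \<alpha>V(1)] shift[OF \<alpha>V(2)] unfolding pairs \<alpha>1(2) \<alpha>2(2) balanced_def by auto
  note mem = this
  have "value_pairs c1 c2 V A = {(x, y) \<in> V \<times> V. x \<in> ?U1 \<longleftrightarrow> y \<in> ?U2}"
  proof (rule Set.set_eqI)
    fix p
    show "p \<in> value_pairs c1 c2 V A \<longleftrightarrow> p \<in> {(x, y) \<in> V \<times> V. x \<in> ?U1 \<longleftrightarrow> y \<in> ?U2}"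
      using mem[of "fst p" "snd p"] by (simp only: prod.collapse mem_Collect_eq split_beta)
  qed
  moreover have "2 * card ?U1 = card V" "2 * card ?U2 = card V"
    using bal card_eq[OF \<alpha>1(2)] card_eq[OF \<alpha>2(2)] unfolding balanced_def by simp_all
  ultimately show ?thesis unfolding obstructed_def balanced_def by (intro conjI)
qed

lemma exists_lifts:
  assumes c: "a1 \<in> carrier G" "a2 \<in> carrier G" "c1 \<in> carrier G" "c2 \<in> carrier G" "b1 \<in> carrier G" "b2 \<in> carrier G"
    and gA: "generates_mod A a1 c1" "generates_mod A c1 c2" "generates_mod A a2 c2"
    and gB: "generates_mod B a1 b1" "generates_mod B a2 b2"
    and unobs: "(\<And>v. v \<in> V \<Longrightarrow> v + v = 0) \<Longrightarrow> \<not> obstructed a1 a2 A V c1 c2"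
  shows "\<exists>v1\<in>V - forbidden a1 c1. \<exists>v2\<in>V - forbidden a2 c2. (v1, v2) \<notin> forbidden_pairs c1 c2"
proof -
  note A1 = forbidden_subset[OF c(3)] forbidden_ne_V[OF c(1,3) gA(1) c(5) gB(1)] coset_like_forbidden
  note A2 = forbidden_subset[OF c(4)] forbidden_ne_V[OF c(2,4) gA(3) c(6) gB(2)] coset_like_forbidden
  note Z = forbidden_pairs_subset[OF c(3,4)] forbidden_pairs_ne[OF c(3,4) gA(2) c(1,5) gB(1)] coset_like_forbidden_pairs
  show ?thesis
  proof (rule V_char_cases)
    assume "\<And>v. v \<in> V \<Longrightarrow> v + v = 0 \<Longrightarrow> v = 0"
    from avoid_three_cosets_odd[OF V_add_subgroup finite_V this A1 A2 Z] show ?thesis .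
  next
    assume char2: "\<And>v. v \<in> V \<Longrightarrow> v + v = 0"
    interpret elementary_2_group V
      by unfold_locales (use V_add_subgroup finite_V char2 in auto)
    show ?thesis
    proof (rule ccontr)
      assume "\<not> ?thesis"
      then have "balanced V (forbidden a1 c1) (forbidden a2 c2) (forbidden_pairs c1 c2)"
        by (intro covering_by_cosets[OF A1 A2 Z]) (auto simp: forbidden_def forbidden_pairs_def)
      then show False using unobs char2 balanced_forbidden_obstructed c by blast
    qed
  qed
qed

text \<open>An index-two \<open>End\<^sub>G(V)\<close>-submodule of \<open>V\<close> forces \<open>End\<^sub>G(V)\<close> to have two elements, so that
  restriction to \<open>A\<close> has at most two values on the cocycles.\<close>

lemma obstructed_cocycle_cases:
  assumes obs: "obstructed a1 a2 B V c1 c2" and c: "c1 \<in> carrier G" "a1 \<in> carrier G" and f: "f \<in> cocycles V B"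
  shows "f \<in> cocycles V A \<or> f \<in> splittings"
proof (rule ccontr)
  assume nf: "\<not> ?thesis"
  define \<psi> where "\<psi> a = delta a f" for a
  have hom': "equiv_hom A \<psi>"
    unfolding \<psi>_def by (rule delta_equiv_hom[OF V_gmodule A translate_V f])
  have \<psi>V: "\<psi> a \<in> V" if "a \<in> A" for a unfolding \<psi>_def using cocyclesD(3)[OF f] A_carrier that by blast
  have \<psi>B: "\<psi> b = 0" if "b \<in> B" for b unfolding \<psi>_def using cocyclesD(4)[OF f] that by blast
  have "{a \<in> A. \<psi> a = 0} = B"
  proof (rule normal_between_eq_B)
    show "{a \<in> A. \<psi> a = 0} \<lhd> G" by (rule equalizer_normal[OF hom' equiv_hom_zero[OF A] A])
    show "B \<subseteq> {a \<in> A. \<psi> a = 0}" using \<psi>B BA by blast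
    have "{a \<in> A. \<psi> a = 0} \<noteq> A" using nf f by (auto simp: cocycles_def \<psi>_def)
    then show "{a \<in> A. \<psi> a = 0} \<subset> A" by blast
  qed
  then have ker': "a \<in> B" if "a \<in> A" "\<psi> a = 0" for a using that by blast
  have "{a \<in> A. \<psi> a = \<phi> a} = B"
  proof (rule normal_between_eq_B)
    show "{a \<in> A. \<psi> a = \<phi> a} \<lhd> G" by (rule equalizer_normal[OF hom' hom A])
    show "B \<subseteq> {a \<in> A. \<psi> a = \<phi> a}"
    proof
      fix b assume "b \<in> B"
      then have "b \<in> A" "\<phi> b = 0" using BA ker by blast+
      then show "b \<in> {a \<in> A. \<psi> a = \<phi> a}" using \<psi>B[OF \<open>b \<in> B\<close>] by simp
    qed
    have "{a \<in> A. \<psi> a = \<phi> a} \<noteq> A" using nf f by (auto simp: splittings_def \<psi>_def)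
    then show "{a \<in> A. \<psi> a = \<phi> a} \<subset> A" by blast
  qed
  then have eq': "a \<in> B" if "a \<in> A" "\<psi> a = \<phi> a" for a using that by blast
  \<comment> \<open>Schur's lemma: as \<open>f\<close> is of neither kind, the endomorphism
    \<open>lam\<close> differs from zero and from the identity on all nonzero elements, so
    \<open>lam\<close> and \<open>lam\<close> minus the identity are both bijective on the finite
    \<open>V\<close>.\<close>
  obtain lam where lam: "\<And>a. a \<in> A \<Longrightarrow> lam (\<phi> a) = \<psi> a"
    and lam_add: "\<And>v w. v \<in> V \<Longrightarrow> w \<in> V \<Longrightarrow> lam (v + w) = lam v + lam w"
    and lam_tr: "\<And>g v. g \<in> carrier G \<Longrightarrow> v \<in> V \<Longrightarrow> lam (translate g v) = translate g (lam v)"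
    using equiv_hom_factor[OF hom hom' A] ker \<psi>B by blast
  have lamV: "lam v \<in> V" if "v \<in> V" for v using that lam \<psi>V by auto
  have lam_diff: "lam (v - w) = lam v - lam w" if "v \<in> V" "w \<in> V" for v w
    using lam_add[of "v - w" w] that add_subgroup_diff[OF V_add_subgroup] by simp
  have lam0: "v = 0" if "v \<in> V" "lam v = 0" for v using that lam ker' ker by auto
  have mu0: "v = 0" if "v \<in> V" "lam v = v" for v using that lam eq' ker by auto
  have inj_lam: "inj_on lam V"
    by (rule inj_onI) (metis lam0 lam_diff add_subgroup_diff[OF V_add_subgroup] eq_iff_diff_eq_0)
  have inj_mu: "inj_on (\<lambda>v. lam v - v) V"
  proof (rule inj_onI)
    fix v w assume vw: "v \<in> V" "w \<in> V" "lam v - v = lam w - w"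
    have "lam (v - w) = lam v - lam w" using vw lam_diff by simp
    also have "\<dots> = v - w" using vw(3) by (simp add: algebra_simps)
    finally have "v - w = 0" using mu0 add_subgroup_diff[OF V_add_subgroup] vw by blast
    then show "v = w" by simp
  qed
  have surj_mu: "(\<lambda>v. lam v - v) ` V = V"
    by (rule endo_inj_surj[OF finite_V _ inj_mu]) (use lamV add_subgroup_diff[OF V_add_subgroup] in blast)
  let ?U = "values_at c1 a1 V B"
  have U: "add_subgroup ?U" by (rule add_subgroup_delta_image[OF V_gmodule])
  have UV: "?U \<subseteq> V" using cocyclesD(3) c by blast
  have half: "2 * card ?U = card V" using obs by (simp add: obstructed_def balanced_def)
  have lamU: "lam x \<in> ?U" if "x \<in> ?U" for x
  proof -
    obtain h where h: "h \<in> cocycles V B" "delta a1 h = 0" "x = delta c1 h" using \<open>x \<in> ?U\<close> by blast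
    obtain h' where h': "h' \<in> cocycles V B" "\<And>g. g \<in> carrier G \<Longrightarrow> delta g h' = lam (delta g h)"
      using transport_cocycle[OF V_gmodule V_gmodule h(1) B_subset lamV lam_add lam_tr] by blast
    have "lam 0 = 0" using lam_add[of 0 0] add_subgroup_zero[OF V_add_subgroup] by simp
    then have "delta a1 h' = 0" "delta c1 h' = lam x" using h' h c by simp_all
    then show ?thesis using h' by (metis (mono_tags, lifting) image_eqI mem_Collect_eq)
  qed
  have "lam ` ?U = ?U"
  proof (rule endo_inj_surj)
    show "finite ?U" using UV finite_V finite_subset by blast
    show "lam ` ?U \<subseteq> ?U" using lamU by blast
    show "inj_on lam ?U" using inj_lam UV inj_on_subset by blast
  qed
  \<comment> \<open>For \<open>y\<close> outside \<open>?U\<close> also \<open>lam y\<close> is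
    outside, since \<open>lam\<close> permutes \<open>?U\<close>; index two then puts the difference
    inside. So \<open>lam\<close> minus the identity maps \<open>V\<close> into the proper subgroup
    \<open>?U\<close>, although it is onto \<open>V\<close>.\<close>
  have muU: "lam y - y \<in> ?U" if y: "y \<in> V" for y
  proof (cases "y \<in> ?U")
    case True
    then show ?thesis using lamU add_subgroup_diff[OF U] by blast
  next
    case False
    have "lam y \<notin> ?U"
    proof
      assume "lam y \<in> ?U"
      then have "lam y \<in> lam ` ?U" using \<open>lam ` ?U = ?U\<close> by simp
      then obtain u where "u \<in> ?U" "lam y = lam u" by blast
      then have "y = u" using inj_lam y UV by (meson inj_onD subsetD)
      then show False using \<open>u \<in> ?U\<close> False by simp
    qed
    then show ?thesis
      using index_two_delta[OF U UV V_add_subgroup finite_V half lamV[OF y] _ y False] by blast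
  qed
  then have "(\<lambda>v. lam v - v) ` V \<subseteq> ?U" by blast
  then have "?U = V" using surj_mu UV by simp
  then show False using half add_subgroup_zero[OF V_add_subgroup] finite_V by auto
qed

end

section \<open>Obstructed pairs in isomorphic modules\<close>

lemma balanced_image:
  assumes inj: "inj_on lam V" and U: "U1 \<subseteq> V" "U2 \<subseteq> V" and bal: "balanced V U1 U2 Z"
  shows "balanced (lam ` V) (lam ` U1) (lam ` U2) (map_prod lam lam ` Z)"
proof -
  have card: "card (lam ` X) = card X" if "X \<subseteq> V" for X
    by (rule card_image[OF inj_on_subset[OF inj that]])
  have mem: "lam x \<in> lam ` X \<longleftrightarrow> x \<in> X" if "x \<in> V" "X \<subseteq> V" for x X
    using inj_on_image_mem_iff[OF inj that] .
  have "map_prod lam lam ` Z = {(x, y) \<in> lam ` V \<times> lam ` V. x \<in> lam ` U1 \<longleftrightarrow> y \<in> lam ` U2}" (is "?L = ?R")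
  proof
    show "?L \<subseteq> ?R"
    proof
      fix p assume "p \<in> ?L"
      then obtain x y where xy: "(x, y) \<in> Z" "p = (lam x, lam y)" by auto
      then have "x \<in> V" "y \<in> V" "x \<in> U1 \<longleftrightarrow> y \<in> U2" using bal by (auto simp: balanced_def)
      then show "p \<in> ?R" using xy(2) mem U by simp
    qed
    show "?R \<subseteq> ?L"
    proof
      fix p assume "p \<in> ?R"
      then obtain x y where xy: "x \<in> V" "y \<in> V" "p = (lam x, lam y)" "lam x \<in> lam ` U1 \<longleftrightarrow> lam y \<in> lam ` U2" by auto
      have "x \<in> U1 \<longleftrightarrow> y \<in> U2" using xy(4) mem[OF xy(1) U(1)] mem[OF xy(2) U(2)] by blast
      then have "(x, y) \<in> Z" using bal xy(1,2) by (simp add: balanced_def)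
      then show "p \<in> ?L" using xy by (intro image_eqI[of _ _ "(x, y)"]) auto
    qed
  qed
  then show ?thesis using bal card U by (simp add: balanced_def)
qed

lemma add_subgroup_sum: "add_subgroup V \<Longrightarrow> (\<And>x. x \<in> S \<Longrightarrow> F x \<in> V) \<Longrightarrow> sum F S \<in> V"
  by (induction S rule: infinite_finite_induct) (auto intro: add_subgroup_intros)

context group
begin

lemma obstructed_cong:
  assumes "cocycles V M = cocycles V N"
  shows "obstructed a1 a2 M V c1 c2 \<longleftrightarrow> obstructed a1 a2 N V c1 c2"
  using assms by (simp add: obstructed_def)

lemma delta_image_subset:
  "c \<in> carrier G \<Longrightarrow> delta c ` {f \<in> cocycles V N. P f} \<subseteq> V"
  using cocyclesD(3) by blast

lemma obstructed_card:
  assumes obs: "obstructed a1 a2 N V c1 c2" and V: "elementary_2_group V" and c: "c1 \<in> carrier G" "c2 \<in> carrier G"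
  shows "2 * card (value_pairs c1 c2 V N) = card V * card V"
  using elementary_2_group.card_balanced[OF V delta_image_subset delta_image_subset obs[unfolded obstructed_def]] c
  by blast

text \<open>Modules are concrete sets of functions, so isomorphic modules are in general different
  sets and the invariance under isomorphism has to be proved.\<close>

lemma obstructed_transport:
  assumes V: "gmodule V" and W: "gmodule W" and N: "N \<subseteq> carrier G"
    and c: "c1 \<in> carrier G" "c2 \<in> carrier G" "a1 \<in> carrier G" "a2 \<in> carrier G"
    and \<alpha>: "\<And>v. v \<in> V \<Longrightarrow> \<alpha> v \<in> W" "\<And>v w. v \<in> V \<Longrightarrow> w \<in> V \<Longrightarrow> \<alpha> (v + w) = \<alpha> v + \<alpha> w"
      "\<And>g v. g \<in> carrier G \<Longrightarrow> v \<in> V \<Longrightarrow> \<alpha> (translate g v) = translate g (\<alpha> v)"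
    and \<beta>: "\<And>v. v \<in> W \<Longrightarrow> \<beta> v \<in> V" "\<And>v w. v \<in> W \<Longrightarrow> w \<in> W \<Longrightarrow> \<beta> (v + w) = \<beta> v + \<beta> w"
      "\<And>g v. g \<in> carrier G \<Longrightarrow> v \<in> W \<Longrightarrow> \<beta> (translate g v) = translate g (\<beta> v)"
    and inverse: "\<And>v. v \<in> V \<Longrightarrow> \<beta> (\<alpha> v) = v" "\<And>w. w \<in> W \<Longrightarrow> \<alpha> (\<beta> w) = w"
    and obs: "obstructed a1 a2 N V c1 c2"
  shows "obstructed a1 a2 N W c1 c2"
proof -
  have zero: "\<alpha> 0 = 0" "\<beta> 0 = 0"
    using \<alpha>(2)[of 0 0] \<beta>(2)[of 0 0] gmoduleD(1)[OF V] gmoduleD(1)[OF W] by (simp_all add: add_subgroup_zero)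
  have fwd: "\<exists>h'\<in>cocycles W N. \<forall>g\<in>carrier G. delta g h' = \<alpha> (delta g h)" if "h \<in> cocycles V N" for h
    by (rule transport_cocycle[OF V W that N \<alpha>])
  have bwd: "\<exists>h'\<in>cocycles V N. \<forall>g\<in>carrier G. delta g h = \<alpha> (delta g h') \<and> delta g h' = \<beta> (delta g h)"
    if h: "h \<in> cocycles W N" for h
  proof -
    obtain h' where h': "h' \<in> cocycles V N" "\<forall>g\<in>carrier G. delta g h' = \<beta> (delta g h)"
      using transport_cocycle[OF W V h N \<beta>] by blast
    then show ?thesis using inverse(2) cocyclesD(3)[OF h] by (intro bexI[of _ h']) simp_all
  qed
  have U: "values_at c a W N = \<alpha> ` values_at c a V N"
    (is "?L = ?R") if ca: "c \<in> carrier G" "a \<in> carrier G" for c a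
  proof
    show "?L \<subseteq> ?R"
    proof
      fix x assume "x \<in> ?L"
      then obtain h where h: "h \<in> cocycles W N" "delta a h = 0" "x = delta c h" by blast
      from bwd[OF h(1)] obtain h' where h': "h' \<in> cocycles V N"
        "\<And>g. g \<in> carrier G \<Longrightarrow> delta g h = \<alpha> (delta g h')"
        "\<And>g. g \<in> carrier G \<Longrightarrow> delta g h' = \<beta> (delta g h)" by blast
      then have "delta a h' = 0" "x = \<alpha> (delta c h')"
        using h h'(3)[OF ca(2)] h'(2)[OF ca(1)] zero by (simp_all only:)
      then show "x \<in> ?R" using h'(1) by blast
    qed
    show "?R \<subseteq> ?L"
    proof
      fix x assume "x \<in> ?R"
      then obtain h where h: "h \<in> cocycles V N" "delta a h = 0" "x = \<alpha> (delta c h)" by blast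
      from fwd[OF h(1)] obtain h' where h': "h' \<in> cocycles W N"
        "\<forall>g\<in>carrier G. delta g h' = \<alpha> (delta g h)" by blast
      then have "delta a h' = 0" "x = delta c h'" using h ca zero by simp_all
      then show "x \<in> ?L" using h'(1) by blast
    qed
  qed
  have Z: "value_pairs c1 c2 W N =
      map_prod \<alpha> \<alpha> ` value_pairs c1 c2 V N" (is "?L = ?R")
  proof
    show "?L \<subseteq> ?R"
    proof
      fix p assume "p \<in> ?L"
      then obtain h where h: "h \<in> cocycles W N" "p = (delta c1 h, delta c2 h)" by blast
      from bwd[OF h(1)] obtain h' where h': "h' \<in> cocycles V N"
        "\<And>g. g \<in> carrier G \<Longrightarrow> delta g h = \<alpha> (delta g h')" by blast
      have "p = map_prod \<alpha> \<alpha> (delta c1 h', delta c2 h')"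
        using h(2) h'(2)[OF c(1)] h'(2)[OF c(2)] by (simp only: map_prod_simp)
      then show "p \<in> ?R" using h'(1) by blast
    qed
    show "?R \<subseteq> ?L"
    proof
      fix p assume "p \<in> ?R"
      then obtain q where q: "p = map_prod \<alpha> \<alpha> q"
        "q \<in> value_pairs c1 c2 V N" by (rule imageE)
      from q(2) obtain h where "q = (delta c1 h, delta c2 h)" "h \<in> cocycles V N" by (rule imageE)
      then have h: "h \<in> cocycles V N" "p = map_prod \<alpha> \<alpha> (delta c1 h, delta c2 h)"
        using q(1) by simp_all
      from fwd[OF h(1)] obtain h' where h': "h' \<in> cocycles W N"
        "\<forall>g\<in>carrier G. delta g h' = \<alpha> (delta g h)" by blast
      have "p = (delta c1 h', delta c2 h')"
        using h(2) h'(2)[rule_format, OF c(1)] h'(2)[rule_format, OF c(2)] by (simp only: map_prod_simp)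
      then show "p \<in> ?L" using h'(1) by - (rule image_eqI[where x = h'], simp_all only:)
    qed
  qed
  have inj: "inj_on \<alpha> V" by (rule inj_on_inverseI[where g = \<beta>]) (rule inverse(1))
  have im: "\<alpha> ` V = W"
  proof
    show "\<alpha> ` V \<subseteq> W" using \<alpha>(1) by blast
    show "W \<subseteq> \<alpha> ` V"
    proof
      fix w assume w: "w \<in> W"
      show "w \<in> \<alpha> ` V" using imageI[OF \<beta>(1)[OF w], of \<alpha>] inverse(2)[OF w] by simp
    qed
  qed
  have "balanced (\<alpha> ` V) (\<alpha> ` values_at c1 a1 V N)
      (\<alpha> ` values_at c2 a2 V N)
      (map_prod \<alpha> \<alpha> ` value_pairs c1 c2 V N)"
    using inj delta_image_subset[OF c(1)] delta_image_subset[OF c(2)] obs[unfolded obstructed_def]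
    by (rule balanced_image)
  then show ?thesis unfolding obstructed_def by (simp only: im Z U[OF c(1,3)] U[OF c(2,4)])
qed

definition fixed_points :: "'a set \<Rightarrow> ('a \<Rightarrow> circle) set \<Rightarrow> ('a \<Rightarrow> circle) set" where
  "fixed_points N V = {v \<in> V. \<forall>n\<in>N. translate n v = v}"

lemma fixed_points_gmodule:
  assumes "N \<lhd> G" "gmodule V"
  shows "gmodule (fixed_points N V)"
  unfolding gmodule_def
proof (intro conjI ballI)
  show "add_subgroup (fixed_points N V)"
    using gmoduleD(1)[OF assms(2)] by (auto simp: add_subgroup_def fixed_points_def translate_diff)
  show "fixed_points N V \<subseteq> fn_space" using gmoduleD(2)[OF assms(2)] by (auto simp: fixed_points_def)
  fix g v assume g: "g \<in> carrier G" and v: "v \<in> fixed_points N V"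
  have "translate n (translate g v) = translate g v" if n: "n \<in> N" for n
  proof -
    have nG: "n \<in> carrier G" using n assms(1) by (meson normal_imp_subgroup subgroup.mem_carrier)
    have "inv g \<otimes> n \<otimes> g \<in> N" using assms(1) n g normal.inv_op_closed1 by metis
    then have "translate (g \<otimes> (inv g \<otimes> n \<otimes> g)) v = translate g v"
      using v g nG by (simp add: translate_mult fixed_points_def)
    moreover have "g \<otimes> (inv g \<otimes> n \<otimes> g) = n \<otimes> g" using g nG by (simp add: m_assoc[symmetric])
    ultimately show ?thesis using g nG by (simp add: translate_mult)
  qed
  moreover have "translate g v \<in> V" using v g gmoduleD(3)[OF assms(2)] by (simp add: fixed_points_def)
  ultimately show "translate g v \<in> fixed_points N V" by (simp add: fixed_points_def)
qed

text \<open>The value at \<open>n \<otimes> g\<close> is both the value at \<open>g\<close> and its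
  translate by \<open>n\<close>, so all values are fixed by \<open>N\<close>.\<close>

lemma cocycle_no_fixed_points:
  assumes N: "N \<lhd> G" and fix0: "fixed_points N V \<subseteq> {0}" and f: "f \<in> cocycles V N"
  shows "f = 0"
proof (rule cocycle_eq_0[OF f])
  fix g assume g: "g \<in> carrier G"
  have "translate n (delta g f) = delta g f" if n: "n \<in> N" for n
  proof -
    have nG: "n \<in> carrier G" using n N by (meson normal_imp_subgroup subgroup.mem_carrier)
    have "delta (n \<otimes> g) f = translate n (delta g f)"
      using g nG cocyclesD(4)[OF f n] by (simp add: delta_mult)
    then show ?thesis using delta_coset[OF N f n g] by simp
  qed
  then have "delta g f \<in> fixed_points N V" using cocyclesD(3)[OF f g] by (simp add: fixed_points_def)
  then show "delta g f = 0" using fix0 by blast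
qed

lemma translate_sum: "translate g (sum F S) = (\<Sum>x\<in>S. translate g (F x))"
  by (induction S rule: infinite_finite_induct)
    (simp_all only: sum.infinite sum.empty sum.insert translate_zero translate_add not_False_eq_True)

end

context chief_step
begin

text \<open>The fixed points of a 2-group on a nonzero 2-group, found in a minimal nonzero
  \<open>A\<close>-invariant subgroup \<open>S\<close>. The fixed set of one \<open>t\<close> in
  \<open>S\<close> is invariant because \<open>A\<close> acts through an abelian group, so it is all
  of \<open>S\<close> once it is nonzero.\<close>

lemma unipotent_fixed_points:
  assumes W: "gmodule W" "finite W" "\<And>w. w \<in> W \<Longrightarrow> w + w = 0"
    and BW: "\<And>b w. b \<in> B \<Longrightarrow> w \<in> W \<Longrightarrow> translate b w = w"
    and sq: "\<And>a. a \<in> A \<Longrightarrow> a \<otimes> a \<in> B" and ne: "W \<noteq> {0}"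
  shows "fixed_points A W \<noteq> {0}"
proof
  assume fp: "fixed_points A W = {0}"
  have W0: "add_subgroup W" "W \<subseteq> fn_space" using gmoduleD[OF W(1)] by blast+
  let ?P = "\<lambda>S. add_subgroup S \<and> S \<subseteq> W \<and> S \<noteq> {0} \<and> (\<forall>a\<in>A. \<forall>x\<in>S. translate a x \<in> S)"
  have "?P W" using W0 ne gmoduleD(3)[OF W(1)] A_carrier by blast
  then obtain S where S: "?P S" and min: "\<And>S'. ?P S' \<Longrightarrow> card S \<le> card S'"
    using ex_has_least_nat[of ?P W card] by blast
  have fS: "finite S" using S W(2) finite_subset by blast
  have "translate t x = x" if t: "t \<in> A" and x: "x \<in> S" for t x
  proof -
    let ?X = "{x \<in> S. translate t x = x}"
    have tG: "t \<in> carrier G" using t A_carrier by blast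
    have X: "add_subgroup ?X" using S by (auto simp: add_subgroup_def translate_diff)
    have inv: "translate a y \<in> ?X" if a: "a \<in> A" and y: "y \<in> ?X" for a y
    proof -
      have aG: "a \<in> carrier G" using a A_carrier by blast
      have k: "t \<otimes> a \<otimes> inv t \<otimes> inv a \<in> B" using comm[OF t a] .
      have "inv a \<otimes> (a \<otimes> t) = t" using tG aG by (simp add: m_assoc[symmetric])
      then have "t \<otimes> a = (t \<otimes> a \<otimes> inv t \<otimes> inv a) \<otimes> (a \<otimes> t)" using tG aG by (simp add: m_assoc)
      then have "translate (t \<otimes> a) y = translate (t \<otimes> a \<otimes> inv t \<otimes> inv a) (translate (a \<otimes> t) y)"
        using tG aG translate_mult[of "t \<otimes> a \<otimes> inv t \<otimes> inv a" "a \<otimes> t" y] by (simp only: m_closed inv_closed simp_thms)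
      also have "\<dots> = translate (a \<otimes> t) y"
        using BW[OF k] gmoduleD(3)[OF W(1)] tG aG y S by blast
      finally have "translate t (translate a y) = translate a y" using tG aG y by (simp add: translate_mult)
      then show ?thesis using S a y by blast
    qed
    have "?X \<noteq> {0}"
    proof
      assume X0: "?X = {0}"
      obtain y where y: "y \<in> S" "y \<noteq> 0" using S add_subgroup_zero by blast
      have yW: "y \<in> W" using y S by blast
      \<comment> \<open>\<open>?z\<close> is fixed because \<open>t \<otimes> t\<close> acts
        trivially. If it vanishes, then \<open>y\<close> itself is fixed, minus signs being
        irrelevant in exponent two.\<close>
      let ?z = "y + translate t y"
      have "?z \<in> S" using S y t add_subgroup_add by blast
      moreover have "translate t ?z = ?z"
        using translate_mult[OF tG tG, of y] BW[OF sq[OF t] yW] by (simp add: translate_add add.commute)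
      ultimately have "?z = 0" using X0 by blast
      then have "translate t y = - y" by (simp add: eq_neg_iff_add_eq_0 add.commute)
      also have "- y = y" using W(3)[OF yW] by (simp add: minus_unique)
      finally show False using X0 y by blast
    qed
    then have "?P ?X" using X inv S by blast
    then have "card S \<le> card ?X" by (rule min)
    then have "?X = S" using fS by (intro card_seteq) auto
    then show ?thesis using x by blast
  qed
  then have "S \<subseteq> fixed_points A W" using S by (auto simp: fixed_points_def)
  then have "S \<subseteq> {0}" using fp by simp
  then show False using S add_subgroup_zero[of S] by blast
qed

text \<open>Averaging over \<open>V\<close>, a copy of \<open>A/B\<close>, makes every cocycle inner on \<open>A\<close>.\<close>

lemma card_cocycles_odd:
  assumes W: "gmodule W" "finite W" "\<And>w. w \<in> W \<Longrightarrow> w + w = 0"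
    and BW: "\<And>b w. b \<in> B \<Longrightarrow> w \<in> W \<Longrightarrow> translate b w = w"
    and odd: "\<And>v. v \<in> V \<Longrightarrow> v + v = 0 \<Longrightarrow> v = 0" and fp: "fixed_points A W = {0}"
  shows "finite (cocycles W B)" "card (cocycles W B) \<le> card W"
proof -
  \<comment> \<open>\<open>r\<close> picks representatives modulo \<open>B\<close>; by
    \<open>dep\<close> the values of a cocycle do not depend on the choice.\<close>
  define r where "r v = (SOME a. a \<in> A \<and> \<phi> a = v)" for v
  have r: "r v \<in> A" "\<phi> (r v) = v" if "v \<in> V" for v
    using someI_ex[of "\<lambda>a. a \<in> A \<and> \<phi> a = v"] that unfolding r_def by blast+
  define avg where "avg f = (\<Sum>v\<in>V. delta (r v) f)" for f
  have dep: "delta a f = delta b f" if f: "f \<in> cocycles W B" and ab: "a \<in> A" "b \<in> A" "\<phi> a = \<phi> b" for f a b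
  proof -
    have ib: "a \<otimes> inv b \<in> A" using ab sub_A by (simp add: subgroup.m_closed subgroup.m_inv_closed)
    have "\<phi> (a \<otimes> inv b) = 0"
      using equiv_homD(2)[OF hom ab(1)] equiv_hom_inv[OF hom sub_A ab(2)] ab sub_A
      by (simp add: subgroup.m_inv_closed)
    then have "a \<otimes> inv b \<in> B" using ker ib by blast
    from delta_coset[OF B f this] have "delta (a \<otimes> inv b \<otimes> b) f = delta b f"
      using ab A_carrier by blast
    then show ?thesis using ab A_carrier by (simp add: m_assoc)
  qed
  have key: "delta s f = avg f - translate s (avg f)" if f: "f \<in> cocycles W B" and s: "s \<in> A" for f s
  proof -
    have sG: "s \<in> carrier G" using s A_carrier by blast
    have dW: "delta g f \<in> W" if "g \<in> carrier G" for g using cocyclesD(3)[OF f that] .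
    have "delta (r (\<phi> s + v)) f = translate s (delta (r v) f) + delta s f" if v: "v \<in> V" for v
    proof -
      have sv: "\<phi> s + v \<in> V" using v s add_subgroup_add[OF V_add_subgroup] by blast
      have "\<phi> (s \<otimes> r v) = \<phi> s + v" using equiv_homD(2)[OF hom s] r[OF v] by simp
      moreover have "s \<otimes> r v \<in> A" using s r[OF v] sub_A by (simp add: subgroup.m_closed)
      ultimately have "delta (r (\<phi> s + v)) f = delta (s \<otimes> r v) f"
        using r(2)[OF sv] by (intro dep[OF f r(1)[OF sv]]) simp_all
      then show ?thesis using sG r[OF v] A_carrier by (simp add: delta_mult)
    qed
    then have "(\<Sum>v\<in>V. delta (r (\<phi> s + v)) f) = translate s (avg f) + (\<Sum>v\<in>V. delta s f)"
      by (simp add: sum.distrib translate_sum avg_def)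
    moreover have "(\<Sum>v\<in>V. delta (r (\<phi> s + v)) f) = avg f"
      unfolding avg_def
    proof (rule sum.reindex_bij_witness[of _ "\<lambda>v. v - \<phi> s" "\<lambda>v. \<phi> s + v"])
    qed (use s add_subgroup_add[OF V_add_subgroup] add_subgroup_diff[OF V_add_subgroup] in auto)
    \<comment> \<open>\<open>V\<close> has odd order: the nonzero \<open>v\<close> pair off with
      \<open>- v\<close>, each pair contributes zero in exponent two, and only the term of
      \<open>v = 0\<close> survives. This takes the place of dividing by
      \<open>card V\<close>.\<close>
    moreover have "(\<Sum>v\<in>V. delta s f) = delta s f"
    proof -
      have "(\<Sum>v\<in>V - {0}. delta s f) = 0"
      proof (rule sum_involution_eq_0[where h = uminus])
        show "delta s f + delta s f = 0" using W(3) dW sG by blast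
        show "- x \<in> V - {0}" if "x \<in> V - {0}" for x using that add_subgroup_minus[OF V_add_subgroup] by auto
        show "- x \<noteq> x" if "x \<in> V - {0}" for x
          using odd[of x] that by (metis Diff_iff add.right_inverse singleton_iff)
      qed simp
      then show ?thesis
        using finite_V add_subgroup_zero[OF V_add_subgroup] sum.remove[of V 0 "\<lambda>_. delta s f"] by simp
    qed
    ultimately have "avg f = translate s (avg f) + delta s f" by metis
    then show ?thesis by (simp add: algebra_simps)
  qed
  \<comment> \<open>By \<open>key\<close> the average determines a cocycle on \<open>A\<close>. A
    cocycle vanishing on \<open>A\<close> is zero, because \<open>A\<close> has no nonzero fixed
    points.\<close>
  have "inj_on avg (cocycles W B)"
  proof (rule inj_onI)
    fix f h assume fh: "f \<in> cocycles W B" "h \<in> cocycles W B" "avg f = avg h"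
    have "f - h \<in> cocycles W B" using fh cocycles_subgroup[OF W(1)] by (blast intro: add_subgroup_diff)
    moreover have "delta s (f - h) = 0" if "s \<in> A" for s
      using key[OF fh(1) that] key[OF fh(2) that] fh(3) by (simp add: delta_diff)
    ultimately have "f - h \<in> cocycles W A" by (simp add: cocycles_def)
    then have "f - h = 0" using cocycle_no_fixed_points[OF A] fp by blast
    then show "f = h" by simp
  qed
  moreover have "avg ` cocycles W B \<subseteq> W"
  proof clarify
    fix f assume f: "f \<in> cocycles W B"
    have "delta (r v) f \<in> W" if "v \<in> V" for v using cocyclesD(3)[OF f] r(1)[OF that] A_carrier by blast
    then show "avg f \<in> W"
      unfolding avg_def by (rule add_subgroup_sum[OF gmoduleD(1)[OF W(1)]])
  qed
  ultimately show "finite (cocycles W B)" "card (cocycles W B) \<le> card W"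
    using W(2) by (auto intro: inj_on_finite card_inj_on_le)
qed

text \<open>Suppose \<open>A\<close> acts nontrivially, so that by irreducibility it has no nonzero
  fixed points. \<open>B\<close> must act trivially, for otherwise there would be no nonzero
  cocycles at either level. If \<open>V\<close> has exponent two, a 2-group acts on a 2-group and
  has fixed points. If \<open>V\<close> is odd, there are at most \<open>card W\<close> cocycles,
  while obstruction needs half of \<open>card W * card W\<close> value pairs; so
  \<open>card W \<le> 2\<close>, too small for an element that is moved.\<close>

lemma obstructed_acts_trivially:
  assumes W: "irreducible_gmodule W" "finite W" "\<And>w. w \<in> W \<Longrightarrow> w + w = 0"
    and obs: "obstructed a1 a2 B W c1 c2" and c: "c1 \<in> carrier G" "c2 \<in> carrier G"
    and neq: "cocycles W B \<noteq> cocycles W A"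
    and aw: "a \<in> A" "w \<in> W"
  shows "translate a w = w"
proof -
  have gW: "gmodule W" and irr: "\<And>U. gmodule U \<Longrightarrow> U \<subseteq> W \<Longrightarrow> U = {0} \<or> U = W"
    using W(1) by (auto simp: irreducible_gmodule_def)
  have el: "elementary_2_group W" using gmoduleD(1)[OF gW] W(2,3) by unfold_locales
  have fixed: "fixed_points N W = {0} \<or> fixed_points N W = W" if "N \<lhd> G" for N
    using irr[OF fixed_points_gmodule[OF that gW]] by (auto simp: fixed_points_def)
  have zeroc: "0 \<in> cocycles W N" for N using cocycles_subgroup[OF gW] add_subgroup_zero by blast
  show ?thesis
  proof (rule ccontr)
    assume nt: "translate a w \<noteq> w"
    then have fA: "fixed_points A W = {0}" using fixed[OF A] aw by (auto simp: fixed_points_def)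
    have "fixed_points B W = W"
    proof (rule ccontr)
      assume "fixed_points B W \<noteq> W"
      then have "fixed_points B W = {0}" using fixed[OF B] by blast
      then have "cocycles W B \<subseteq> {0}" using cocycle_no_fixed_points[OF B] by blast
      then show False using neq zeroc[of A] zeroc[of B] cocycles_antimono[of B A W] BA by blast
    qed
    then have BW: "translate b x = x" if "b \<in> B" "x \<in> W" for b x
      using that unfolding fixed_points_def by blast
    have W0: "W \<noteq> {0}" using nt aw by auto
    show False
    proof (rule V_char_cases)
      assume char2: "\<And>v. v \<in> V \<Longrightarrow> v + v = 0"
      have "b \<otimes> b \<in> B" if "b \<in> A" for b
        using ker[of "b \<otimes> b"] char2[of "\<phi> b"] that sub_A equiv_homD(2)[OF hom that that]
        by (simp add: subgroup.m_closed)
      then show False using unipotent_fixed_points[OF gW W(2,3) BW _ W0] fA by blast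
    next
      assume odd: "\<And>v. v \<in> V \<Longrightarrow> v + v = 0 \<Longrightarrow> v = 0"
      note cc = card_cocycles_odd[OF gW W(2,3) BW odd fA]
      have "card W * card W = 2 * card (value_pairs c1 c2 W B)"
        using obstructed_card[OF obs el c] by simp
      also have "\<dots> \<le> 2 * card W" using cc card_image_le[OF cc(1)] by (meson le_trans mult_le_mono2)
      finally have "card W \<le> 2" using elementary_2_group.card_pos[OF el] by simp
      have aG: "a \<in> carrier G" using aw A_carrier by blast
      have "w \<noteq> 0" using nt by auto
      moreover have "w \<in> fn_space" using aw gmoduleD(2)[OF gW] by blast
      ultimately have "translate a w \<noteq> 0" using translate_eq_0_iff[OF aG] by simp
      moreover have "translate a w \<in> W" using gmoduleD(3)[OF gW aG aw(2)] .
      moreover have "0 \<in> W" using add_subgroup_zero gmoduleD(1)[OF gW] by blast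
      ultimately have "card {0, w, translate a w} = 3" "{0, w, translate a w} \<subseteq> W"
        using nt \<open>w \<noteq> 0\<close> aw by auto
      then show False using card_mono[OF W(2), of "{0, w, translate a w}"] \<open>card W \<le> 2\<close> by linarith
    qed
  qed
qed

end

section \<open>Generating paths in finite soluble groups\<close>

context chief_step
begin

lemma V_irreducible: "irreducible_gmodule V"
  unfolding irreducible_gmodule_def
proof (intro conjI allI impI V_gmodule)
  fix W assume W: "gmodule W" "W \<subseteq> V"
  let ?N = "{a \<in> A. \<phi> a \<in> W}"
  have W0: "add_subgroup W" using W(1) by (rule gmoduleD)
  have "?N \<lhd> G"
    unfolding normal_inv_iff
  proof (intro conjI ballI)
    show "subgroup ?N G"
    proof (rule subgroupI)
      show "?N \<subseteq> carrier G" using A_carrier by blast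
      have "\<one> \<in> ?N" using subgroup.one_closed[OF sub_A] equiv_hom_one[OF hom sub_A] add_subgroup_zero[OF W0] by simp
      then show "?N \<noteq> {}" by blast
      show "inv a \<in> ?N" if "a \<in> ?N" for a
        using that subgroup.m_inv_closed[OF sub_A] equiv_hom_inv[OF hom sub_A] add_subgroup_minus[OF W0] by simp
      show "a \<otimes> b \<in> ?N" if "a \<in> ?N" "b \<in> ?N" for a b
        using that subgroup.m_closed[OF sub_A] equiv_homD(2)[OF hom] add_subgroup_add[OF W0] by simp
    qed
    show "g \<otimes> a \<otimes> inv g \<in> ?N" if "g \<in> carrier G" "a \<in> ?N" for g a
      using that A equiv_homD(3)[OF hom] gmoduleD(3)[OF W(1)] by (simp add: normal_inv_iff)
  qed
  moreover have "B \<subseteq> ?N"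
  proof
    fix b assume "b \<in> B"
    then have "b \<in> A" "\<phi> b = 0" using BA ker by blast+
    then show "b \<in> ?N" using add_subgroup_zero[OF W0] by simp
  qed
  ultimately have "?N = B \<or> ?N = A" using minimal[of ?N] by blast
  then show "W = {0} \<or> W = V"
  proof
    assume N: "?N = B"
    have "w = 0" if w: "w \<in> W" for w
    proof -
      obtain a where a: "a \<in> A" "w = \<phi> a" using w W(2) by blast
      then have "a \<in> ?N" using w by simp
      then show ?thesis using N ker a by simp
    qed
    then show ?thesis using add_subgroup_zero[OF W0] by blast
  next
    assume "?N = A"
    then show ?thesis using W(2) by blast
  qed
qed

text \<open>A cocycle that does not vanish on \<open>A\<close> restricts there to an equivariant map
  with kernel \<open>B\<close>, onto \<open>W\<close> by irreducibility. So \<open>W\<close> is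
  isomorphic to \<open>V\<close>, and only \<open>V\<close> has to be watched for new
  obstructions.\<close>

lemma obstructed_transfer:
  assumes W: "irreducible_gmodule W" "finite W" "\<And>w. w \<in> W \<Longrightarrow> w + w = 0"
    and obs: "obstructed a1 a2 B W c1 c2"
    and c: "c1 \<in> carrier G" "c2 \<in> carrier G" "a1 \<in> carrier G" "a2 \<in> carrier G"
    and neq: "cocycles W B \<noteq> cocycles W A"
  shows "obstructed a1 a2 B V c1 c2" "v \<in> V \<Longrightarrow> v + v = 0"
proof -
  have gW: "gmodule W" and irr: "\<And>U. gmodule U \<Longrightarrow> U \<subseteq> W \<Longrightarrow> U = {0} \<or> U = W"
    using W(1) by (auto simp: irreducible_gmodule_def)
  have triv: "translate a w = w" if "a \<in> A" "w \<in> W" for a w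
    by (rule obstructed_acts_trivially[OF W obs c(1,2) neq that])
  obtain f where f: "f \<in> cocycles W B" "f \<notin> cocycles W A"
    using neq cocycles_antimono[of B A W] BA by blast
  define \<psi> where "\<psi> a = delta a f" for a
  have hom': "equiv_hom A \<psi>"
    unfolding \<psi>_def by (rule delta_equiv_hom[OF gW A triv f(1)])
  have \<psi>B: "\<psi> b = 0" if "b \<in> B" for b unfolding \<psi>_def using cocyclesD(4)[OF f(1) that] .
  have ker': "{a \<in> A. \<psi> a = 0} = B"
  proof (rule normal_between_eq_B)
    show "{a \<in> A. \<psi> a = 0} \<lhd> G" by (rule equalizer_normal[OF hom' equiv_hom_zero[OF A] A])
    show "B \<subseteq> {a \<in> A. \<psi> a = 0}" using \<psi>B BA by blast
    have "{a \<in> A. \<psi> a = 0} \<noteq> A" using f by (auto simp: cocycles_def \<psi>_def)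
    then show "{a \<in> A. \<psi> a = 0} \<subset> A" by blast
  qed
  have "\<psi> ` A \<noteq> {0}" using ker' BA by blast
  moreover have "\<psi> ` A \<subseteq> W" using cocyclesD(3)[OF f(1)] A_carrier unfolding \<psi>_def by blast
  ultimately have im: "\<psi> ` A = W" using irr[OF equiv_hom_image_gmodule[OF hom' A]] by blast
  have k1: "\<phi> a = 0" if "a \<in> A" "\<psi> a = 0" for a using that ker' ker by blast
  have k2: "\<psi> a = 0" if "a \<in> A" "\<phi> a = 0" for a using that \<psi>B ker by blast
  obtain \<alpha> where \<alpha>: "\<And>a. a \<in> A \<Longrightarrow> \<alpha> (\<psi> a) = \<phi> a"
    "\<And>v w. v \<in> W \<Longrightarrow> w \<in> W \<Longrightarrow> \<alpha> (v + w) = \<alpha> v + \<alpha> w"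
    "\<And>g v. g \<in> carrier G \<Longrightarrow> v \<in> W \<Longrightarrow> \<alpha> (translate g v) = translate g (\<alpha> v)"
    using equiv_hom_factor[OF hom' hom A k1] unfolding im by blast
  obtain \<beta> where \<beta>: "\<And>a. a \<in> A \<Longrightarrow> \<beta> (\<phi> a) = \<psi> a"
    "\<And>v w. v \<in> V \<Longrightarrow> w \<in> V \<Longrightarrow> \<beta> (v + w) = \<beta> v + \<beta> w"
    "\<And>g v. g \<in> carrier G \<Longrightarrow> v \<in> V \<Longrightarrow> \<beta> (translate g v) = translate g (\<beta> v)"
    using equiv_hom_factor[OF hom hom' A k2] by blast
  have W_ex: "\<exists>a\<in>A. w = \<psi> a" if "w \<in> W" for w using that im by blast
  have V_ex: "\<exists>a\<in>A. v = \<phi> a" if "v \<in> V" for v using that by blast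
  have "\<alpha> w \<in> V" "\<beta> (\<alpha> w) = w" if "w \<in> W" for w
    using W_ex[OF that] \<alpha>(1) \<beta>(1) by auto
  moreover have "\<beta> v \<in> W" "\<alpha> (\<beta> v) = v" if "v \<in> V" for v
    using V_ex[OF that] \<alpha>(1) \<beta>(1) im by auto
  ultimately show "obstructed a1 a2 B V c1 c2"
    by (intro obstructed_transport[OF gW V_gmodule B_subset c _ \<alpha>(2,3) _ \<beta>(2,3) _ _ obs])
  show "v + v = 0" if "v \<in> V"
  proof -
    obtain a where a: "a \<in> A" "v = \<phi> a" using V_ex[OF \<open>v \<in> V\<close>] by blast
    have aW: "\<psi> a \<in> W" using a im by blast
    have "\<alpha> (0 + 0) = \<alpha> 0 + \<alpha> 0" using \<alpha>(2) add_subgroup_zero[OF gmoduleD(1)[OF gW]] by blast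
    then have "\<alpha> 0 = 0" by simp
    moreover have "v + v = \<alpha> (\<psi> a + \<psi> a)" using \<alpha>(1)[OF a(1)] \<alpha>(2)[OF aW aW] a(2) by simp
    ultimately show ?thesis using W(3)[OF aW] by simp
  qed
qed

text \<open>By \<open>obstructed_cocycle_cases\<close> the cocycles modulo \<open>B\<close> are
  those vanishing on \<open>A\<close>, whose values ignore the lift, and the splittings, whose
  values it shifts. Exponent two absorbs the sign in \<open>forbidden\<close>. The result has the
  shape that \<open>exists_not_balanced\<close> can prevent.\<close>

lemma balanced_lift:
  assumes char2: "\<And>v. v \<in> V \<Longrightarrow> v + v = 0"
    and c: "c1 \<in> carrier G" "c2 \<in> carrier G" "a1 \<in> carrier G" "a2 \<in> carrier G" and m: "m1 \<in> A" "m2 \<in> A"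
    and obs: "obstructed a1 a2 B V (m1 \<otimes> c1) (m2 \<otimes> c2)"
  shows "balanced V
    (values_at c1 a1 V A \<union> (+) (\<phi> m1) ` forbidden a1 c1)
    (values_at c2 a2 V A \<union> (+) (\<phi> m2) ` forbidden a2 c2)
    (value_pairs c1 c2 V A \<union> (+) (\<phi> m1, \<phi> m2) ` forbidden_pairs c1 c2)"
proof -
  have mc: "m1 \<otimes> c1 \<in> carrier G" using m c A_carrier by simp
  have cases: "cocycles V B = cocycles V A \<union> splittings"
    using obstructed_cocycle_cases[OF obs mc c(3)] cocycles_antimono[of B A V] BA splittingsD(1) by blast
  have neg: "- v = v" if "v \<in> V" for v using char2[OF that] by (simp add: minus_unique)
  have old: "delta (m \<otimes> c) f = delta c f" if "f \<in> cocycles V A" "m \<in> A" "c \<in> carrier G" for f m c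
    by (rule delta_coset[OF A that])
  have new: "delta (m \<otimes> c) f = \<phi> m + (- delta c f)" if "f \<in> splittings" "m \<in> A" "c \<in> carrier G" for f m c
    using delta_lift[OF that] neg[OF delta_in_V[OF that(1,3)]] by (simp add: add.commute)
  have U: "delta (m \<otimes> c) ` {f \<in> cocycles V B. delta a f = 0} =
      values_at c a V A \<union> (+) (\<phi> m) ` forbidden a c"
    if mc: "m \<in> A" "c \<in> carrier G" for m c a
  proof -
    have "{f \<in> cocycles V B. delta a f = 0} =
      {f \<in> cocycles V A. delta a f = 0} \<union> {f \<in> splittings. delta a f = 0}" using cases by blast
    then have "delta (m \<otimes> c) ` {f \<in> cocycles V B. delta a f = 0} =
      delta (m \<otimes> c) ` {f \<in> cocycles V A. delta a f = 0} \<union>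
      delta (m \<otimes> c) ` {f \<in> splittings. delta a f = 0}" by (simp only: image_Un)
    moreover have "delta (m \<otimes> c) ` {f \<in> cocycles V A. delta a f = 0} =
      values_at c a V A"
      by (rule image_cong[OF refl]) (use old mc in blast)
    moreover have "delta (m \<otimes> c) ` {f \<in> splittings. delta a f = 0} = (+) (\<phi> m) ` forbidden a c"
      unfolding forbidden_def image_image by (rule image_cong[OF refl]) (use new mc in blast)
    ultimately show ?thesis by simp
  qed
  have "(\<lambda>f. (delta (m1 \<otimes> c1) f, delta (m2 \<otimes> c2) f)) ` cocycles V B =
    (\<lambda>f. (delta (m1 \<otimes> c1) f, delta (m2 \<otimes> c2) f)) ` cocycles V A \<union>
    (\<lambda>f. (delta (m1 \<otimes> c1) f, delta (m2 \<otimes> c2) f)) ` splittings"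
    unfolding cases by (rule image_Un)
  moreover have "(\<lambda>f. (delta (m1 \<otimes> c1) f, delta (m2 \<otimes> c2) f)) ` cocycles V A =
    value_pairs c1 c2 V A"
    by (rule image_cong[OF refl]) (simp only: old m c)
  moreover have "(\<lambda>f. (delta (m1 \<otimes> c1) f, delta (m2 \<otimes> c2) f)) ` splittings =
    (+) (\<phi> m1, \<phi> m2) ` forbidden_pairs c1 c2"
    unfolding forbidden_pairs_def image_image
    by (rule image_cong[OF refl]) (simp only: new m c add_Pair)
  ultimately show ?thesis
    using obs unfolding obstructed_def U[OF m(1) c(1)] U[OF m(2) c(2)] by (simp only:)
qed

lemma exists_unobstructed_lifts:
  assumes c: "a1 \<in> carrier G" "a2 \<in> carrier G" "c1 \<in> carrier G" "c2 \<in> carrier G" "b1 \<in> carrier G" "b2 \<in> carrier G"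
    and gA: "generates_mod A a1 c1" "generates_mod A c1 c2" "generates_mod A a2 c2"
    and gB: "generates_mod B a1 b1" "generates_mod B a2 b2"
    and unobs: "(\<And>v. v \<in> V \<Longrightarrow> v + v = 0) \<Longrightarrow> \<not> obstructed a1 a2 A V c1 c2"
  shows "\<exists>m1\<in>A. \<exists>m2\<in>A. generates_mod B a1 (m1 \<otimes> c1) \<and> generates_mod B (m1 \<otimes> c1) (m2 \<otimes> c2) \<and>
    generates_mod B a2 (m2 \<otimes> c2) \<and>
    \<not> ((\<forall>v\<in>V. v + v = 0) \<and> obstructed a1 a2 B V (m1 \<otimes> c1) (m2 \<otimes> c2))"
proof -
  obtain v1 v2 where v: "v1 \<in> V - forbidden a1 c1" "v2 \<in> V - forbidden a2 c2" "(v1, v2) \<notin> forbidden_pairs c1 c2"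
    using exists_lifts[OF c gA gB unobs] by blast
  have lift: "\<exists>m1\<in>A. \<exists>m2\<in>A. w1 = \<phi> m1 \<and> w2 = \<phi> m2 \<and> generates_mod B a1 (m1 \<otimes> c1) \<and>
      generates_mod B (m1 \<otimes> c1) (m2 \<otimes> c2) \<and> generates_mod B a2 (m2 \<otimes> c2)"
    if w: "w1 \<in> V - forbidden a1 c1" "w2 \<in> V - forbidden a2 c2" "(w1, w2) \<notin> forbidden_pairs c1 c2" for w1 w2
  proof -
    obtain m1 m2 where m: "m1 \<in> A" "m2 \<in> A" "w1 = \<phi> m1" "w2 = \<phi> m2" using w by blast
    then show ?thesis
      using w lift_generates_iff[OF c(1,3) gA(1) m(1)] lift_generates_iff[OF c(2,4) gA(3) m(2)]
        lifts_generate_iff[OF c(3,4) gA(2) m(1,2)] by blast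
  qed
  show ?thesis
  proof (cases "(\<forall>v\<in>V. v + v = 0) \<and> splittings \<noteq> {}")
    \<comment> \<open>In exponent two there are no splittings here, so an obstruction modulo
      \<open>B\<close> would leave only cocycles vanishing on \<open>A\<close> and would already be
      one modulo \<open>A\<close>.\<close>
    case False
    obtain m1 m2 where m: "m1 \<in> A" "m2 \<in> A" and g: "generates_mod B a1 (m1 \<otimes> c1)"
      "generates_mod B (m1 \<otimes> c1) (m2 \<otimes> c2)" "generates_mod B a2 (m2 \<otimes> c2)"
      using lift[OF v] by blast
    have "\<not> ((\<forall>v\<in>V. v + v = 0) \<and> obstructed a1 a2 B V (m1 \<otimes> c1) (m2 \<otimes> c2))"
    proof
      assume *: "(\<forall>v\<in>V. v + v = 0) \<and> obstructed a1 a2 B V (m1 \<otimes> c1) (m2 \<otimes> c2)"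
      then have "splittings = {}" using False by blast
      moreover have "m1 \<otimes> c1 \<in> carrier G" using m c A_carrier by simp
      ultimately have "cocycles V B = cocycles V A"
        using obstructed_cocycle_cases[OF conjunct2[OF *] _ c(1)] cocycles_antimono[of B A V] BA by blast
      from obstructed_cong[OF this] have "obstructed a1 a2 A V (m1 \<otimes> c1) (m2 \<otimes> c2)"
        using * by (simp only:)
      then have "obstructed a1 a2 A V c1 c2" by (simp only: obstructed_coset[OF A m c(3,4)])
      moreover have "\<not> obstructed a1 a2 A V c1 c2" using * by (intro unobs) blast
      ultimately show False by (rule notE[rotated])
    qed
    then show ?thesis using m g by blast
  next
    case True
    then have char2: "v + v = 0" if "v \<in> V" for v using that by blast
    interpret E: elementary_2_group V
      using V_add_subgroup finite_V char2 by unfold_locales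
    let ?W = "value_pairs c1 c2 V A"
    let ?u = "\<lambda>a c. values_at c a V A"
    have coc: "add_subgroup (cocycles V A)" by (rule cocycles_subgroup[OF V_gmodule])
    have W: "add_subgroup ?W"
    proof -
      have "(delta c1 f, delta c2 f) - (delta c1 h, delta c2 h) \<in> ?W"
        if "f \<in> cocycles V A" "h \<in> cocycles V A" for f h
        using imageI[OF add_subgroup_diff[OF coc that], of "\<lambda>f. (delta c1 f, delta c2 f)"]
        by (simp only: delta_diff diff_Pair)
      moreover have "0 \<in> ?W"
        using imageI[OF add_subgroup_zero[OF coc], of "\<lambda>f. (delta c1 f, delta c2 f)"]
        by (simp only: delta_zero zero_prod_def)
      ultimately show ?thesis unfolding add_subgroup_def by (auto simp only:)
    qed
    have WV: "?W \<subseteq> V \<times> V" using cocyclesD(3) c(3,4) by blast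
    have Z3: "p - z \<in> ?W \<longleftrightarrow> p \<in> forbidden_pairs c1 c2" if z: "z \<in> forbidden_pairs c1 c2" for p z
    proof -
      obtain f where f: "f \<in> splittings" "z = (- delta c1 f, - delta c2 f)"
        using z unfolding forbidden_pairs_def by blast
      show ?thesis
      proof
        assume "p - z \<in> ?W"
        then obtain h where h: "h \<in> cocycles V A" "p - z = (delta c1 h, delta c2 h)" by blast
        have nh: "f - h \<in> splittings"
          using splittings_add[OF f(1) add_subgroup_minus[OF coc h(1)]] by simp
        have "p = (p - z) + z" by simp
        also have "\<dots> = (delta c1 h, delta c2 h) + z" by (simp only: h(2))
        also have "\<dots> = (- delta c1 (f - h), - delta c2 (f - h))"
          unfolding f(2) by (simp add: delta_diff)
        finally show "p \<in> forbidden_pairs c1 c2" using nh unfolding forbidden_pairs_def by blast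
      next
        assume "p \<in> forbidden_pairs c1 c2"
        then obtain h where h: "h \<in> splittings" "p = (- delta c1 h, - delta c2 h)"
          unfolding forbidden_pairs_def by blast
        have "p - z = (delta c1 (f - h), delta c2 (f - h))"
          unfolding h(2) f(2) by (simp add: delta_diff)
        then show "p - z \<in> ?W" using splittings_diff[OF f(1) h(1)] by blast
      qed
    qed
    have A3: "x - b \<in> ?u a c \<longleftrightarrow> x \<in> forbidden a c" if b: "b \<in> forbidden a c" for a c b x
    proof -
      obtain f where f: "f \<in> splittings" "delta a f = 0" "b = - delta c f"
        using b unfolding forbidden_def by blast
      show ?thesis
      proof
        assume "x - b \<in> ?u a c"
        then obtain h where h: "h \<in> cocycles V A" "delta a h = 0" "x - b = delta c h" by blast
        have nh: "f - h \<in> splittings"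
          using splittings_add[OF f(1) add_subgroup_minus[OF coc h(1)]] by simp
        have "x = (x - b) + b" by simp
        also have "\<dots> = delta c h + b" by (simp only: h(3))
        also have "\<dots> = - delta c (f - h)"
          unfolding f(3) by (simp add: delta_diff)
        finally have "x = - delta c (f - h)" .
        moreover have "delta a (f - h) = 0" using f h by (simp add: delta_diff)
        ultimately show "x \<in> forbidden a c" using nh unfolding forbidden_def by blast
      next
        assume "x \<in> forbidden a c"
        then obtain h where h: "h \<in> splittings" "delta a h = 0" "x = - delta c h"
          unfolding forbidden_def by blast
        have "x - b = delta c (f - h)" unfolding h(3) f(3) by (simp add: delta_diff)
        moreover have "delta a (f - h) = 0" using f h by (simp add: delta_diff)
        ultimately show "x - b \<in> ?u a c" using splittings_diff[OF f(1) h(1)] by blast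
      qed
    qed
    have Zne: "forbidden_pairs c1 c2 \<noteq> {}" using True unfolding forbidden_pairs_def by blast
    have "\<exists>w1\<in>V - forbidden a1 c1. \<exists>w2\<in>V - forbidden a2 c2. (w1, w2) \<notin> forbidden_pairs c1 c2 \<and>
      \<not> balanced V (?u a1 c1 \<union> (+) w1 ` forbidden a1 c1) (?u a2 c2 \<union> (+) w2 ` forbidden a2 c2)
        (?W \<union> (+) (w1, w2) ` forbidden_pairs c1 c2)"
      by (rule E.exists_not_balanced[OF W WV forbidden_pairs_subset[OF c(3,4)] Zne Z3
          add_subgroup_delta_image[OF V_gmodule] delta_image_subset[OF c(3)] forbidden_subset[OF c(3)] A3
          add_subgroup_delta_image[OF V_gmodule] delta_image_subset[OF c(4)] forbidden_subset[OF c(4)] A3 v])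
    then obtain w1 w2 where w: "w1 \<in> V - forbidden a1 c1" "w2 \<in> V - forbidden a2 c2" "(w1, w2) \<notin> forbidden_pairs c1 c2"
      and nb: "\<not> balanced V (?u a1 c1 \<union> (+) w1 ` forbidden a1 c1) (?u a2 c2 \<union> (+) w2 ` forbidden a2 c2)
        (?W \<union> (+) (w1, w2) ` forbidden_pairs c1 c2)"
      by (elim bexE conjE) (rule that)
    obtain m1 m2 where m: "m1 \<in> A" "m2 \<in> A" "w1 = \<phi> m1" "w2 = \<phi> m2" and g: "generates_mod B a1 (m1 \<otimes> c1)"
      "generates_mod B (m1 \<otimes> c1) (m2 \<otimes> c2)" "generates_mod B a2 (m2 \<otimes> c2)"
      using lift[OF w] by blast
    have "\<not> obstructed a1 a2 B V (m1 \<otimes> c1) (m2 \<otimes> c2)"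
      using nb balanced_lift[OF char2 c(3,4,1,2) m(1,2)] unfolding m(3,4) by (rule contrapos_nn)
    then show ?thesis using m(1,2) g by blast
  qed
qed

end

section \<open>Abelian chief factors of a soluble group and the induction along them\<close>

context group
begin

lemma exp_of_derived_normal: "(derived G ^^ n) (carrier G) \<lhd> G"
proof (induction n)
  case 0
  show ?case by (simp add: normal_inv_iff subgroup_self)
next
  case (Suc n)
  then show ?case by (simp add: derived_is_normal)
qed

text \<open>\<open>D k\<close> is the last term of the derived series not contained in
  \<open>B\<close>. Modulo \<open>B\<close> the product \<open>?M\<close> has the same image as
  \<open>D k\<close>, and the derived subgroup of that image is the image of \<open>D l\<close>,
  which is trivial.\<close>

lemma exists_abelian_normal_over:
  assumes B: "B \<lhd> G" "B \<noteq> carrier G" and sol: "solvable G"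
  obtains M where "M \<lhd> G" "B \<subset> M"
    "\<And>x y. x \<in> M \<Longrightarrow> y \<in> M \<Longrightarrow> x \<otimes> y \<otimes> inv x \<otimes> inv y \<in> B"
proof -
  define D where "D n = (derived G ^^ n) (carrier G)" for n
  have sB: "subgroup B G" using B by (simp add: normal_imp_subgroup)
  have DN: "D n \<lhd> G" for n unfolding D_def by (rule exp_of_derived_normal)
  have DG: "D n \<subseteq> carrier G" for n using DN by (simp add: normal_imp_subgroup subgroup.subset)
  obtain n where "D n = {\<one>}" using sol unfolding solvable_iff_trivial_derived_seq D_def by blast
  then have ex: "\<exists>n. D n \<subseteq> B" using subgroup.one_closed[OF sB] by (intro exI[of _ n]) simp
  define l where "l = (LEAST n. D n \<subseteq> B)"
  have l: "D l \<subseteq> B" unfolding l_def by (rule LeastI_ex[OF ex])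
  have "D 0 = carrier G" by (simp add: D_def)
  then have "l \<noteq> 0" using l B subgroup.subset[OF sB] by auto
  then obtain k where k: "l = Suc k" by (cases l) auto
  have nk: "\<not> D k \<subseteq> B" using not_less_Least[of k "\<lambda>n. D n \<subseteq> B"] k unfolding l_def by simp
  have Dk: "derived G (D k) = D l" using k by (simp add: D_def)
  let ?M = "B <#> D k"
  have sD: "subgroup (D k) G" using DN by (rule normal_imp_subgroup)
  have sM: "subgroup ?M G" by (rule mult_norm_subgroup[OF B(1) sD])
  have M: "?M \<lhd> G"
    unfolding normal_inv_iff
  proof (intro conjI ballI sM)
    fix g z assume g: "g \<in> carrier G" and z: "z \<in> ?M"
    obtain b d where bd: "b \<in> B" "d \<in> D k" "z = b \<otimes> d" using z unfolding set_mult_def by blast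
    have bdG: "b \<in> carrier G" "d \<in> carrier G"
      using bd subgroup.mem_carrier[OF sB] subgroup.mem_carrier[OF sD] by blast+
    have "inv g \<otimes> (g \<otimes> (d \<otimes> inv g)) = d \<otimes> inv g" using g bdG by (simp add: m_assoc[symmetric])
    then have "g \<otimes> z \<otimes> inv g = (g \<otimes> b \<otimes> inv g) \<otimes> (g \<otimes> d \<otimes> inv g)"
      using bd(3) bdG g by (simp add: m_assoc)
    moreover have "g \<otimes> b \<otimes> inv g \<in> B" "g \<otimes> d \<otimes> inv g \<in> D k"
      using B(1) DN[of k] g bd by (simp_all add: normal_inv_iff)
    ultimately show "g \<otimes> z \<otimes> inv g \<in> ?M" unfolding set_mult_def by blast
  qed
  have DM: "d \<in> ?M" if "d \<in> D k" for d
  proof -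
    have "d = \<one> \<otimes> d" using subgroup.mem_carrier[OF sD that] by simp
    then show ?thesis using that subgroup.one_closed[OF sB] unfolding set_mult_def by blast
  qed
  have BM: "b \<in> ?M" if "b \<in> B" for b
  proof -
    have "b = b \<otimes> \<one>" using subgroup.mem_carrier[OF sB that] by simp
    then show ?thesis using that subgroup.one_closed[OF sD] unfolding set_mult_def by blast
  qed
  interpret nB: normal B G by (rule B(1))
  interpret h: group_hom G "G Mod B" "\<lambda>x. B #> x"
    by (intro group_hom.intro group_hom_axioms.intro nB.factorgroup_is_group nB.r_coset_hom_Mod is_group)
  have "(\<lambda>x. B #> x) ` ?M = (\<lambda>x. B #> x) ` D k"
  proof
    show "(\<lambda>x. B #> x) ` D k \<subseteq> (\<lambda>x. B #> x) ` ?M" using DM by blast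
    show "(\<lambda>x. B #> x) ` ?M \<subseteq> (\<lambda>x. B #> x) ` D k"
    proof clarify
      fix z assume "z \<in> ?M"
      then obtain b d where bd: "b \<in> B" "d \<in> D k" "z = b \<otimes> d" unfolding set_mult_def by blast
      have bdG: "b \<in> carrier G" "d \<in> carrier G"
        using bd subgroup.mem_carrier[OF sB] subgroup.mem_carrier[OF sD] by blast+
      have "B #> z = B #> d"
        using coset_mult_assoc[OF subgroup.subset[OF sB] bdG] coset_join2[OF bdG(1) sB bd(1)] bd(3) by simp
      then show "B #> z \<in> (\<lambda>x. B #> x) ` D k" using bd(2) by blast
    qed
  qed
  then have im: "(\<lambda>x. B #> x) ` derived G ?M = (\<lambda>x. B #> x) ` D l"
    using h.derived_img[OF subgroup.subset[OF sM]] h.derived_img[OF DG[of k]] Dk by simp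
  have "x \<otimes> y \<otimes> inv x \<otimes> inv y \<in> B" if xy: "x \<in> ?M" "y \<in> ?M" for x y
  proof -
    let ?z = "x \<otimes> y \<otimes> inv x \<otimes> inv y"
    have zG: "?z \<in> carrier G" using xy subgroup.mem_carrier[OF sM] by simp
    have "?z \<in> derived_set G ?M" using xy by blast
    then have "?z \<in> derived G ?M" unfolding derived_def by (rule generate.incl)
    then have "B #> ?z \<in> (\<lambda>x. B #> x) ` D l" using im by blast
    then obtain d where d: "d \<in> D l" "B #> ?z = B #> d" by blast
    then have "B #> ?z = B" using coset_join2[OF _ sB, of d] l DG by auto
    then show ?thesis using zG sB by (rule coset_join1)
  qed
  moreover have "B \<subset> ?M" using BM DM nk by blast
  ultimately show ?thesis using that M by blast
qed

lemma exists_chief_over: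
  assumes B: "B \<lhd> G" "B \<noteq> carrier G" and sol: "solvable G" and fin: "finite (carrier G)"
  obtains A where "A \<lhd> G" "B \<subset> A"
    "\<And>N. N \<lhd> G \<Longrightarrow> B \<subseteq> N \<Longrightarrow> N \<subseteq> A \<Longrightarrow> N = B \<or> N = A"
    "\<And>x y. x \<in> A \<Longrightarrow> y \<in> A \<Longrightarrow> x \<otimes> y \<otimes> inv x \<otimes> inv y \<in> B"
proof -
  obtain M where M: "M \<lhd> G" "B \<subset> M"
    "\<And>x y. x \<in> M \<Longrightarrow> y \<in> M \<Longrightarrow> x \<otimes> y \<otimes> inv x \<otimes> inv y \<in> B"
    using exists_abelian_normal_over[OF B sol] by blast
  let ?P = "\<lambda>N. N \<lhd> G \<and> B \<subset> N \<and> N \<subseteq> M"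
  have "?P M" using M by blast
  then obtain A where A: "?P A" and min: "\<And>N. ?P N \<Longrightarrow> card A \<le> card N"
    using ex_has_least_nat[of ?P M card] by blast
  have fA: "finite A" using A fin normal_imp_subgroup subgroup.subset by (metis finite_subset)
  show ?thesis
  proof (rule that[of A])
    show "N = B \<or> N = A" if N: "N \<lhd> G" "B \<subseteq> N" "N \<subseteq> A" for N
    proof (rule disjCI)
      assume "N \<noteq> A"
      show "N = B"
      proof (rule ccontr)
        assume "N \<noteq> B"
        then have "card A \<le> card N" using N A by (intro min) blast
        then show False using card_seteq[OF fA N(3)] \<open>N \<noteq> A\<close> by blast
      qed
    qed
    show "x \<otimes> y \<otimes> inv x \<otimes> inv y \<in> B" if "x \<in> A" "y \<in> A" for x y using that A M(3) by blast
  qed (use A in blast)+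
qed

text \<open>The induction goes down from the whole group to smaller \<open>N\<close>. The absence of
  obstructions is claimed for all modules at once, because the next chief factor is known only after
  the path has been fixed.\<close>

lemma exists_unobstructed_path:
  assumes fin: "finite (carrier G)" and sol: "solvable G"
    and c: "a1 \<in> carrier G" "a2 \<in> carrier G" "b1 \<in> carrier G" "b2 \<in> carrier G"
    and gen: "generate G {a1, b1} = carrier G" "generate G {a2, b2} = carrier G"
    and N: "N \<lhd> G"
  shows "\<exists>c1\<in>carrier G. \<exists>c2\<in>carrier G. generates_mod N a1 c1 \<and> generates_mod N c1 c2 \<and> generates_mod N a2 c2 \<and>
    (\<forall>W. irreducible_gmodule W \<longrightarrow> finite W \<longrightarrow> (\<forall>w\<in>W. w + w = 0) \<longrightarrow> \<not> obstructed a1 a2 N W c1 c2)"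
  using N
proof (induction "card (carrier G) - card N" arbitrary: N rule: less_induct)
  case less
  have NG: "N \<subseteq> carrier G" using less.prems by (simp add: normal_imp_subgroup subgroup.subset)
  show ?case
  proof (cases "N = carrier G")
    case True
    have "generates_mod N x y" if "x \<in> carrier G" "y \<in> carrier G" for x y
    proof -
      have "{x, y} \<union> N = carrier G" using that True by blast
      moreover have "generate G (carrier G) = carrier G"
        using generate_incl[of "carrier G"] generate.incl[of _ "carrier G" G] by blast
      ultimately show ?thesis by (simp add: generates_mod_def)
    qed
    \<comment> \<open>Modulo the whole group only the zero cocycle is left, so an obstruction would
      make the square of \<open>card W\<close> equal to two.\<close>
    moreover have "\<not> obstructed a1 a2 N W \<one> \<one>"
      if W: "irreducible_gmodule W" "finite W" "\<forall>w\<in>W. w + w = 0" for W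
    proof
      assume obs: "obstructed a1 a2 N W \<one> \<one>"
      have gW: "gmodule W" using W(1) by (simp add: irreducible_gmodule_def)
      have "elementary_2_group W" using gmoduleD(1)[OF gW] W(2,3) by unfold_locales blast+
      from obstructed_card[OF obs this]
      have *: "2 * card ((\<lambda>f. (delta \<one> f, delta \<one> f)) ` cocycles W N) = card W * card W" by simp
      have "f = 0" if "f \<in> cocycles W N" for f
        using cocycle_eq_0[OF that] cocyclesD(4)[OF that] True by blast
      then have "cocycles W N = {0}" using add_subgroup_zero[OF cocycles_subgroup[OF gW]] by blast
      then have "card W * card W = 2" using * by simp
      then have "card W dvd 2" by (metis dvd_triv_left)
      then have "card W = 1 \<or> card W = 2" using dvd_imp_le[of "card W" 2] \<open>card W * card W = 2\<close>
        by (cases "card W = 0") auto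
      then show False using \<open>card W * card W = 2\<close> by auto
    qed
    ultimately show ?thesis using c one_closed by blast
  next
    case False
    obtain A where An: "A \<lhd> G" "N \<subset> A"
      and min: "\<And>M. M \<lhd> G \<Longrightarrow> N \<subseteq> M \<Longrightarrow> M \<subseteq> A \<Longrightarrow> M = N \<or> M = A"
      and comm: "\<And>x y. x \<in> A \<Longrightarrow> y \<in> A \<Longrightarrow> x \<otimes> y \<otimes> inv x \<otimes> inv y \<in> N"
      using exists_chief_over[OF less.prems False sol fin] by blast
    have AG: "A \<subseteq> carrier G" using An by (simp add: normal_imp_subgroup subgroup.subset)
    have fA: "finite A" using AG fin by (rule finite_subset)
    obtain \<phi> where \<phi>: "equiv_hom A \<phi>" "\<And>a. a \<in> A \<Longrightarrow> \<phi> a = 0 \<longleftrightarrow> a \<in> N"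
      using exists_chief_embedding[OF An(1) less.prems An(2) fA min comm] by blast
    interpret chief_step G A N \<phi>
      by (rule chief_step.intro[OF is_group chief_step_axioms.intro]) (fact fin An less.prems min comm \<phi>)+
    have "card N < card A" using An(2) fA by (intro psubset_card_mono)
    moreover have "card A \<le> card (carrier G)" using AG fin by (rule card_mono[rotated])
    ultimately have "card (carrier G) - card A < card (carrier G) - card N" by linarith
    from less.hyps[OF this An(1)] obtain c1 c2 where c12: "c1 \<in> carrier G" "c2 \<in> carrier G"
      and gA: "generates_mod A a1 c1" "generates_mod A c1 c2" "generates_mod A a2 c2"
      and unobs: "\<And>W. irreducible_gmodule W \<Longrightarrow> finite W \<Longrightarrow> (\<forall>w\<in>W. w + w = 0) \<Longrightarrow> \<not> obstructed a1 a2 A W c1 c2"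
      by blast
    have gB: "generates_mod N x y" if "generate G {x, y} = carrier G" "x \<in> carrier G" "y \<in> carrier G" for x y
      by (rule generates_mod_mono[of "{}"]) (use that NG in \<open>auto simp: generates_mod_def\<close>)
    have unobsV: "\<not> obstructed a1 a2 A V c1 c2" if "\<And>v. v \<in> V \<Longrightarrow> v + v = 0"
      using unobs[OF V_irreducible finite_V] that by blast
    obtain m1 m2 where m: "m1 \<in> A" "m2 \<in> A"
      and g: "generates_mod N a1 (m1 \<otimes> c1)" "generates_mod N (m1 \<otimes> c1) (m2 \<otimes> c2)" "generates_mod N a2 (m2 \<otimes> c2)"
      and nV: "\<not> ((\<forall>v\<in>V. v + v = 0) \<and> obstructed a1 a2 N V (m1 \<otimes> c1) (m2 \<otimes> c2))"
      using exists_unobstructed_lifts[OF c(1,2) c12 c(3,4) gA gB[OF gen(1) c(1,3)] gB[OF gen(2) c(2,4)] unobsV]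
      by blast
    have mc: "m1 \<otimes> c1 \<in> carrier G" "m2 \<otimes> c2 \<in> carrier G" using m c12 AG by auto
    have "\<not> obstructed a1 a2 N W (m1 \<otimes> c1) (m2 \<otimes> c2)"
      if W: "irreducible_gmodule W" "finite W" "\<forall>w\<in>W. w + w = 0" for W
    proof
      assume obs: "obstructed a1 a2 N W (m1 \<otimes> c1) (m2 \<otimes> c2)"
      have W2: "w + w = 0" if "w \<in> W" for w using W(3) that by blast
      \<comment> \<open>Either \<open>W\<close> gained no cocycles, and the obstruction was already
        present modulo \<open>A\<close>, or it passes to \<open>V\<close>, where the choice of the
        lift excludes it.\<close>
      show False
      proof (cases "cocycles W N = cocycles W A")
        case True
        from obstructed_cong[OF True] have "obstructed a1 a2 A W (m1 \<otimes> c1) (m2 \<otimes> c2)"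
          using obs by (simp only:)
        then have "obstructed a1 a2 A W c1 c2" by (simp only: obstructed_coset[OF An(1) m c12])
        then show False using unobs[OF W] by contradiction
      next
        case neq: False
        show False
          using nV obstructed_transfer[OF W(1,2) W2 obs mc c(1,2) neq] by blast
      qed
    qed
    then show ?thesis using mc g by blast
  qed
qed

theorem solvable_generating_path:
  assumes fin: "finite (carrier G)" and sol: "solvable G"
    and c: "a1 \<in> carrier G" "a2 \<in> carrier G" "b1 \<in> carrier G" "b2 \<in> carrier G"
    and gen: "generate G {a1, b1} = carrier G" "generate G {a2, b2} = carrier G"
  shows "\<exists>c1\<in>carrier G. \<exists>c2\<in>carrier G. generate G {a1, c1} = carrier G \<and>
    generate G {c1, c2} = carrier G \<and> generate G {a2, c2} = carrier G"
proof -
  have red: "generate G {x, y} = carrier G"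
    if "generates_mod {\<one>} x y" "x \<in> carrier G" "y \<in> carrier G" for x y
  proof -
    have K: "subgroup (generate G {x, y}) G" using that by (intro generate_is_subgroup) auto
    have "{x, y} \<union> {\<one>} \<subseteq> generate G {x, y}" by (auto intro: generate.incl generate.one)
    from generate_subgroup_incl[OF this K] show ?thesis
      using that(1) subgroup.subset[OF K] by (auto simp: generates_mod_def)
  qed
  show ?thesis
    using exists_unobstructed_path[OF fin sol c gen one_is_normal] red c(1,2) by blast
qed

end

section \<open>Passage to the inverse limit\<close>

text \<open>Everything about the inverse limit that is used later, expressed by the coordinate maps
  \<open>q i\<close>. They need not be surjective, because transition maps in
  \<open>inverse_system\<close> need not be.\<close>

lemma prosoluble_projections:
  assumes "prosoluble TYPE('i) TYPE('h) G T"
  obtains I :: "'i set" and r and H :: "'i \<Rightarrow> 'h monoid" and q :: "'i \<Rightarrow> 'a \<Rightarrow> 'h" where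
    "group G" "topspace T = carrier G" "compact_space T"
    "\<And>J. finite J \<Longrightarrow> J \<subseteq> I \<Longrightarrow> \<exists>k\<in>I. \<forall>j\<in>J. (j, k) \<in> r"
    "\<And>i. i \<in> I \<Longrightarrow> group (H i)" "\<And>i. i \<in> I \<Longrightarrow> finite (carrier (H i))" "\<And>i. i \<in> I \<Longrightarrow> solvable (H i)"
    "\<And>i. i \<in> I \<Longrightarrow> q i \<in> hom G (H i)"
    "\<And>i. i \<in> I \<Longrightarrow> continuous_map T (discrete_topology (carrier (H i))) (q i)"
    "\<And>i j x y. (i, j) \<in> r \<Longrightarrow> x \<in> carrier G \<Longrightarrow> y \<in> carrier G \<Longrightarrow> q j x = q j y \<Longrightarrow> q i x = q i y"
    "\<And>U x. openin T U \<Longrightarrow> x \<in> U \<Longrightarrow> \<exists>i\<in>I. \<forall>y\<in>carrier G. q i y = q i x \<longrightarrow> y \<in> U"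
proof -
  have tg: "topological_group G T" using assms by (simp add: prosoluble_def)
  obtain I :: "'i set" and r and H :: "'i \<Rightarrow> 'h monoid" and \<phi> where sys: "inverse_system I r H \<phi>"
    and fs': "\<forall>i\<in>I. finite (carrier (H i)) \<and> solvable (H i)"
    and iso': "topological_group_iso G T (inverse_limit_group I r H \<phi>) (inverse_limit_topology I r H \<phi>)"
    using assms unfolding prosoluble_def by (elim conjE exE) (rule that)
  have fs: "\<And>i. i \<in> I \<Longrightarrow> finite (carrier (H i))" "\<And>i. i \<in> I \<Longrightarrow> solvable (H i)"
    using fs' by simp_all
  obtain f where iso: "f \<in> iso G (inverse_limit_group I r H \<phi>)"
    and homeo: "homeomorphic_map T (inverse_limit_topology I r H \<phi>) f"
    using iso' unfolding topological_group_iso_def by (elim conjE exE) (rule that)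
  define L where "L = carrier (inverse_limit_group I r H \<phi>)"
  define P where "P = product_topology (\<lambda>i. discrete_topology (carrier (H i))) I"
  have T: "inverse_limit_topology I r H \<phi> = subtopology P L"
    by (simp add: inverse_limit_topology_def L_def P_def)
  have L: "L = {x \<in> topspace P. \<forall>(i, j)\<in>r. \<phi> i j (x j) = x i}"
    by (simp add: L_def P_def inverse_limit_group_def)
  have dir: "directed_poset I r" and grp: "\<And>i. i \<in> I \<Longrightarrow> group (H i)"
    using sys by (auto simp: inverse_system_def)
  have rI: "i \<in> I" "j \<in> I" if "(i, j) \<in> r" for i j
    using dir that by (auto simp: directed_poset_def partial_order_on_def preorder_on_def refl_on_def)
  have tr: "(i, k) \<in> r" if "(i, j) \<in> r" "(j, k) \<in> r" for i j k
    using dir that by (auto simp: directed_poset_def partial_order_on_def preorder_on_def dest: transD)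
  have bound: "\<exists>k\<in>I. \<forall>j\<in>J. (j, k) \<in> r" if "finite J" "J \<subseteq> I" for J
    using that
  proof (induction J)
    case empty
    then show ?case using dir by (auto simp: directed_poset_def)
  next
    case (insert i J)
    then obtain k where k: "k \<in> I" "\<forall>j\<in>J. (j, k) \<in> r" by blast
    obtain l where "l \<in> I" "(i, l) \<in> r" "(k, l) \<in> r"
      using dir k(1) insert.prems unfolding directed_poset_def by blast
    then show ?case using k tr by blast
  qed
  have topG: "topspace T = carrier G" and G: "group G" using tg by (auto simp: topological_group_def)
  have fL: "f x \<in> L" if "x \<in> carrier G" for x
    using iso that by (auto simp: iso_def L_def bij_betw_def)
  have inj: "inj_on f (carrier G)" using iso by (auto simp: iso_def bij_betw_def)
  define q where "q i x = f x i" for i x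
  have qH: "q i x \<in> carrier (H i)" if "i \<in> I" "x \<in> carrier G" for i x
    using fL[OF that(2)] that(1) by (auto simp: q_def L P_def)
  have compact: "compact_space T"
  proof -
    have cP: "compact_space P"
      unfolding P_def compact_space_product_topology using fs(1) by (auto simp: compact_space_discrete_topology)
    have coord: "closedin P {x \<in> topspace P. x i = h}" if "i \<in> I" for i h
    proof (cases "h \<in> carrier (H i)")
      case True
      have "closedin P {x \<in> topspace P. x i \<in> {h}}"
        unfolding P_def
        by (rule closedin_continuous_map_preimage[OF continuous_map_product_projection[OF that]]) (use True in simp)
      then show ?thesis by simp
    next
      case False
      then have "{x \<in> topspace P. x i = h} = {}" using that by (auto simp: P_def)
      then show ?thesis by (simp only: closedin_empty)
    qed
    \<comment> \<open>One compatibility condition involves two coordinates with finitely many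
      values, so it cuts out a finite union of closed cylinders.\<close>
    have "closedin P {x \<in> topspace P. \<phi> i j (x j) = x i}" if ij: "(i, j) \<in> r" for i j
    proof -
      have "{x \<in> topspace P. \<phi> i j (x j) = x i} =
        (\<Union>h\<in>carrier (H j). {x \<in> topspace P. x j = h} \<inter> {x \<in> topspace P. x i = \<phi> i j h})"
        using rI[OF ij] by (auto simp: P_def)
      moreover have "closedin P \<dots>"
        using fs(1) rI[OF ij] coord by (intro closedin_Union finite_imageI) (auto intro: closedin_Int)
      ultimately show ?thesis by (simp only:)
    qed
    then have "closedin P (topspace P \<inter> (\<Inter>p\<in>r. {x \<in> topspace P. \<phi> (fst p) (snd p) (x (snd p)) = x (fst p)}))"
      by (cases "r = {}") (auto intro!: closedin_Int closedin_INT)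
    also have "topspace P \<inter> (\<Inter>p\<in>r. {x \<in> topspace P. \<phi> (fst p) (snd p) (x (snd p)) = x (fst p)}) = L"
      unfolding L by (auto simp: split_beta)
    finally have "compact_space (subtopology P L)"
      using cP by (intro compact_space_subtopology closedin_compact_space)
    then show ?thesis
      using homeomorphic_compact_space[OF homeomorphic_map_imp_homeomorphic_space[OF homeo]] T by simp
  qed
  have hom: "q i \<in> hom G (H i)" if "i \<in> I" for i
  proof (rule homI)
    show "q i (x \<otimes>\<^bsub>G\<^esub> y) = q i x \<otimes>\<^bsub>H i\<^esub> q i y" if "x \<in> carrier G" "y \<in> carrier G" for x y
    proof -
      have "f (x \<otimes>\<^bsub>G\<^esub> y) = f x \<otimes>\<^bsub>inverse_limit_group I r H \<phi>\<^esub> f y"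
        using iso that by (auto simp: iso_def hom_def)
      then show ?thesis using \<open>i \<in> I\<close> by (simp add: q_def inverse_limit_group_def)
    qed
  qed (rule qH[OF that])
  have cont: "continuous_map T (discrete_topology (carrier (H i))) (q i)" if "i \<in> I" for i
  proof -
    have "continuous_map T P f"
      using homeomorphic_imp_continuous_map[OF homeo] unfolding T by (rule continuous_map_into_fulltopology)
    then have "continuous_map T (discrete_topology (carrier (H i))) ((\<lambda>x. x i) \<circ> f)"
      unfolding P_def by (rule continuous_map_compose[OF _ continuous_map_product_projection[OF that]])
    moreover have "q i = (\<lambda>x. x i) \<circ> f" by (simp add: q_def fun_eq_iff)
    ultimately show ?thesis by simp
  qed
  have down: "q i x = \<phi> i j (q j x)" if "(i, j) \<in> r" "x \<in> carrier G" for i j x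
    using fL[OF that(2)] that(1) by (auto simp: q_def L)
  have base: "\<exists>i\<in>I. \<forall>y\<in>carrier G. q i y = q i x \<longrightarrow> y \<in> U" if U: "openin T U" "x \<in> U" for U x
  proof -
    have UG: "U \<subseteq> carrier G" using openin_subset[OF U(1)] topG by simp
    have "openin (subtopology P L) (f ` U)"
      using homeomorphic_map_openness[OF homeo, of U] U(1) UG topG T by simp
    then obtain W where W: "openin P W" "f ` U = W \<inter> L" by (auto simp: openin_subtopology)
    then have "f x \<in> W" using U(2) by blast
    then obtain X where X: "finite {i \<in> I. X i \<noteq> carrier (H i)}" "f x \<in> Pi\<^sub>E I X" "Pi\<^sub>E I X \<subseteq> W"
      using W(1) unfolding P_def openin_product_topology_alt by fastforce
    \<comment> \<open>A basic open set restricts finitely many coordinates, and directedness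
      replaces them by the single coordinate \<open>k\<close>.\<close>
    obtain k where k: "k \<in> I" "\<forall>j\<in>{i \<in> I. X i \<noteq> carrier (H i)}. (j, k) \<in> r"
      using bound[OF X(1)] by blast
    have "y \<in> U" if y: "y \<in> carrier G" "q k y = q k x" for y
    proof -
      have "f y i \<in> X i" if i: "i \<in> I" for i
      proof (cases "X i = carrier (H i)")
        case True
        then show ?thesis using qH[OF i y(1)] by (simp add: q_def)
      next
        case False
        then have "(i, k) \<in> r" using k(2) i by blast
        then have "q i y = q i x" using down y U(2) UG by (metis subsetD)
        then show ?thesis using X(2) i by (auto simp: q_def)
      qed
      moreover have "f y \<in> extensional I" using fL[OF y(1)] by (auto simp: L P_def PiE_def)
      ultimately have "f y \<in> W" using X(3) by (auto simp: PiE_def)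
      then have "f y \<in> f ` U" using W(2) fL[OF y(1)] by blast
      then show ?thesis using inj y(1) UG by (meson inj_on_image_mem_iff)
    qed
    then show ?thesis using k(1) by blast
  qed
  show thesis
  proof (rule that[of I r H q])
    show "q i x = q i y" if "(i, j) \<in> r" "x \<in> carrier G" "y \<in> carrier G" "q j x = q j y" for i j x y
      using down[OF that(1,2)] down[OF that(1,3)] that(4) by simp
  qed (fact G topG compact bound grp fs hom cont base)+
qed

section \<open>Generation modulo the kernels of the finite images\<close>

context group_hom
begin

lemma generates_mod_kernel_iff:
  assumes xy: "x \<in> carrier G" "y \<in> carrier G"
  shows "G.generates_mod (kernel G H h) x y \<longleftrightarrow> generate H {h x, h y} = h ` carrier G"
proof -
  let ?N = "kernel G H h"
  have NG: "?N \<subseteq> carrier G" by (auto simp: kernel_def)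
  have img: "generate H (h ` S) = h ` generate G S" if "S \<subseteq> carrier G" for S
    using generate_img[OF that] .
  have im2: "generate H {h x, h y} = h ` generate G {x, y}" using img[of "{x, y}"] xy by simp
  have s: "subgroup (generate G {x, y}) G" using xy by (intro G.generate_is_subgroup) auto
  show ?thesis
  proof
    assume gen: "G.generates_mod ?N x y"
    have "subgroup (generate H {h x, h y}) H" using xy by (intro H.generate_is_subgroup) auto
    moreover have "h ` ({x, y} \<union> ?N) \<subseteq> generate H {h x, h y}"
      by (auto simp: kernel_def intro: generate.incl generate.one)
    ultimately have "generate H (h ` ({x, y} \<union> ?N)) \<subseteq> generate H {h x, h y}"
      by (intro H.generate_subgroup_incl)
    then have "h ` carrier G \<subseteq> generate H {h x, h y}"
      using img[of "{x, y} \<union> ?N"] gen xy NG by (simp add: G.generates_mod_def)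
    moreover have "h ` generate G {x, y} \<subseteq> h ` carrier G" using subgroup.subset[OF s] by blast
    ultimately show "generate H {h x, h y} = h ` carrier G" using im2 by blast
  next
    assume eq: "generate H {h x, h y} = h ` carrier G"
    let ?K = "generate G ({x, y} \<union> ?N)"
    have K: "subgroup ?K G" using xy NG by (intro G.generate_is_subgroup) auto
    have "g \<in> ?K" if g: "g \<in> carrier G" for g
    proof -
      have "h g \<in> h ` generate G {x, y}" using eq im2 g by blast
      then obtain k where k: "k \<in> generate G {x, y}" "h g = h k" by blast
      have kG: "k \<in> carrier G" using subgroup.mem_carrier[OF s k(1)] .
      have "generate G {x, y} \<subseteq> ?K" by (rule G.mono_generate) blast
      then have "k \<in> ?K" using k(1) by blast
      moreover have "g \<otimes> inv k \<in> ?N" using g kG k(2) by (simp add: kernel_def)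
      then have "g \<otimes> inv k \<in> ?K" by (auto intro: generate.incl)
      ultimately have "g \<otimes> inv k \<otimes> k \<in> ?K" using subgroup.m_closed[OF K] by blast
      then show ?thesis using g kG by (simp add: G.m_assoc)
    qed
    then show "G.generates_mod ?N x y" using subgroup.subset[OF K] unfolding G.generates_mod_def by blast
  qed
qed

text \<open>The finite theorem is applied to the image of \<open>h\<close>, a subgroup of the
  soluble group \<open>H\<close>, because \<open>h\<close> need not be onto.\<close>

lemma exists_path_mod_kernel:
  assumes fin: "finite (carrier H)" and sol: "solvable H"
    and c: "a1 \<in> carrier G" "a2 \<in> carrier G" "b1 \<in> carrier G" "b2 \<in> carrier G"
    and gen: "G.generates_mod (kernel G H h) a1 b1" "G.generates_mod (kernel G H h) a2 b2"
  shows "\<exists>c1\<in>carrier G. \<exists>c2\<in>carrier G. G.generates_mod (kernel G H h) a1 c1 \<and>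
    G.generates_mod (kernel G H h) c1 c2 \<and> G.generates_mod (kernel G H h) a2 c2"
proof -
  let ?Q = "H\<lparr>carrier := h ` carrier G\<rparr>"
  have sub: "subgroup (h ` carrier G) H" by (rule img_is_subgroup)
  interpret Q: group ?Q by (rule H.subgroup_imp_group[OF sub])
  have "group_hom ?Q H (\<lambda>x. x)"
    using subgroup.mem_carrier[OF sub]
    by (intro group_hom.intro group_hom_axioms.intro Q.is_group H.is_group homI) auto
  then have solQ: "solvable ?Q"
    by (rule group_hom.inj_hom_imp_solvable) (use sol in \<open>auto simp: inj_on_def\<close>)
  have finQ: "finite (carrier ?Q)" using finite_subset[OF subgroup.subset[OF sub] fin] by simp
  have con: "generate ?Q {h x, h y} = generate H {h x, h y}" if "x \<in> carrier G" "y \<in> carrier G" for x y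
    using that by (intro H.generate_consistent[OF _ sub]) auto
  have iff: "G.generates_mod (kernel G H h) x y \<longleftrightarrow> generate ?Q {h x, h y} = carrier ?Q"
    if "x \<in> carrier G" "y \<in> carrier G" for x y
    using generates_mod_kernel_iff[OF that] con[OF that] by simp
  have "\<exists>d1\<in>carrier ?Q. \<exists>d2\<in>carrier ?Q. generate ?Q {h a1, d1} = carrier ?Q \<and>
      generate ?Q {d1, d2} = carrier ?Q \<and> generate ?Q {h a2, d2} = carrier ?Q"
    by (rule Q.solvable_generating_path[OF finQ solQ, of _ _ "h b1" "h b2"]) (use c gen iff in auto)
  then obtain c1 c2 where cc: "c1 \<in> carrier G" "c2 \<in> carrier G" and "generate ?Q {h a1, h c1} = carrier ?Q"
      "generate ?Q {h c1, h c2} = carrier ?Q" "generate ?Q {h a2, h c2} = carrier ?Q"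
    by auto
  then show ?thesis using iff c by blast
qed

end

text \<open>The pairs \<open>(c1, c2)\<close> that complete a path modulo the kernel of
  \<open>q i\<close> form a nonempty closed set \<open>X i\<close>, and these sets shrink along the
  directed index set. Compactness gives a common pair, and generation modulo all kernels is
  topological generation.\<close>

lemma prosoluble_generating_path:
  assumes pros: "prosoluble TYPE('i) TYPE('h) G T"
    and a: "a1 \<in> nonisolated G T" "a2 \<in> nonisolated G T"
  shows "\<exists>c1\<in>carrier G. \<exists>c2\<in>carrier G. top_generates G T {a1, c1} \<and>
    top_generates G T {c1, c2} \<and> top_generates G T {a2, c2}"
proof -
  from prosoluble_projections[OF pros]
  obtain I :: "'i set" and r and H :: "'i \<Rightarrow> 'h monoid" and q :: "'i \<Rightarrow> 'a \<Rightarrow> 'h" where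
    G: "group G" and top: "topspace T = carrier G" and comp: "compact_space T"
    and bound: "\<And>J. finite J \<Longrightarrow> J \<subseteq> I \<Longrightarrow> \<exists>k\<in>I. \<forall>j\<in>J. (j, k) \<in> r"
    and H: "\<And>i. i \<in> I \<Longrightarrow> group (H i)" "\<And>i. i \<in> I \<Longrightarrow> finite (carrier (H i))" "\<And>i. i \<in> I \<Longrightarrow> solvable (H i)"
    and hom: "\<And>i. i \<in> I \<Longrightarrow> q i \<in> hom G (H i)"
    and cont: "\<And>i. i \<in> I \<Longrightarrow> continuous_map T (discrete_topology (carrier (H i))) (q i)"
    and down: "\<And>i j x y. (i, j) \<in> r \<Longrightarrow> x \<in> carrier G \<Longrightarrow> y \<in> carrier G \<Longrightarrow> q j x = q j y \<Longrightarrow> q i x = q i y"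
    and base: "\<And>U x. openin T U \<Longrightarrow> x \<in> U \<Longrightarrow> \<exists>i\<in>I. \<forall>y\<in>carrier G. q i y = q i x \<longrightarrow> y \<in> U"
    by blast
  interpret G: group G by (rule G)
  have gh: "group_hom G (H i) (q i)" if "i \<in> I" for i
    using H(1)[OF that] hom[OF that] G by (intro group_hom.intro group_hom_axioms.intro)
  define N where "N i = kernel G (H i) (q i)" for i
  have fib: "q i x = q i y \<longleftrightarrow> inv\<^bsub>G\<^esub> x \<otimes>\<^bsub>G\<^esub> y \<in> N i" if "i \<in> I" "x \<in> carrier G" "y \<in> carrier G" for i x y
  proof -
    interpret group_hom G "H i" "q i" using gh that(1) .
    have "q i (inv\<^bsub>G\<^esub> x \<otimes>\<^bsub>G\<^esub> y) = inv\<^bsub>H i\<^esub> q i x \<otimes>\<^bsub>H i\<^esub> q i y" using that by simp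
    then show ?thesis
      using that by (auto simp: N_def kernel_def H.inv_solve_left')
  qed
  have openfib: "openin T {z \<in> carrier G. q i z = h}" if "i \<in> I" "h \<in> carrier (H i)" for i h
    using openin_continuous_map_preimage[OF cont[OF that(1)], of "{h}"] that(2) top by simp
  have closedfib: "closedin T {z \<in> carrier G. q i z = h}" if "i \<in> I" "h \<in> carrier (H i)" for i h
    using closedin_continuous_map_preimage[OF cont[OF that(1)], of "{h}"] that(2) top by simp
  have NG: "N i \<subseteq> carrier G" for i by (auto simp: N_def kernel_def)
  have topgen: "top_generates G T {x, y} \<longleftrightarrow> (\<forall>i\<in>I. G.generates_mod (N i) x y)"
    if xy: "x \<in> carrier G" "y \<in> carrier G" for x y
  proof
    assume tg: "top_generates G T {x, y}"
    show "\<forall>i\<in>I. G.generates_mod (N i) x y"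
    proof
      fix i assume i: "i \<in> I"
      let ?K = "generate G ({x, y} \<union> N i)"
      have K: "subgroup ?K G" using xy NG by (intro G.generate_is_subgroup) auto
      have "g \<in> ?K" if g: "g \<in> carrier G" for g
      proof -
        have "q i g \<in> carrier (H i)" using hom[OF i] g by (auto simp: hom_def)
        then have op: "openin T {z \<in> carrier G. q i z = q i g}" by (rule openfib[OF i])
        have clo: "g \<in> T closure_of (generate G {x, y})" using tg g by (simp add: top_generates_def)
        have "g \<in> {z \<in> carrier G. q i z = q i g}" using g by simp
        from iffD1[OF in_closure_of clo, THEN conjunct2, rule_format, OF conjI[OF this op]]
        obtain z where z: "z \<in> generate G {x, y}" "z \<in> carrier G" "q i z = q i g" by blast
        have "generate G {x, y} \<subseteq> ?K" by (rule G.mono_generate) blast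
        then have "z \<in> ?K" using z(1) by blast
        moreover have "inv\<^bsub>G\<^esub> z \<otimes>\<^bsub>G\<^esub> g \<in> N i" using fib[OF i z(2) g] z(3) by simp
        then have "inv\<^bsub>G\<^esub> z \<otimes>\<^bsub>G\<^esub> g \<in> ?K" by (auto intro: generate.incl)
        ultimately have "z \<otimes>\<^bsub>G\<^esub> (inv\<^bsub>G\<^esub> z \<otimes>\<^bsub>G\<^esub> g) \<in> ?K" by (rule subgroup.m_closed[OF K])
        then show ?thesis using z(2) g by (simp add: G.m_assoc[symmetric])
      qed
      then show "G.generates_mod (N i) x y" using subgroup.subset[OF K] unfolding G.generates_mod_def by blast
    qed
  next
    assume gen: "\<forall>i\<in>I. G.generates_mod (N i) x y"
    have s: "subgroup (generate G {x, y}) G" using xy by (intro G.generate_is_subgroup) auto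
    have "g \<in> T closure_of (generate G {x, y})" if g: "g \<in> carrier G" for g
      unfolding in_closure_of
    proof (intro conjI allI impI)
      show "g \<in> topspace T" using g top by simp
      fix U assume "g \<in> U \<and> openin T U"
      then obtain i where i: "i \<in> I" "\<forall>z\<in>carrier G. q i z = q i g \<longrightarrow> z \<in> U" using base by blast
      interpret group_hom G "H i" "q i" using gh i(1) .
      have "q i ` carrier G = q i ` generate G {x, y}"
        using generates_mod_kernel_iff[OF xy] gen i(1) generate_img[of "{x, y}"] xy by (simp add: N_def)
      then obtain z where z: "z \<in> generate G {x, y}" "q i g = q i z" using g by blast
      then show "\<exists>z. z \<in> generate G {x, y} \<and> z \<in> U" using i(2) subgroup.mem_carrier[OF s z(1)] by auto
    qed
    moreover have "T closure_of (generate G {x, y}) \<subseteq> carrier G" using closure_of_subset_topspace[of T] top by simp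
    ultimately show "top_generates G T {x, y}" unfolding top_generates_def by blast
  qed
  obtain b1 b2 where c: "a1 \<in> carrier G" "a2 \<in> carrier G" "b1 \<in> carrier G" "b2 \<in> carrier G"
    and tb: "top_generates G T {a1, b1}" "top_generates G T {a2, b2}"
    using a unfolding nonisolated_def by blast
  define X where "X i = {(x, y) \<in> carrier G \<times> carrier G. G.generates_mod (N i) a1 x \<and>
    G.generates_mod (N i) x y \<and> G.generates_mod (N i) a2 y}" for i
  have ne: "X i \<noteq> {}" if i: "i \<in> I" for i
  proof -
    have "G.generates_mod (N i) a1 b1" "G.generates_mod (N i) a2 b2"
      using topgen[OF c(1,3)] topgen[OF c(2,4)] tb i by blast+
    then show ?thesis
      using group_hom.exists_path_mod_kernel[OF gh[OF i] H(2,3)[OF i] c] unfolding X_def N_def by blast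
  qed
  have mono: "X j \<subseteq> X i" if ij: "(i, j) \<in> r" "i \<in> I" "j \<in> I" for i j
  proof -
    have "N j \<subseteq> N i"
    proof
      fix n assume n: "n \<in> N j"
      have nG: "n \<in> carrier G" using n NG by blast
      have "q j \<one>\<^bsub>G\<^esub> = q j n" using fib[OF ij(3) G.one_closed nG] n nG by simp
      then have "q i \<one>\<^bsub>G\<^esub> = q i n" using down[OF ij(1) G.one_closed nG] by blast
      then show "n \<in> N i" using fib[OF ij(2) G.one_closed nG] nG by simp
    qed
    then show ?thesis using G.generates_mod_mono[OF _ NG] c unfolding X_def by blast
  qed
  have closed: "closedin (prod_topology T T) (X i)" if i: "i \<in> I" for i
  proof -
    let ?F = "\<lambda>h. {z \<in> carrier G. q i z = h}"
    let ?S = "(\<lambda>(x, y). (q i x, q i y)) ` X i"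
    interpret group_hom G "H i" "q i" using gh i .
    have X_iff: "(x, y) \<in> X i \<longleftrightarrow> generate (H i) {q i a1, q i x} = q i ` carrier G \<and>
        generate (H i) {q i x, q i y} = q i ` carrier G \<and> generate (H i) {q i a2, q i y} = q i ` carrier G"
      if "x \<in> carrier G" "y \<in> carrier G" for x y
      using that c by (simp add: X_def N_def generates_mod_kernel_iff)
    have XG: "X i \<subseteq> carrier G \<times> carrier G" by (auto simp: X_def)
    have SH: "?S \<subseteq> carrier (H i) \<times> carrier (H i)" using XG by auto
    \<comment> \<open>Membership depends only on the images under \<open>q i\<close>, so
      \<open>X i\<close> is a finite union of products of closed fibres.\<close>
    have "X i = (\<Union>p\<in>?S. ?F (fst p) \<times> ?F (snd p))"
    proof
      show "X i \<subseteq> (\<Union>p\<in>?S. ?F (fst p) \<times> ?F (snd p))" using XG by fastforce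
      show "(\<Union>p\<in>?S. ?F (fst p) \<times> ?F (snd p)) \<subseteq> X i"
      proof clarsimp
        fix x y x' y'
        assume "(x', y') \<in> X i" "x \<in> carrier G" "y \<in> carrier G" "q i x = q i x'" "q i y = q i y'"
        then show "(x, y) \<in> X i" using XG X_iff[of x y] X_iff[of x' y'] by auto
      qed
    qed
    moreover have "closedin (prod_topology T T) (\<Union>p\<in>?S. ?F (fst p) \<times> ?F (snd p))"
    proof (rule closedin_Union)
      have "finite ?S" using SH H(2)[OF i] finite_subset by blast
      then show "finite ((\<lambda>p. ?F (fst p) \<times> ?F (snd p)) ` ?S)" by (rule finite_imageI)
      fix C assume "C \<in> (\<lambda>p. ?F (fst p) \<times> ?F (snd p)) ` ?S"
      then obtain p where p: "p \<in> ?S" "C = ?F (fst p) \<times> ?F (snd p)" by blast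
      have "fst p \<in> carrier (H i)" "snd p \<in> carrier (H i)" using p(1) SH by auto
      then show "closedin (prod_topology T T) C" using closedfib[OF i] p(2) by (simp add: closedin_prod_Times_iff)
    qed
    ultimately show ?thesis by simp
  qed
  have "compact_space (prod_topology T T)" using comp by (simp add: compact_space_prod_topology)
  moreover have "\<Inter>\<F> \<noteq> {}" if F: "finite \<F>" "\<F> \<subseteq> X ` I" for \<F>
  proof -
    obtain J where J: "finite J" "J \<subseteq> I" "\<F> = X ` J" using F finite_subset_image by metis
    obtain k where k: "k \<in> I" "\<forall>j\<in>J. (j, k) \<in> r" using bound[OF J(1,2)] by blast
    have "X k \<subseteq> \<Inter>\<F>" using mono k J by blast
    then show ?thesis using ne[OF k(1)] by blast
  qed
  moreover have "\<forall>C\<in>X ` I. closedin (prod_topology T T) C" using closed by blast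
  ultimately have "\<Inter>(X ` I) \<noteq> {}" unfolding compact_space_fip by blast
  then obtain p where p: "p \<in> \<Inter>(X ` I)" by blast
  obtain c1 c2 where "p = (c1, c2)" by (cases p)
  then have cX: "(c1, c2) \<in> X i" if "i \<in> I" for i using p that by blast
  obtain k where "k \<in> I" using bound[of "{}"] by blast
  then have cG: "c1 \<in> carrier G" "c2 \<in> carrier G" using cX[of k] by (auto simp: X_def)
  have "G.generates_mod (N i) a1 c1" "G.generates_mod (N i) c1 c2" "G.generates_mod (N i) a2 c2" if "i \<in> I" for i
    using cX[OF that] by (auto simp: X_def)
  then show ?thesis using topgen[OF c(1) cG(1)] topgen[OF cG] topgen[OF c(2) cG(2)] cG by blast
qed

theorem theorem3:
  fixes G :: "('a, 'm) monoid_scheme" and T :: "'a topology"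
  assumes "prosoluble TYPE('i) TYPE('h) G T"
    and "two_generated G T"
  shows "Digraph_Component.connected (Delta_graph G T) \<and> graph_diameter (Delta_graph G T) \<le> 3"
proof -
  interpret D: wf_digraph "Delta_graph G T" by (rule wf_digraph_Delta_graph)
  have ends: "tail (Delta_graph G T) = fst" "head (Delta_graph G T) = snd"
    by (simp_all add: Delta_graph_def generating_graph_def)
  \<comment> \<open>A walk may repeat vertices, so one form of length exactly three also covers
    equal or adjacent \<open>u\<close> and \<open>v\<close>.\<close>
  have walk: "\<exists>p. D.awalk u p v \<and> length p = 3" if uv: "u \<in> nonisolated G T" "v \<in> nonisolated G T" for u v
  proof -
    obtain c1 c2 where c: "c1 \<in> carrier G" "c2 \<in> carrier G"
      "top_generates G T {u, c1}" "top_generates G T {c1, c2}" "top_generates G T {v, c2}"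
      using prosoluble_generating_path[OF assms(1) uv] by blast
    have "u \<in> carrier G" "v \<in> carrier G" using uv by (auto simp: nonisolated_def)
    then have "D.awalk u [(u, c1), (c1, c2), (c2, v)] v"
      using c uv by (simp add: D.awalk_simps arcs_Delta_graph ends insert_commute)
    then show ?thesis by (intro exI conjI) auto
  qed
  have "D.\<mu> (\<lambda>_. 1) u v \<le> 3" if uv: "u \<in> nonisolated G T" "v \<in> nonisolated G T" for u v
  proof -
    obtain p where p: "D.awalk u p v" "length p = 3" using walk[OF uv] by blast
    have "D.\<mu> (\<lambda>_. 1) u v \<le> ereal (D.awalk_cost (\<lambda>_. 1) p)" using p(1) by (rule D.min_cost_le_walk_cost)
    also have "D.awalk_cost (\<lambda>_. 1) p = 3" using p(2) by (simp add: D.awalk_cost_def sum_list_triv)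
    finally show ?thesis by simp
  qed
  then have "graph_diameter (Delta_graph G T) \<le> 3"
    unfolding graph_diameter_def by (auto intro!: SUP_least)
  moreover have "Digraph_Component.connected (Delta_graph G T)"
    unfolding Digraph_Component.connected_def
  proof (rule strongly_connectedI)
    \<comment> \<open>Two-generation supplies a vertex, as connectedness here includes that the
      graph is nonempty.\<close>
    have "nonisolated G T \<noteq> {}" using assms(2) unfolding two_generated_def nonisolated_def by blast
    then show "verts (with_proj (mk_symmetric (Delta_graph G T))) \<noteq> {}" by (simp add: mk_symmetric_def)
    fix u v
    assume "u \<in> verts (with_proj (mk_symmetric (Delta_graph G T)))" "v \<in> verts (with_proj (mk_symmetric (Delta_graph G T)))"
    then have uv: "u \<in> nonisolated G T" "v \<in> nonisolated G T" by (simp_all add: mk_symmetric_def)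
    obtain p where "D.awalk u p v" using walk[OF uv] by blast
    then have "u \<rightarrow>\<^sup>*\<^bsub>Delta_graph G T\<^esub> v" by (rule D.reachable_awalkI)
    then show "u \<rightarrow>\<^sup>*\<^bsub>with_proj (mk_symmetric (Delta_graph G T))\<^esub> v" by (rule D.reachable_mk_symmetricI)
  qed
  ultimately show ?thesis by blast
qed

end
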